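(* Let $d\ge 1$, $n\ge d+1$ and $r\ge 2n-d$ be integers. The homogeneous prime ideal in $\mathbb{R}[m_0,m_1,\ldots,m_r]$ that defines the moment variety $\mathcal{M}_{\{\!\{r\}\!\}}(d,n)\subset\mathbb{P}^r$ is generated by the maximal minors of the Hankel matrix with $n+1$ rows and $r+d-n+1$ columns $$\begin{pmatrix} c_0&c_1&\cdots&c_n&c_{n+1}&\cdots&c_{r+d-n}\\ c_1&c_2&\cdots&c_{n+1}&c_{n+2}&\cdots&c_{r+d-n+1}\\ \vdots&\vdots&&\vdots&\vdots&&\vdots\\ c_n&c_{n+1}&\cdots&c_{2n}&c_{2n+1}&\cdots&c_{r+d}\end{pmatrix},$$ where $c_0=c_1=\cdots=c_{d-1}=0$ and $c_{i+d}=\binom{d+i}{d}m_i$ for $i=0,1,\ldots,r$. These minors form a reduced Gröbner basis with respect to any antidiagonal term order, with initial monomial ideal $\langle m_{n-d},m_{n-d+1},\ldots,m_{r-n}\rangle^{n+1}$. The degree of $\mathcal{M}_{\{\!\{r\}\!\}}(d,n)$ equals $\binom{r-n+d+1}{n}$.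
   Context: The variety $\mathcal{M}_{\{\!\{r\}\!\}}(d,n)$, called the $r$-th moment variety of polytopal measures of type $(d,n)$, is the Zariski closure in $\mathbb{P}^r$ (with coordinates $m_0,\ldots,m_r$) of the set of points $(m_0:m_1:\cdots:m_r)$ given parametrically by $$\sum_{i=0}^\infty\binom{d+i}{d}m_i t^i=\frac{A_{n-d-1}(t)}{(1-u_1t)(1-u_2t)\cdots(1-u_nt)},$$ where $u_1,\ldots,u_n$ are arbitrary and $A_{n-d-1}(t)$ ranges over polynomials of degree at most $n-d-1$ with constant coefficient $1$. An antidiagonal term order is a monomial order for which the leading monomial of each maximal minor of the Hankel matrix is (up to a scalar) the product of the entries on its antidiagonal; for example the reverse lexicographic order with $m_0>m_1>\cdots>m_r$.
   Formalization: "Reduced Gröbner basis" is replaced by "minimal Gröbner basis": the minors are never monic, and for d=1, n=2, r=5 the minor of columns 1,2,3 (counted from 0) has the non-leading term 2c_2c_3c_4, a multiple of the leading term of another minor. *)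

theory Defs
  imports
    "HOL-Library.Poly_Mapping"
    "HOL-Algebra.Ideal_Product"
    "HOL-Computational_Algebra.Formal_Power_Series"
    "HOL-Computational_Algebra.Polynomial_FPS"
    "Jordan_Normal_Form.Determinant"
    "Jordan_Normal_Form.DL_Submatrix"
begin

section \<open>Polynomials in the variables \<open>m\<^sub>0, \<dots>, m\<^sub>r\<close>\<close>

type_synonym monomial = "nat \<Rightarrow>\<^sub>0 nat"
type_synonym 'a mpoly = "monomial \<Rightarrow>\<^sub>0 'a"

definition monomials :: "nat \<Rightarrow> monomial set" where
  "monomials r = {s. Poly_Mapping.keys s \<subseteq> {..r}}"

definition mpoly_ring :: "nat \<Rightarrow> ('a::comm_ring_1) mpoly ring" where
  "mpoly_ring r =
     \<lparr>carrier = {f. Poly_Mapping.keys f \<subseteq> monomials r},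
      monoid.mult = (*), one = 1, zero = 0, add = (+)\<rparr>"

definition mvar :: "nat \<Rightarrow> ('a::comm_ring_1) mpoly" where
  "mvar i = Poly_Mapping.single (Poly_Mapping.single i 1) 1"

definition mconst :: "'a::comm_ring_1 \<Rightarrow> 'a mpoly" where
  "mconst a = Poly_Mapping.single 0 a"

definition mscale :: "'a::comm_ring_1 \<Rightarrow> 'a mpoly \<Rightarrow> 'a mpoly" where
  "mscale a f = mconst a * f"

definition mono_degree :: "monomial \<Rightarrow> nat" where
  "mono_degree s = (\<Sum>i\<in>Poly_Mapping.keys s. Poly_Mapping.lookup s i)"

definition homogeneous :: "nat \<Rightarrow> ('a::zero) mpoly \<Rightarrow> bool" where
  "homogeneous k f \<longleftrightarrow> (\<forall>s\<in>Poly_Mapping.keys f. mono_degree s = k)"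

definition mpoly_eval :: "(nat \<Rightarrow> 'a) \<Rightarrow> ('a::comm_ring_1) mpoly \<Rightarrow> 'a" where
  "mpoly_eval v f =
     (\<Sum>s\<in>Poly_Mapping.keys f.
        Poly_Mapping.lookup f s * (\<Prod>i\<in>Poly_Mapping.keys s. v i ^ Poly_Mapping.lookup s i))"

definition homogeneous_ideal :: "nat \<Rightarrow> ('a::comm_ring_1) mpoly set \<Rightarrow> bool" where
  "homogeneous_ideal r I \<longleftrightarrow>
     ideal I (mpoly_ring r) \<and> I = genideal (mpoly_ring r) {f \<in> I. \<exists>k. homogeneous k f}"

lemma mpoly_ring_cring: "cring (mpoly_ring r :: ('a::comm_ring_1) mpoly ring)"
proof -
  let ?C = "{f :: 'a mpoly. Poly_Mapping.keys f \<subseteq> monomials r}"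
  have add: "f + g \<in> ?C" if "f \<in> ?C" "g \<in> ?C" for f g
    using that keys_add[of f g] by auto
  have mult: "f * g \<in> ?C" if "f \<in> ?C" "g \<in> ?C" for f g
  proof -
    have "s + t \<in> monomials r" if "s \<in> monomials r" "t \<in> monomials r" for s t
      using that keys_add[of s t] by (auto simp: monomials_def)
    thus ?thesis using that keys_mult[of f g] by fastforce
  qed
  have neg: "- f \<in> ?C" if "f \<in> ?C" for f
    using that by simp
  have one: "(1 :: 'a mpoly) \<in> ?C"
    by (simp add: monomials_def)
  show ?thesis
  proof (rule cringI)
    show "abelian_group (mpoly_ring r :: 'a mpoly ring)"
    proof (rule abelian_groupI)
      fix f :: "'a mpoly" assume "f \<in> carrier (mpoly_ring r)"
      thus "\<exists>g\<in>carrier (mpoly_ring r). g \<oplus>\<^bsub>mpoly_ring r\<^esub> f = \<zero>\<^bsub>mpoly_ring r\<^esub>"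
        using neg by (intro bexI[of _ "- f"]) (auto simp: mpoly_ring_def)
    qed (use add in \<open>auto simp: mpoly_ring_def algebra_simps\<close>)
    show "Group.comm_monoid (mpoly_ring r :: 'a mpoly ring)"
      using mult one
      by (intro comm_monoidI) (auto simp: mpoly_ring_def algebra_simps)
  qed (auto simp: mpoly_ring_def algebra_simps)
qed

lemma mscale_vector_space: "vector_space (mscale :: 'a::field \<Rightarrow> 'a mpoly \<Rightarrow> 'a mpoly)"
  by unfold_locales
     (auto simp: mscale_def mconst_def algebra_simps single_add mult_single
           simp flip: mult.assoc)

section \<open>Projective space and the Zariski topology\<close>

text \<open>A point of \<open>\<bbbP>\<^sup>r\<close> is the set of all its homogeneous coordinate vectors; a coordinate
  vector is a function on the naturals that vanishes beyond \<open>r\<close>.\<close>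

definition proj_point :: "(nat \<Rightarrow> 'k::field) \<Rightarrow> (nat \<Rightarrow> 'k) set" where
  "proj_point v = {(\<lambda>i. c * v i) | c. c \<noteq> 0}"

definition proj_space :: "nat \<Rightarrow> (nat \<Rightarrow> 'k::field) set set" where
  "proj_space r = {proj_point v | v. (\<exists>i. v i \<noteq> 0) \<and> (\<forall>i>r. v i = 0)}"

definition zero_locus :: "nat \<Rightarrow> ('k::field) mpoly set \<Rightarrow> (nat \<Rightarrow> 'k) set set" where
  "zero_locus r F = {P \<in> proj_space r. \<forall>f\<in>F. \<forall>v\<in>P. mpoly_eval v f = 0}"

definition zariski_closed :: "nat \<Rightarrow> (nat \<Rightarrow> 'k::field) set set \<Rightarrow> bool" where
  "zariski_closed r X \<longleftrightarrow>
     (\<exists>F \<subseteq> carrier (mpoly_ring r). (\<forall>f\<in>F. \<exists>k. homogeneous k f) \<and> X = zero_locus r F)"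

definition zariski_closure :: "nat \<Rightarrow> (nat \<Rightarrow> 'k::field) set set \<Rightarrow> (nat \<Rightarrow> 'k) set set" where
  "zariski_closure r S = \<Inter> {X. zariski_closed r X \<and> S \<subseteq> X}"

definition vanishing_ideal :: "nat \<Rightarrow> (nat \<Rightarrow> 'k::field) set set \<Rightarrow> 'k mpoly set" where
  "vanishing_ideal r X =
     {f \<in> carrier (mpoly_ring r). \<forall>P\<in>X. \<forall>v\<in>P. mpoly_eval v f = 0}"

abbreviation extend_scalars :: "real mpoly \<Rightarrow> ('k::real_field) mpoly" where
  "extend_scalars f \<equiv> Poly_Mapping.map of_real f"

definition real_vanishing_ideal :: "nat \<Rightarrow> (nat \<Rightarrow> 'k::real_field) set set \<Rightarrow> real mpoly set" where
  "real_vanishing_ideal r X =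
     {f \<in> carrier (mpoly_ring r). extend_scalars f \<in> vanishing_ideal r X}"

section \<open>Degree of a projective variety\<close>

text \<open>The degree is read off the Hilbert polynomial of the homogeneous coordinate ring: if it has
  degree \<open>e\<close> and leading coefficient \<open>a\<close>, then the degree of the variety is \<open>e! a\<close>.\<close>

definition forms :: "nat \<Rightarrow> nat \<Rightarrow> ('a::comm_ring_1) mpoly set" where
  "forms r k = {f \<in> carrier (mpoly_ring r). homogeneous k f}"

definition hilbert_function :: "nat \<Rightarrow> ('k::field) mpoly set \<Rightarrow> nat \<Rightarrow> nat" where
  "hilbert_function r I k =
     vector_space.dim mscale (forms r k :: 'k mpoly set) - vector_space.dim mscale (forms r k \<inter> I)"

definition hilbert_polynomial :: "nat \<Rightarrow> ('k::field) mpoly set \<Rightarrow> rat poly \<Rightarrow> bool" where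
  "hilbert_polynomial r I p \<longleftrightarrow>
     (\<forall>\<^sub>F k in sequentially. of_nat (hilbert_function r I k) = poly p (of_nat k))"

definition has_proj_degree :: "nat \<Rightarrow> (nat \<Rightarrow> 'k::field) set set \<Rightarrow> nat \<Rightarrow> bool" where
  "has_proj_degree r X D \<longleftrightarrow>
     (\<exists>p. hilbert_polynomial r (vanishing_ideal r X) p \<and>
          of_nat D = fact (Polynomial.degree p) * lead_coeff p)"

section \<open>Monomial orders and Groebner bases\<close>

text \<open>On finitely many variables a linear order that is compatible with multiplication and has
  \<open>1\<close> as least element is automatically a well-order. Exponent vectors are additive, so the
  monomial \<open>1\<close> is written \<open>0\<close>.\<close>

definition monomial_order :: "nat \<Rightarrow> monomial rel \<Rightarrow> bool" where
  "monomial_order r ord \<longleftrightarrow>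
     linear_order_on (monomials r) ord \<and>
     (\<forall>s\<in>monomials r. (0, s) \<in> ord) \<and>
     (\<forall>s t. \<forall>u\<in>monomials r. (s, t) \<in> ord \<longrightarrow> (s + u, t + u) \<in> ord)"

definition is_lead_monomial :: "monomial rel \<Rightarrow> ('a::zero) mpoly \<Rightarrow> monomial \<Rightarrow> bool" where
  "is_lead_monomial ord f s \<longleftrightarrow>
     s \<in> Poly_Mapping.keys f \<and> (\<forall>t\<in>Poly_Mapping.keys f. (t, s) \<in> ord)"

definition lead_monomials :: "monomial rel \<Rightarrow> ('a::zero) mpoly set \<Rightarrow> monomial set" where
  "lead_monomials ord F = {s. \<exists>f\<in>F. is_lead_monomial ord f s}"

definition monomial_ideal :: "nat \<Rightarrow> monomial set \<Rightarrow> ('a::comm_ring_1) mpoly set" where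
  "monomial_ideal r S = genideal (mpoly_ring r) ((\<lambda>s. Poly_Mapping.single s 1) ` S)"

definition initial_ideal :: "nat \<Rightarrow> monomial rel \<Rightarrow> ('a::comm_ring_1) mpoly set \<Rightarrow> 'a mpoly set" where
  "initial_ideal r ord I = monomial_ideal r (lead_monomials ord I)"

definition groebner_basis ::
  "nat \<Rightarrow> monomial rel \<Rightarrow> ('a::comm_ring_1) mpoly set \<Rightarrow> 'a mpoly set \<Rightarrow> bool" where
  "groebner_basis r ord I G \<longleftrightarrow>
     finite G \<and> G \<subseteq> I \<and> initial_ideal r ord I = monomial_ideal r (lead_monomials ord G)"

text \<open>No element is redundant: there is no zero element, and no leading monomial divides the
  leading monomial of another element. This does not ask for leading coefficients \<open>1\<close>, nor that
  the non-leading terms be standard. The Hankel minors considered below do not have the latter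
  property: for \<open>d = 1\<close>, \<open>n = 2\<close>, \<open>r = 5\<close> the minor of columns \<open>1, 2, 3\<close> (counted from \<open>0\<close>)
  contains \<open>2 c\<^sub>2 c\<^sub>3 c\<^sub>4\<close>, a multiple of the leading term of the minor of columns \<open>0, 2, 4\<close>.\<close>

definition minimal_groebner_basis ::
  "nat \<Rightarrow> monomial rel \<Rightarrow> ('a::comm_ring_1) mpoly set \<Rightarrow> 'a mpoly set \<Rightarrow> bool" where
  "minimal_groebner_basis r ord I G \<longleftrightarrow>
     groebner_basis r ord I G \<and> 0 \<notin> G \<and>
     (\<forall>f\<in>G. \<forall>g\<in>G. \<forall>s t. f \<noteq> g \<longrightarrow> is_lead_monomial ord f s \<longrightarrow> is_lead_monomial ord g t \<longrightarrow>
        \<not> (\<exists>u. t = s + u))"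

section \<open>Moment varieties of polytopal measures\<close>

definition moment_points :: "nat \<Rightarrow> nat \<Rightarrow> nat \<Rightarrow> (nat \<Rightarrow> 'k::field) set set" where
  "moment_points d n r =
     {proj_point (\<lambda>i. if i \<le> r then m i else 0) | m.
        \<exists>(u :: nat \<Rightarrow> 'k) (A :: 'k poly).
          Polynomial.degree A \<le> n - d - 1 \<and> Polynomial.coeff A 0 = 1 \<and>
          Abs_fps (\<lambda>i. of_nat ((d + i) choose d) * m i) =
            fps_of_poly A / (\<Prod>j = 1..n. 1 - fps_const (u j) * fps_X)}"

definition moment_variety :: "nat \<Rightarrow> nat \<Rightarrow> nat \<Rightarrow> (nat \<Rightarrow> 'k::field) set set" where
  "moment_variety d n r = zariski_closure r (moment_points d n r)"

definition hankel_entry :: "nat \<Rightarrow> nat \<Rightarrow> ('a::comm_ring_1) mpoly" where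
  "hankel_entry d k = (if k < d then 0 else mconst (of_nat (k choose d)) * mvar (k - d))"

definition hankel_matrix :: "nat \<Rightarrow> nat \<Rightarrow> nat \<Rightarrow> ('a::comm_ring_1) mpoly mat" where
  "hankel_matrix d n r = mat (n + 1) (r + d - n + 1) (\<lambda>(i, j). hankel_entry d (i + j))"

definition maximal_column_sets :: "nat \<Rightarrow> nat \<Rightarrow> nat \<Rightarrow> nat set set" where
  "maximal_column_sets d n r = {J. J \<subseteq> {..<r + d - n + 1} \<and> card J = n + 1}"

definition hankel_submatrix :: "nat \<Rightarrow> nat \<Rightarrow> nat \<Rightarrow> nat set \<Rightarrow> ('a::comm_ring_1) mpoly mat" where
  "hankel_submatrix d n r J = submatrix (hankel_matrix d n r) UNIV J"

definition hankel_minors :: "nat \<Rightarrow> nat \<Rightarrow> nat \<Rightarrow> ('a::comm_ring_1) mpoly set" where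
  "hankel_minors d n r = (\<lambda>J. det (hankel_submatrix d n r J)) ` maximal_column_sets d n r"

definition antidiagonal_product :: "('a::comm_ring_1) mpoly mat \<Rightarrow> 'a mpoly" where
  "antidiagonal_product M = (\<Prod>i<dim_row M. M $$ (i, dim_row M - 1 - i))"

definition antidiagonal_order :: "nat \<Rightarrow> nat \<Rightarrow> nat \<Rightarrow> monomial rel \<Rightarrow> bool" where
  "antidiagonal_order d n r ord \<longleftrightarrow>
     monomial_order r ord \<and>
     (\<forall>J\<in>maximal_column_sets d n r. \<exists>s a.
        is_lead_monomial ord (det (hankel_submatrix d n r J) :: real mpoly) s \<and>
        a \<noteq> (0::real) \<and> antidiagonal_product (hankel_submatrix d n r J) = Poly_Mapping.single s a)"

end

theory Submission
  imports Defs
begin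

text \<open>
  All sequences \<open>c\<close> coming from the parametrisation satisfy a linear recurrence of order \<open>n\<close>, so the
  maximal Hankel minors vanish on the variety; each minor has its antidiagonal product as the unique
  term of least weight for the weights \<open>k\<^sup>2\<close> of \<open>c\<^sub>k\<close>, and these products are all monomials of degree
  \<open>n + 1\<close> in the middle variables \<open>m\<^bsub>n-d\<^esub>, \<dots>, m\<^bsub>r-n\<^esub>\<close>. Hence every polynomial is, modulo the minors, a
  combination of standard monomials, those of degree at most \<open>n\<close> in the middle variables. Everything
  follows once the standard monomials are known to be linearly independent on the variety.

  For the independence fix the values of the outer variables so that the only nonzero entries among
  the first and the last \<open>n\<close> entries of \<open>c\<close> are \<open>c\<^bsub>n-1\<^esub> = c\<^bsub>r+d\<^esub> = 1\<close>. Over \<open>\<complex>\<close>, the fibre of the variety over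
  this point consists of the exponential sums supported on \<open>n\<close> of the \<open>N = r + d - n + 1\<close>-th roots of
  unity. There are \<open>N choose n\<close> of them, which is also the number of monomials of degree at most \<open>n\<close> in
  the middle variables, and products of linear forms show that these monomials separate them. Since the
  projection to the outer variables is unramified at these points, the lowest Taylor coefficient at the
  base point of a relation between standard monomials must vanish.
\<close>

section \<open>Evaluation and degrees\<close>

text \<open>The cone over the variety has \<open>n\<close> parameters \<open>u\<close> and
  \<open>n - d\<close> initial values, and \<open>2 * n - d\<close> is also the number of outer
  variables. This is why one fibre of the projection to them suffices, provided that it contains as
  many unramified points as there are standard monomials in the middle variables. The base point is
  chosen so that these points can be written down: sequences of period \<open>N\<close> have equal
  first and last \<open>n\<close> entries, and an exponential sum over \<open>N\<close>-th roots of
  unity has period \<open>N\<close>. The values 0, ..., 0, 1 respect the \<open>d\<close> prescribed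
  zeros because \<open>d < n\<close>, and they force every weight of the exponential sum to be
  nonzero, whichever \<open>n\<close> roots are chosen. Nonzero weights are needed twice, for
  separating the points and for moving them in all tangent directions. Roots of unity require
  complex numbers, whereas the theorem concerns real ideals and points over an arbitrary
  \<open>'k::real_field\<close>. Independence is carried from the complex numbers to the reals by
  substituting the imaginary unit into real curves, and from the reals to \<open>'k\<close> by a
  real linear functional applied to coefficients.\<close>

definition mono_eval :: "(nat \<Rightarrow> 'a::comm_monoid_mult) \<Rightarrow> monomial \<Rightarrow> 'a" where
  "mono_eval v s = (\<Prod>i\<in>Poly_Mapping.keys s. v i ^ Poly_Mapping.lookup s i)"

lemma mono_eval_superset:
  assumes "finite A" "Poly_Mapping.keys s \<subseteq> A"
  shows "mono_eval v s = (\<Prod>i\<in>A. v i ^ Poly_Mapping.lookup s i)"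
  unfolding mono_eval_def
  by (rule prod.mono_neutral_left) (use assms in \<open>auto simp: in_keys_iff\<close>)

lemma mono_eval_0 [simp]: "mono_eval v 0 = 1"
  by (simp add: mono_eval_def)

lemma mono_eval_single [simp]: "mono_eval v (Poly_Mapping.single i k) = v i ^ k"
  by (simp add: mono_eval_def)

lemma mono_eval_add: "mono_eval v (s + t) = mono_eval v s * mono_eval v t"
proof -
  let ?A = "Poly_Mapping.keys s \<union> Poly_Mapping.keys t"
  have "mono_eval v (s + t) = (\<Prod>i\<in>?A. v i ^ Poly_Mapping.lookup (s + t) i)"
    by (rule mono_eval_superset) (use keys_add[of s t] in auto)
  also have "\<dots> = mono_eval v s * mono_eval v t"
    by (simp add: mono_eval_superset[of ?A] lookup_add power_add prod.distrib)
  finally show ?thesis .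
qed

lemma mono_eval_sum: "mono_eval v (\<Sum>i\<in>A. s i) = (\<Prod>i\<in>A. mono_eval v (s i))"
  by (induction A rule: infinite_finite_induct) (simp_all add: mono_eval_add)

lemma (in comm_ring_hom) hom_mono_eval: "hom (mono_eval v s) = mono_eval (\<lambda>i. hom (v i)) s"
  by (simp add: mono_eval_def hom_prod hom_power)

lemma mpoly_eq_sum_single:
  "(\<Sum>s\<in>Poly_Mapping.keys f. Poly_Mapping.single s (Poly_Mapping.lookup f s)) = f"
  by (rule poly_mapping_eqI)
     (auto simp: lookup_sum lookup_single when_def in_keys_iff)

text \<open>The coefficient map \<open>h\<close> is separate from the point \<open>v\<close> because
  the target ring varies: the base field, an extension of the reals, univariate polynomials for
  curves, polynomials over polynomials for Taylor expansions, and the polynomial ring itself for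
  \<open>extend_scalars\<close>.\<close>

definition mpoly_eval_with ::
  "('a::comm_ring_1 \<Rightarrow> 'b::comm_ring_1) \<Rightarrow> (nat \<Rightarrow> 'b) \<Rightarrow> 'a mpoly \<Rightarrow> 'b" where
  "mpoly_eval_with h v f =
     (\<Sum>s\<in>Poly_Mapping.keys f. h (Poly_Mapping.lookup f s) * mono_eval v s)"

lemma mpoly_eval_eq: "mpoly_eval v f = mpoly_eval_with (\<lambda>c. c) v f"
  by (simp add: mpoly_eval_def mpoly_eval_with_def mono_eval_def)

context comm_ring_hom
begin

lemma mpoly_eval_with_superset:
  assumes "finite A" "Poly_Mapping.keys f \<subseteq> A"
  shows "mpoly_eval_with hom v f = (\<Sum>s\<in>A. hom (Poly_Mapping.lookup f s) * mono_eval v s)"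
  unfolding mpoly_eval_with_def
  by (rule sum.mono_neutral_left) (use assms in \<open>auto simp: in_keys_iff\<close>)

lemma mpoly_eval_with_single:
  "mpoly_eval_with hom v (Poly_Mapping.single s c) = hom c * mono_eval v s"
  by (subst mpoly_eval_with_superset[of "{s}"]) auto

lemma mpoly_eval_with_add:
  "mpoly_eval_with hom v (f + g) = mpoly_eval_with hom v f + mpoly_eval_with hom v g"
proof -
  let ?A = "Poly_Mapping.keys f \<union> Poly_Mapping.keys g"
  have "mpoly_eval_with hom v (f + g) =
      (\<Sum>s\<in>?A. hom (Poly_Mapping.lookup (f + g) s) * mono_eval v s)"
    by (rule mpoly_eval_with_superset) (use keys_add[of f g] in auto)
  also have "\<dots> = (\<Sum>s\<in>?A. hom (Poly_Mapping.lookup f s) * mono_eval v s) +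
      (\<Sum>s\<in>?A. hom (Poly_Mapping.lookup g s) * mono_eval v s)"
    by (simp only: lookup_add hom_add distrib_right sum.distrib)
  also have "\<dots> = mpoly_eval_with hom v f + mpoly_eval_with hom v g"
    by (subst (1 2) mpoly_eval_with_superset[of ?A, symmetric]) auto
  finally show ?thesis .
qed

lemma mpoly_eval_with_sum:
  "mpoly_eval_with hom v (\<Sum>x\<in>A. f x) = (\<Sum>x\<in>A. mpoly_eval_with hom v (f x))"
proof (induction A rule: infinite_finite_induct)
  case (insert x A)
  thus ?case by (simp add: mpoly_eval_with_add)
qed (simp_all add: mpoly_eval_with_def)

lemma mpoly_eval_with_mult:
  "mpoly_eval_with hom v (f * g) = mpoly_eval_with hom v f * mpoly_eval_with hom v g"
proof -
  let ?t = "\<lambda>f s. Poly_Mapping.single s (Poly_Mapping.lookup f s)"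
  have "f * g = (\<Sum>s\<in>Poly_Mapping.keys f. \<Sum>t\<in>Poly_Mapping.keys g. ?t f s * ?t g t)"
    by (simp only: sum_product[symmetric] mpoly_eq_sum_single)
  also have "mpoly_eval_with hom v \<dots> = (\<Sum>s\<in>Poly_Mapping.keys f. \<Sum>t\<in>Poly_Mapping.keys g.
      (hom (Poly_Mapping.lookup f s) * mono_eval v s) * (hom (Poly_Mapping.lookup g t) * mono_eval v t))"
    by (simp only: mpoly_eval_with_sum mult_single mpoly_eval_with_single hom_mult mono_eval_add mult_ac)
  also have "\<dots> = mpoly_eval_with hom v f * mpoly_eval_with hom v g"
    by (simp only: mpoly_eval_with_def sum_product)
  finally show ?thesis .
qed

lemma comm_ring_hom_mpoly_eval_with: "comm_ring_hom (mpoly_eval_with hom v)"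
proof
  show "mpoly_eval_with hom v 1 = 1"
    by (simp only: single_one[symmetric] mpoly_eval_with_single) simp
  show "mpoly_eval_with hom v 0 = 0"
    by (simp add: mpoly_eval_with_def)
qed (simp_all add: mpoly_eval_with_add mpoly_eval_with_mult)

lemma mpoly_eval_with_mvar [simp]: "mpoly_eval_with hom v (mvar i) = v i"
  by (simp add: mvar_def mpoly_eval_with_single)

lemma mpoly_eval_with_mconst [simp]: "mpoly_eval_with hom v (mconst c) = hom c"
  by (simp add: mconst_def mpoly_eval_with_single)

lemma hom_mpoly_eval_with:
  "hom (mpoly_eval_with h v f) = mpoly_eval_with (\<lambda>c. hom (h c)) (\<lambda>i. hom (v i)) f"
  by (simp add: mpoly_eval_with_def hom_sum hom_mult hom_mono_eval)

end

lemma comm_ring_hom_id: "comm_ring_hom (\<lambda>c. c)"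
  by unfold_locales auto

lemma comm_ring_hom_of_real: "comm_ring_hom (of_real :: real \<Rightarrow> 'a::real_field)"
  by unfold_locales auto

lemma comm_ring_hom_pCons: "comm_ring_hom (\<lambda>c. [:c:])"
  by unfold_locales (auto simp: one_pCons)

lemma comm_ring_hom_poly: "comm_ring_hom (\<lambda>p. poly p x)"
  by unfold_locales auto

lemma comm_ring_hom_comp:
  assumes "comm_ring_hom f" "comm_ring_hom g"
  shows "comm_ring_hom (\<lambda>x. f (g x))"
proof -
  interpret f: comm_ring_hom f by fact
  interpret g: comm_ring_hom g by fact
  show ?thesis by unfold_locales (auto simp: f.hom_add g.hom_add f.hom_mult g.hom_mult)
qed

lemma mono_eval_mvar: "mono_eval mvar s = (Poly_Mapping.single s 1 :: 'a::comm_ring_1 mpoly)"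
proof -
  have pow: "(mvar i :: 'a mpoly) ^ k = Poly_Mapping.single (Poly_Mapping.single i k) 1" for i k
    by (induction k) (simp_all add: mvar_def mult_single flip: single_add)
  have *: "(\<Prod>i\<in>A. mvar i ^ f i :: 'a mpoly) =
       Poly_Mapping.single (\<Sum>i\<in>A. Poly_Mapping.single i (f i)) 1" if "finite A" for A f
    using that by induction (simp_all add: pow mult_single)
  have s: "(\<Sum>i\<in>Poly_Mapping.keys s. Poly_Mapping.single i (Poly_Mapping.lookup s i)) = s"
    by (rule poly_mapping_eqI) (auto simp: lookup_sum lookup_single when_def in_keys_iff)
  show ?thesis
    by (simp add: mono_eval_def * s)
qed

lemma lookup_extend_scalars [simp]:
  "Poly_Mapping.lookup (extend_scalars f) s = of_real (Poly_Mapping.lookup f s)"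
  by transfer (simp add: when_def)

lemma keys_extend_scalars [simp]:
  "Poly_Mapping.keys (extend_scalars f) = Poly_Mapping.keys f"
  by (auto simp: in_keys_iff)

text \<open>Extension of scalars is evaluation at the variables themselves, so it inherits the
  homomorphism property from the general evaluation.\<close>

lemma extend_scalars_eq:
  "(extend_scalars f :: 'k::real_field mpoly) = mpoly_eval_with (\<lambda>c. mconst (of_real c)) mvar f"
proof -
  have "(extend_scalars f :: 'k mpoly) =
      (\<Sum>s\<in>Poly_Mapping.keys f. Poly_Mapping.single s (of_real (Poly_Mapping.lookup f s)))"
    using mpoly_eq_sum_single[of "extend_scalars f :: 'k mpoly"] by simp
  thus ?thesis
    by (simp add: mpoly_eval_with_def mono_eval_mvar mconst_def mult_single)
qed

lemma comm_ring_hom_mconst: "comm_ring_hom mconst"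
  by unfold_locales (auto simp: mconst_def single_add mult_single)

lemma comm_ring_hom_extend_scalars: "comm_ring_hom (extend_scalars :: _ \<Rightarrow> 'k::real_field mpoly)"
  unfolding extend_scalars_eq
  by (intro comm_ring_hom.comm_ring_hom_mpoly_eval_with
        comm_ring_hom_comp[OF comm_ring_hom_mconst comm_ring_hom_of_real])

lemma mpoly_eval_extend_scalars:
  "mpoly_eval v (extend_scalars f) = mpoly_eval_with of_real v f"
  by (simp add: mpoly_eval_eq mpoly_eval_with_def)

lemma mpoly_eval_of_real:
  "mpoly_eval (\<lambda>i. of_real (v i)) (extend_scalars f) = of_real (mpoly_eval v f)"
  by (simp only: mpoly_eval_extend_scalars)
     (simp add: mpoly_eval_eq comm_ring_hom.hom_mpoly_eval_with[OF comm_ring_hom_of_real])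

section \<open>Degrees and the number of monomials\<close>

definition deg_in :: "nat set \<Rightarrow> monomial \<Rightarrow> nat" where
  "deg_in V s = (\<Sum>i\<in>V. Poly_Mapping.lookup s i)"

lemma deg_in_add: "deg_in V (s + t) = deg_in V s + deg_in V t"
  by (simp add: deg_in_def lookup_add sum.distrib)

lemma mono_degree_eq_deg_in:
  "finite V \<Longrightarrow> Poly_Mapping.keys s \<subseteq> V \<Longrightarrow> mono_degree s = deg_in V s"
  unfolding mono_degree_def deg_in_def
  by (rule sum.mono_neutral_left) (auto simp: in_keys_iff)

lemma mono_degree_add: "mono_degree (s + t) = mono_degree s + mono_degree t"
proof -
  let ?V = "Poly_Mapping.keys s \<union> Poly_Mapping.keys t"
  have "mono_degree (s + t) = deg_in ?V (s + t)"
    by (rule mono_degree_eq_deg_in) (use keys_add[of s t] in auto)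
  thus ?thesis by (simp add: deg_in_add mono_degree_eq_deg_in[of ?V])
qed

lemma deg_in_le_mono_degree:
  assumes "finite V" shows "deg_in V s \<le> mono_degree s"
proof -
  have "deg_in V s \<le> deg_in (V \<union> Poly_Mapping.keys s) s"
    unfolding deg_in_def by (rule sum_mono2) (use assms in auto)
  thus ?thesis using mono_degree_eq_deg_in[of "V \<union> Poly_Mapping.keys s" s] assms by simp
qed

lemma mono_degree_single [simp]: "mono_degree (Poly_Mapping.single i k) = k"
  by (simp add: mono_degree_def)

lemma mono_degree_0 [simp]: "mono_degree 0 = 0"
  by (simp add: mono_degree_def)

lemma mono_degree_sum: "mono_degree (\<Sum>i\<in>A. s i) = (\<Sum>i\<in>A. mono_degree (s i))"
  by (induction A rule: infinite_finite_induct) (simp_all add: mono_degree_add)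

definition monomials_on :: "nat set \<Rightarrow> nat \<Rightarrow> monomial set" where
  "monomials_on V k = {s. Poly_Mapping.keys s \<subseteq> V \<and> mono_degree s = k}"

text \<open>An exponent vector is the multiplicity function of a finite multiset, so the count of
  multisets of a given size applies to monomials.\<close>

lemma bij_betw_monomials_on:
  assumes "finite V"
  shows "bij_betw (\<lambda>M. Abs_poly_mapping (count M)) (multisets_of_size V k) (monomials_on V k)"
proof -
  have fin: "finite {x. 0 < count M x}" for M :: "nat multiset"
    by simp
  have lk: "Poly_Mapping.lookup (Abs_poly_mapping (count M)) = count M" for M :: "nat multiset"
    by (rule lookup_Abs_poly_mapping) (use fin in simp)
  have ks: "Poly_Mapping.keys (Abs_poly_mapping (count M)) = set_mset M" for M :: "nat multiset"
    by (auto simp: in_keys_iff lk)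
  have dg: "mono_degree (Abs_poly_mapping (count M)) = size M" for M :: "nat multiset"
    by (simp add: mono_degree_def lk ks size_multiset_overloaded_eq)
  show ?thesis
  proof (rule bij_betwI')
    fix M M' :: "nat multiset"
    have "count M = count M'" if "Abs_poly_mapping (count M) = Abs_poly_mapping (count M')"
      using lk[of M] lk[of M'] unfolding that by simp
    thus "(Abs_poly_mapping (count M) = Abs_poly_mapping (count M')) = (M = M')"
      by (auto simp: count_inject)
  next
    fix M assume "M \<in> multisets_of_size V k"
    thus "Abs_poly_mapping (count M) \<in> monomials_on V k"
      by (auto simp: multisets_of_size_def monomials_on_def ks dg)
  next
    fix s assume s: "s \<in> monomials_on V k"
    define M where "M = Abs_multiset (Poly_Mapping.lookup s)"
    have "count M = Poly_Mapping.lookup s"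
      unfolding M_def by (rule Abs_multiset_inverse) simp
    hence M: "Abs_poly_mapping (count M) = s" by (simp add: lookup_inverse)
    have "M \<in> multisets_of_size V k"
      using s ks[of M] dg[of M] unfolding M monomials_on_def multisets_of_size_def by simp
    thus "\<exists>M\<in>multisets_of_size V k. s = Abs_poly_mapping (count M)"
      using M by (intro bexI[of _ M]) simp_all
  qed
qed

lemma finite_monomials_on [simp]: "finite V \<Longrightarrow> finite (monomials_on V k)"
  using bij_betw_finite[OF bij_betw_monomials_on[of V k]] finite_multisets_of_size[of V k] by simp

lemma card_monomials_on: "finite V \<Longrightarrow> card (monomials_on V k) = (card V + k - 1) choose k"
  using bij_betw_same_card[OF bij_betw_monomials_on[of V k]] card_multisets_of_size[of V k] by simp

lemma monomials_on_disjoint: "k \<noteq> l \<Longrightarrow> monomials_on V k \<inter> monomials_on V l = {}"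
  by (auto simp: monomials_on_def)

text \<open>Hockey-stick summation over the degrees. It is carried out with
  \<open>card V - 1\<close>, where truncated subtraction sets the empty \<open>V\<close>
  apart.\<close>

lemma card_monomials_on_le:
  assumes "finite V"
  shows "card (\<Union>k\<le>n. monomials_on V k) = (card V + n) choose n"
proof (cases "card V = 0")
  case True
  hence "V = {}" using assms by simp
  have "monomials_on V k = (if k = 0 then {0} else {})" for k
    unfolding monomials_on_def \<open>V = {}\<close> subset_empty keys_eq_empty by auto
  hence "(\<Union>k\<le>n. monomials_on V k) = {0}" by (auto split: if_splits)
  thus ?thesis using True by simp
next
  case False
  have "card (\<Union>k\<le>n. monomials_on V k) = (\<Sum>k\<le>n. card (monomials_on V k))"
    by (rule card_UN_disjoint) (use assms monomials_on_disjoint in auto)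
  also have "\<dots> = (\<Sum>k\<le>n. ((card V - 1) + k) choose (card V - 1))"
  proof (rule sum.cong)
    fix k
    have "card V + k - 1 = card V - 1 + k" using False by simp
    thus "card (monomials_on V k) = ((card V - 1) + k) choose (card V - 1)"
      using binomial_symmetric[of "card V - 1" "card V - 1 + k"] assms
      by (simp add: card_monomials_on)
  qed simp
  also have "\<dots> = (card V + n) choose n"
    using choose_rising_sum(2)[of "card V - 1" n] False by simp
  finally show ?thesis .
qed

lemma digit_sum_inj:
  fixes s t :: "nat \<Rightarrow> nat"
  assumes "\<And>i. i \<le> r \<Longrightarrow> s i < B" "\<And>i. i \<le> r \<Longrightarrow> t i < B"
    and "(\<Sum>i\<le>r. s i * B ^ i) = (\<Sum>i\<le>r. t i * B ^ i)"
  shows "\<forall>i\<le>r. s i = t i"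
  using assms
proof (induction r arbitrary: s t)
  case 0
  thus ?case by simp
next
  case (Suc r)
  have B: "B > 0" using Suc.prems(1)[of 0] by simp
  have split: "(\<Sum>i\<le>Suc r. s i * B ^ i) = s 0 + B * (\<Sum>i\<le>r. s (Suc i) * B ^ i)" for s :: "nat \<Rightarrow> nat"
    unfolding sum.atMost_Suc_shift sum_distrib_left by (simp add: mult.left_commute)
  define S T where "S = (\<Sum>i\<le>r. s (Suc i) * B ^ i)" and "T = (\<Sum>i\<le>r. t (Suc i) * B ^ i)"
  have eq: "s 0 + B * S = t 0 + B * T"
    using Suc.prems(3) unfolding split S_def T_def .
  have "s 0 = (s 0 + B * S) mod B" "t 0 = (t 0 + B * T) mod B"
    using Suc.prems(1,2)[of 0] by simp_all
  hence 0: "s 0 = t 0" unfolding eq by simp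
  hence "S = T" using eq B by simp
  hence *: "\<forall>i\<le>r. s (Suc i) = t (Suc i)" unfolding S_def T_def
    by (intro Suc.IH[of "\<lambda>i. s (Suc i)" "\<lambda>i. t (Suc i)"] Suc.prems(1,2)) (simp_all only: Suc_le_mono)
  show ?case
  proof (intro allI impI)
    fix i assume i: "i \<le> Suc r"
    show "s i = t i"
    proof (cases i)
      case (Suc j)
      thus ?thesis using i "*"[rule_format, of j] by simp
    qed (use 0 in simp)
  qed
qed

text \<open>Kronecker substitution: the variable \<open>i\<close> is replaced by \<open>t\<^bsup>B\<^sup>i\<^esup>\<close> with \<open>B\<close> larger than all
  exponents, so that distinct monomials become distinct powers of \<open>t\<close>.\<close>

lemma mpoly_eqI_eval:
  fixes f :: "'k::field_char_0 mpoly"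
  assumes f: "Poly_Mapping.keys f \<subseteq> monomials r"
    and zero: "\<And>v. mpoly_eval v f = 0"
  shows "f = 0"
proof (rule ccontr)
  assume "f \<noteq> 0"
  then obtain s0 where s0: "s0 \<in> Poly_Mapping.keys f" by (metis all_not_in_conv keys_eq_empty)
  define B where "B = Suc (Max (mono_degree ` Poly_Mapping.keys f))"
  have lt: "Poly_Mapping.lookup s i < B" if "s \<in> Poly_Mapping.keys f" for s i
  proof -
    have "Poly_Mapping.lookup s i = deg_in {i} s" by (simp add: deg_in_def)
    also have "\<dots> \<le> mono_degree s" by (rule deg_in_le_mono_degree) simp
    also have "\<dots> < B" unfolding B_def using that by (simp add: less_Suc_eq_le)
    finally show ?thesis .
  qed
  define e where "e s = (\<Sum>i\<le>r. Poly_Mapping.lookup s i * B ^ i)" for s :: monomial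
  have inj: "s = t" if "s \<in> Poly_Mapping.keys f" "t \<in> Poly_Mapping.keys f" "e s = e t" for s t
  proof (rule poly_mapping_eqI)
    fix i
    have out: "Poly_Mapping.lookup u i = 0" if "u \<in> Poly_Mapping.keys f" "\<not> i \<le> r" for u
    proof -
      have "i \<notin> Poly_Mapping.keys u" using f that by (auto simp: monomials_def)
      thus ?thesis by (simp add: in_keys_iff)
    qed
    have "\<forall>i\<le>r. Poly_Mapping.lookup s i = Poly_Mapping.lookup t i"
      by (rule digit_sum_inj[of r _ B]) (use that lt in \<open>simp_all add: e_def\<close>)
    thus "Poly_Mapping.lookup s i = Poly_Mapping.lookup t i"
      using out[OF that(1)] out[OF that(2)] by (cases "i \<le> r") simp_all
  qed
  define p where "p = (\<Sum>s\<in>Poly_Mapping.keys f. monom (Poly_Mapping.lookup f s) (e s))"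
  have "poly p t = 0" for t
  proof -
    have ev: "mono_eval (\<lambda>i. t ^ (B ^ i)) s = t ^ e s" if "s \<in> Poly_Mapping.keys f" for s
    proof -
      have pow: "(t ^ m) ^ k = t ^ (k * m)" for m k
        using power_mult[of t m k] by (simp only: mult.commute)
      have "Poly_Mapping.keys s \<subseteq> {..r}" using that f by (auto simp: monomials_def)
      hence "mono_eval (\<lambda>i. t ^ (B ^ i)) s = (\<Prod>i\<le>r. (t ^ (B ^ i)) ^ Poly_Mapping.lookup s i)"
        using mono_eval_superset[of "{..r}" s "\<lambda>i. t ^ (B ^ i)"] by blast
      also have "\<dots> = (\<Prod>i\<le>r. t ^ (Poly_Mapping.lookup s i * B ^ i))"
        by (simp only: power_mult[symmetric] mult.commute)
      finally show ?thesis unfolding e_def power_sum .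
    qed
    have "poly p t = mpoly_eval (\<lambda>i. t ^ (B ^ i)) f"
      unfolding p_def poly_sum poly_monom mpoly_eval_eq mpoly_eval_with_def
      by (rule sum.cong) (simp_all only: ev)
    thus ?thesis using zero by simp
  qed
  hence "p = 0" using poly_all_0_iff_0 by blast
  moreover have "coeff p (e s0) = Poly_Mapping.lookup f s0"
  proof -
    have "coeff p (e s0) = (\<Sum>s\<in>Poly_Mapping.keys f. if s = s0 then Poly_Mapping.lookup f s else 0)"
      unfolding p_def coeff_sum
    proof (rule sum.cong)
      fix s assume "s \<in> Poly_Mapping.keys f"
      hence "e s = e s0 \<longleftrightarrow> s = s0" using inj[of s s0] s0 by blast
      thus "coeff (monom (Poly_Mapping.lookup f s) (e s)) (e s0) = (if s = s0 then Poly_Mapping.lookup f s else 0)"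
        by simp
    qed simp
    thus ?thesis using s0 by simp
  qed
  ultimately show False using s0 by (simp add: in_keys_iff)
qed

section \<open>Linear recurrences and the parametrisation\<close>

text \<open>These are the coefficients of the denominator of the generating function; the one with
  index \<open>i\<close> multiplies the term \<open>i\<close> places back in the recurrence.\<close>

definition char_coeff :: "nat \<Rightarrow> (nat \<Rightarrow> 'a::comm_ring_1) \<Rightarrow> nat \<Rightarrow> 'a" where
  "char_coeff n u i = coeff (\<Prod>j=1..n. [:1, - u j:]) i"

lemma coeff_linear_mult:
  "coeff ([:1, - c:] * p) i = coeff p i - (case i of 0 \<Rightarrow> 0 | Suc k \<Rightarrow> c * coeff p k)"
  for c :: "'a::comm_ring_1"
  by (cases i) (simp_all add: coeff_pCons)

lemma char_coeff_Suc:
  "char_coeff (Suc n) u i =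
     char_coeff n u i - (case i of 0 \<Rightarrow> 0 | Suc k \<Rightarrow> u (Suc n) * char_coeff n u k)"
proof -
  have "(\<Prod>j=1..Suc n. [:1, - u j:]) = [:1, - u (Suc n):] * (\<Prod>j=1..n. [:1, - u j:])"
    by (subst prod.nat_ivl_Suc') auto
  thus ?thesis unfolding char_coeff_def by (simp only: coeff_linear_mult)
qed

lemma char_coeff_0_left: "char_coeff 0 u i = (if i = 0 then 1 else 0)"
  by (simp add: char_coeff_def)

lemma char_coeff_0 [simp]: "char_coeff n u 0 = 1"
  by (induction n) (simp_all add: char_coeff_Suc char_coeff_0_left)

lemma char_coeff_above: "n < i \<Longrightarrow> char_coeff n u i = 0"
proof (induction n arbitrary: i)
  case (Suc n)
  thus ?case by (cases i) (simp_all add: char_coeff_Suc)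
qed (simp add: char_coeff_0_left)

lemma (in comm_ring_hom) hom_char_coeff:
  "hom (char_coeff n u i) = char_coeff n (\<lambda>j. hom (u j)) i"
proof (induction n arbitrary: i)
  case (Suc n)
  thus ?case by (cases i) (simp_all add: char_coeff_Suc hom_minus hom_mult)
qed (simp add: char_coeff_0_left)

text \<open>Reversing the denominator gives the monic polynomial with roots \<open>u j\<close>.
  Induction on \<open>n\<close> avoids inverting \<open>x\<close>, so the identity holds in every
  commutative ring, in particular for the polynomial-valued \<open>u\<close> that describe
  curves.\<close>

lemma char_coeff_sum:
  "(\<Sum>i\<le>n. char_coeff n u i * x ^ (n - i)) = (\<Prod>j=1..n. x - u j)"
proof (induction n)
  case (Suc n)
  have "(\<Sum>i\<le>Suc n. char_coeff (Suc n) u i * x ^ (Suc n - i)) =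
      (\<Sum>i\<le>Suc n. char_coeff n u i * x ^ (Suc n - i)) -
      (\<Sum>i\<le>Suc n. (case i of 0 \<Rightarrow> 0 | Suc k \<Rightarrow> u (Suc n) * char_coeff n u k) * x ^ (Suc n - i))"
    by (simp only: char_coeff_Suc left_diff_distrib sum_subtractf)
  also have "(\<Sum>i\<le>Suc n. char_coeff n u i * x ^ (Suc n - i)) = (\<Sum>i\<le>n. char_coeff n u i * x ^ (n - i)) * x"
    unfolding sum.atMost_Suc sum_distrib_right
    by (simp add: char_coeff_above Suc_diff_le mult_ac)
  also have "(\<Sum>i\<le>Suc n. (case i of 0 \<Rightarrow> 0 | Suc k \<Rightarrow> u (Suc n) * char_coeff n u k) * x ^ (Suc n - i)) =
      (\<Sum>i\<le>n. char_coeff n u i * x ^ (n - i)) * u (Suc n)"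
    unfolding sum.atMost_Suc_shift sum_distrib_right by (simp add: mult_ac)
  also have "(\<Sum>i\<le>n. char_coeff n u i * x ^ (n - i)) * x - (\<Sum>i\<le>n. char_coeff n u i * x ^ (n - i)) * u (Suc n) =
      (\<Prod>j=1..n. x - u j) * (x - u (Suc n))"
    unfolding Suc.IH by (simp add: right_diff_distrib)
  also have "\<dots> = (\<Prod>j=1..Suc n. x - u j)"
    by (simp add: mult.commute)
  finally show ?case .
qed (simp add: char_coeff_0_left)

lemma char_coeff_root:
  assumes "j \<in> {1..n}"
  shows "(\<Sum>i\<le>n. char_coeff n u i * u j ^ (n - i)) = 0"
  unfolding char_coeff_sum by (rule prod_zero) (use assms in auto)

text \<open>Each term is a polynomial in the values of \<open>q\<close> and \<open>a\<close>, over
  any commutative ring. The sequence therefore commutes with ring homomorphisms, and its parameters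
  may themselves be polynomials in a curve parameter.\<close>

function rec_seq :: "nat \<Rightarrow> (nat \<Rightarrow> 'a::comm_ring_1) \<Rightarrow> (nat \<Rightarrow> 'a) \<Rightarrow> nat \<Rightarrow> 'a" where
  "rec_seq n q a k = (if k < n then a k else - (\<Sum>i=1..n. q i * rec_seq n q a (k - i)))"
  by pat_completeness auto
termination
  by (relation "measure (\<lambda>(n, q, a, k). k)") auto

declare rec_seq.simps [simp del]

lemma rec_seq_init [simp]: "k < n \<Longrightarrow> rec_seq n q a k = a k"
  by (simp add: rec_seq.simps)

lemma rec_seq_unique:
  assumes "\<And>k. k < n \<Longrightarrow> s k = a k"
    and "\<And>k. n \<le> k \<Longrightarrow> s k = - (\<Sum>i=1..n. q i * s (k - i))"
  shows "rec_seq n q a k = s k"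
proof (induction k rule: less_induct)
  case (less k)
  show ?case
  proof (cases "k < n")
    case False
    have "(\<Sum>i=1..n. q i * rec_seq n q a (k - i)) = (\<Sum>i=1..n. q i * s (k - i))"
      by (rule sum.cong) (use less False in auto)
    thus ?thesis using False assms(2)[of k] rec_seq.simps[of n q a k] by simp
  qed (use assms in simp)
qed

lemma rec_seq_relation:
  assumes "n \<le> k" "q 0 = 1"
  shows "(\<Sum>i\<le>n. q i * rec_seq n q a (k - i)) = 0"
proof -
  have "{..n} = insert 0 {1..n}" by auto
  thus ?thesis using assms rec_seq.simps[of n q a k] by simp
qed

lemma (in comm_ring_hom) hom_rec_seq:
  "hom (rec_seq n q a k) = rec_seq n (\<lambda>i. hom (q i)) (\<lambda>i. hom (a i)) k"
proof (rule rec_seq_unique[symmetric])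
  fix k assume "n \<le> k"
  thus "hom (rec_seq n q a k) = - (\<Sum>i=1..n. hom (q i) * hom (rec_seq n q a (k - i)))"
    by (subst rec_seq.simps) (simp add: hom_uminus hom_sum hom_mult)
qed simp

lemma rec_seq_scale: "rec_seq n q (\<lambda>k. c * a k) k = c * rec_seq n q a k"
proof (rule rec_seq_unique)
  fix k assume "n \<le> k"
  thus "c * rec_seq n q a k = - (\<Sum>i=1..n. q i * (c * rec_seq n q a (k - i)))"
    by (subst rec_seq.simps) (simp add: sum_distrib_left mult_ac)
qed simp

text \<open>The coordinates \<open>m\<^sub>i\<close> as polynomials in the reciprocal roots \<open>u\<^sub>j\<close> and the initial values
  \<open>a\<^sub>d, \<dots>, a\<^bsub>n-1\<^esub>\<close> of the sequence \<open>c\<close>. The map \<open>h\<close> embeds the base field; taking a polynomial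
  ring as target gives curves in the parameter space.\<close>

definition moment_vec ::
  "('b::field \<Rightarrow> 'a::comm_ring_1) \<Rightarrow> nat \<Rightarrow> nat \<Rightarrow> (nat \<Rightarrow> 'a) \<Rightarrow> (nat \<Rightarrow> 'a) \<Rightarrow> nat \<Rightarrow> 'a" where
  "moment_vec h d n u a i =
     h (inverse (of_nat ((d + i) choose d))) *
     rec_seq n (char_coeff n u) (\<lambda>k. if k < d then 0 else a k) (d + i)"

lemma (in comm_ring_hom) hom_moment_vec:
  "hom (moment_vec h d n u a i) =
     moment_vec (\<lambda>c. hom (h c)) d n (\<lambda>j. hom (u j)) (\<lambda>k. hom (a k)) i"
proof -
  have "(\<lambda>k. hom (if k < d then 0 else a k)) = (\<lambda>k. if k < d then 0 else hom (a k))" by auto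
  thus ?thesis by (simp add: moment_vec_def hom_mult hom_rec_seq hom_char_coeff)
qed

lemma moment_vec_scale: "moment_vec h d n u (\<lambda>k. c * a k) i = c * moment_vec h d n u a i"
proof -
  have "(\<lambda>k. if k < d then 0 else c * a k) = (\<lambda>k. c * (if k < d then 0 else a k))" by auto
  thus ?thesis by (simp add: moment_vec_def rec_seq_scale mult_ac)
qed

text \<open>A polynomial curve in the parameter space turns \<open>f\<close> into a univariate
  polynomial that interpolates its values along the curve. Passing to limits, primality and the step
  from real to complex parameters all rest on this.\<close>

lemma poly_mpoly_eval_moment_vec:
  "poly (mpoly_eval_with (\<lambda>c. [:c:]) (moment_vec (\<lambda>c. [:c:]) d n u a) f) t =
     mpoly_eval (moment_vec (\<lambda>c. c) d n (\<lambda>j. poly (u j) t) (\<lambda>k. poly (a k) t)) f"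
  by (simp add: comm_ring_hom.hom_mpoly_eval_with[OF comm_ring_hom_poly]
      comm_ring_hom.hom_moment_vec[OF comm_ring_hom_poly] mpoly_eval_eq)

lemma poly_eq_0_cofinite:
  fixes p :: "'a::field_char_0 poly"
  assumes "finite S" "\<And>t. t \<notin> S \<Longrightarrow> poly p t = 0"
  shows "p = 0"
proof (rule ccontr)
  assume "p \<noteq> 0"
  hence "finite {t. poly p t = 0}" by (rule poly_roots_finite)
  hence "finite (S \<union> {t. poly p t = 0})" using assms by simp
  moreover have "S \<union> {t. poly p t = 0} = UNIV" using assms by auto
  ultimately show False using infinite_UNIV_char_0[where 'a='a] by simp
qed

lemma mpoly_eval_cong:
  assumes "f \<in> carrier (mpoly_ring r)" "\<And>i. i \<le> r \<Longrightarrow> v i = w i"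
  shows "mpoly_eval v f = mpoly_eval w f"
proof -
  have "mono_eval v s = mono_eval w s" if "s \<in> Poly_Mapping.keys f" for s
    unfolding mono_eval_def
    by (rule prod.cong) (use that assms in \<open>auto simp: mpoly_ring_def monomials_def subset_iff\<close>)
  thus ?thesis by (simp add: mpoly_eval_eq mpoly_eval_with_def)
qed

text \<open>The kernel of a polynomial map on an affine space, without the normalisation
  \<open>a d = 1\<close>. Scaling \<open>a\<close> scales the point, so this is the ideal of the
  affine cone, and whole lines in the parameter space remain available.\<close>

definition cone_ideal :: "nat \<Rightarrow> nat \<Rightarrow> nat \<Rightarrow> 'k::field mpoly set" where
  "cone_ideal d n r =
     {f \<in> carrier (mpoly_ring r). \<forall>u a. mpoly_eval (moment_vec (\<lambda>c. c) d n u a) f = 0}"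

text \<open>Multiplication by the denominator turns the bound on the degree of \<open>A\<close> into
  a recurrence of order \<open>n\<close> for the sequence \<open>s\<close>, which starts with
  \<open>d\<close> zeros; the constant coefficient of \<open>A\<close> becomes
  \<open>s d = 1\<close>.\<close>

lemma moment_points_subset:
  fixes P :: "(nat \<Rightarrow> 'k::field_char_0) set"
  assumes "d < n" "P \<in> moment_points d n r"
  shows "\<exists>u a. P = proj_point (\<lambda>i. if i \<le> r then moment_vec (\<lambda>c. c) d n u a i else 0) \<and> a d = 1"
proof -
  obtain m u A where P: "P = proj_point (\<lambda>i. if i \<le> r then m i else 0)"
    and A: "Polynomial.degree A \<le> n - d - 1" "Polynomial.coeff A 0 = 1"
    and gf: "Abs_fps (\<lambda>i. of_nat ((d + i) choose d) * m i) =
        fps_of_poly A / (\<Prod>j = 1..n. 1 - fps_const (u j) * fps_X)"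
    using assms(2) unfolding moment_points_def by blast
  define q where "q = char_coeff n u"
  define C where "C = Abs_fps (\<lambda>i. of_nat ((d + i) choose d) * m i)"
  define Q where "Q = (\<Prod>j = 1..n. 1 - fps_const (u j) * fps_X)"
  have "Q = fps_of_poly (\<Prod>j=1..n. [:1, - u j:])"
    by (simp add: Q_def fps_of_poly_prod fps_of_poly_pCons flip: fps_const_neg)
  hence Qn: "fps_nth Q i = q i" for i by (simp add: q_def char_coeff_def)
  hence "fps_nth Q 0 \<noteq> 0" by (simp add: q_def)
  hence QC: "Q * C = fps_of_poly A"
    using gf unfolding C_def[symmetric] Q_def[symmetric]
    by (metis fps_is_unit_iff dvd_mult_div_cancel unit_imp_dvd)
  define s where "s k = (if k < d then 0 else fps_nth C (k - d))" for k
  have rec: "s k = - (\<Sum>i=1..n. q i * s (k - i))" if k: "n \<le> k" for k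
  proof -
    have "(\<Sum>i=0..k-d. q i * fps_nth C (k - d - i)) = fps_nth (Q * C) (k - d)"
      by (simp add: fps_mult_nth Qn)
    \<comment> \<open>For \<open>n \<le> k\<close> the index \<open>k - d\<close> exceeds the bound
      \<open>n - d - 1\<close> on the degree of \<open>A\<close>.\<close>
    also have "\<dots> = 0"
      unfolding QC using A(1) k assms(1) by (simp add: coeff_eq_0)
    finally have "(\<Sum>i=0..k-d. q i * fps_nth C (k - d - i)) = 0" .
    also have "(\<Sum>i=0..k-d. q i * fps_nth C (k - d - i)) = (\<Sum>i\<in>{0..k-d} \<inter> {0..n}. q i * s (k - i))"
    proof (rule sum.mono_neutral_cong_right)
      show "\<forall>i\<in>{0..k-d} - {0..k-d} \<inter> {0..n}. q i * fps_nth C (k - d - i) = 0"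
        by (auto simp: q_def char_coeff_above)
      fix i assume "i \<in> {0..k-d} \<inter> {0..n}"
      hence "\<not> k - i < d" "k - d - i = k - i - d" using k assms(1) by auto
      thus "q i * fps_nth C (k - d - i) = q i * s (k - i)" by (simp add: s_def)
    qed auto
    \<comment> \<open>The added terms have \<open>k - i < d\<close>, where \<open>s\<close> is zero:
      the leading zeros complete the recurrence.\<close>
    also have "\<dots> = (\<Sum>i\<in>{0..n}. q i * s (k - i))"
    proof (rule sum.mono_neutral_left)
      show "\<forall>i\<in>{0..n} - {0..k-d} \<inter> {0..n}. q i * s (k - i) = 0"
        using k assms(1) by (auto simp: s_def)
    qed auto
    also have "{0..n} = insert 0 {1..n}" by auto
    finally show ?thesis by (simp add: q_def eq_neg_iff_add_eq_0)
  qed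
  have m: "moment_vec (\<lambda>c. c) d n u s i = m i" for i
  proof -
    have "rec_seq n q (\<lambda>k. if k < d then 0 else s k) (d + i) = s (d + i)"
      by (rule rec_seq_unique) (use rec in \<open>auto simp: s_def\<close>)
    moreover have "of_nat ((d + i) choose d) \<noteq> (0 :: 'k)" by simp
    ultimately show ?thesis by (simp add: moment_vec_def q_def s_def C_def)
  qed
  have "fps_nth (Q * C) 0 = 1" using A(2) QC by simp
  hence "s d = 1" using Qn[of 0] by (simp add: s_def q_def)
  moreover have "P = proj_point (\<lambda>i. if i \<le> r then moment_vec (\<lambda>c. c) d n u s i else 0)"
    unfolding P m ..
  ultimately show ?thesis by blast
qed

text \<open>Conversely, the recurrence makes the product \<open>Q * C\<close> vanish beyond degree
  \<open>n - d - 1\<close>, so this product is itself the numerator.\<close>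

lemma proj_point_in_moment_points:
  fixes u a :: "nat \<Rightarrow> 'k::field_char_0"
  assumes "d < n" "a d = 1"
  shows "proj_point (\<lambda>i. if i \<le> r then moment_vec (\<lambda>c. c) d n u a i else 0) \<in> moment_points d n r"
proof -
  define q where "q = char_coeff n u"
  define m where "m = moment_vec (\<lambda>c. c) d n u a"
  define s where "s = rec_seq n q (\<lambda>k. if k < d then 0 else a k)"
  define C where "C = Abs_fps (\<lambda>i. of_nat ((d + i) choose d) * m i)"
  define Q where "Q = (\<Prod>j = 1..n. 1 - fps_const (u j) * fps_X)"
  have "Q = fps_of_poly (\<Prod>j=1..n. [:1, - u j:])"
    by (simp add: Q_def fps_of_poly_prod fps_of_poly_pCons flip: fps_const_neg)
  hence Qn: "fps_nth Q i = q i" for i by (simp add: q_def char_coeff_def)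
  hence Q0: "fps_nth Q 0 \<noteq> 0" by (simp add: q_def)
  have Cn: "fps_nth C i = s (d + i)" for i
  proof -
    have "of_nat ((d + i) choose d) \<noteq> (0 :: 'k)" by simp
    thus ?thesis by (simp add: C_def m_def moment_vec_def s_def q_def)
  qed
  have zero: "fps_nth (Q * C) k = 0" if "k > n - d - 1" for k
  proof -
    have "fps_nth (Q * C) k = (\<Sum>i\<in>{0..k}. q i * s (d + (k - i)))"
      by (simp add: fps_mult_nth Qn Cn)
    also have "\<dots> = (\<Sum>i\<in>{0..k} \<inter> {..n}. q i * s (d + k - i))"
    proof (rule sum.mono_neutral_cong_right)
      show "\<forall>i\<in>{0..k} - {0..k} \<inter> {..n}. q i * s (d + (k - i)) = 0"
        by (auto simp: q_def char_coeff_above)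
    qed auto
    also have "\<dots> = (\<Sum>i\<le>n. q i * s (d + k - i))"
    proof (rule sum.mono_neutral_left)
      show "\<forall>i\<in>{..n} - {0..k} \<inter> {..n}. q i * s (d + k - i) = 0"
      proof
        fix i assume "i \<in> {..n} - {0..k} \<inter> {..n}"
        hence "d + k - i < d" using that assms(1) by auto
        thus "q i * s (d + k - i) = 0" using assms(1) by (simp add: s_def)
      qed
    qed auto
    also have "\<dots> = 0"
      unfolding s_def by (rule rec_seq_relation) (use that assms(1) in \<open>auto simp: q_def\<close>)
    finally show ?thesis .
  qed
  define A where "A = (\<Sum>i\<le>n - d - 1. monom (fps_nth (Q * C) i) i)"
  have cA: "coeff A k = fps_nth (Q * C) k" for k
    using zero[of k] by (auto simp: A_def coeff_sum)
  have "degree A \<le> n - d - 1"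
    by (rule degree_le) (simp add: cA zero)
  moreover have "coeff A 0 = 1"
    using assms by (simp add: cA Cn s_def Qn q_def)
  moreover have "C = fps_of_poly A / Q"
  proof -
    have "fps_of_poly A = C * Q" by (rule fps_ext) (simp add: cA mult.commute)
    thus ?thesis using Q0 by (metis fps_nonzero_nth nonzero_mult_div_cancel_right)
  qed
  ultimately show ?thesis
    unfolding moment_points_def C_def Q_def m_def[symmetric] by blast
qed

section \<open>Homogeneous components and the ideal of the variety\<close>

definition hom_comp :: "nat \<Rightarrow> 'a::comm_ring_1 mpoly \<Rightarrow> 'a mpoly" where
  "hom_comp k f =
     (\<Sum>s | s \<in> Poly_Mapping.keys f \<and> mono_degree s = k. Poly_Mapping.single s (Poly_Mapping.lookup f s))"

lemma lookup_hom_comp: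
  "Poly_Mapping.lookup (hom_comp k f) s = (if mono_degree s = k then Poly_Mapping.lookup f s else 0)"
  by (auto simp: hom_comp_def lookup_sum lookup_single when_def in_keys_iff)

lemma keys_hom_comp: "Poly_Mapping.keys (hom_comp k f) = {s \<in> Poly_Mapping.keys f. mono_degree s = k}"
  by (auto simp: in_keys_iff lookup_hom_comp split: if_splits)

lemma homogeneous_hom_comp: "homogeneous k (hom_comp k f)"
  by (simp add: homogeneous_def keys_hom_comp)

lemma hom_comp_carrier: "f \<in> carrier (mpoly_ring r) \<Longrightarrow> hom_comp k f \<in> carrier (mpoly_ring r)"
  by (auto simp: mpoly_ring_def keys_hom_comp)

lemma sum_hom_comp: "(\<Sum>k\<in>mono_degree ` Poly_Mapping.keys f. hom_comp k f) = f"
proof (rule poly_mapping_eqI)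
  fix s
  have "s \<notin> Poly_Mapping.keys f \<Longrightarrow> Poly_Mapping.lookup f s = 0" by (simp add: in_keys_iff)
  thus "Poly_Mapping.lookup (\<Sum>k\<in>mono_degree ` Poly_Mapping.keys f. hom_comp k f) s = Poly_Mapping.lookup f s"
    by (cases "s \<in> Poly_Mapping.keys f") (simp_all add: lookup_sum lookup_hom_comp)
qed

lemma mono_eval_scale:
  fixes c :: "'a::comm_ring_1"
  shows "mono_eval (\<lambda>i. c * v i) s = c ^ mono_degree s * mono_eval v s"
  by (simp add: mono_eval_def mono_degree_def power_mult_distrib prod.distrib power_sum)

text \<open>For fixed \<open>v\<close>, the value at \<open>c * v\<close> is a polynomial in
  \<open>c\<close> whose \<open>k\<close>-th coefficient is the value of the degree \<open>k\<close>
  component at \<open>v\<close>. Characteristic zero supplies enough scalars to conclude that this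
  polynomial is zero.\<close>

lemma mpoly_eval_hom_comp_eq_0:
  fixes f :: "'k::field_char_0 mpoly"
  assumes "\<And>c. mpoly_eval (\<lambda>i. c * v i) f = 0"
  shows "mpoly_eval v (hom_comp k f) = 0"
proof -
  define p where "p = (\<Sum>s\<in>Poly_Mapping.keys f.
      monom (Poly_Mapping.lookup f s * mono_eval v s) (mono_degree s))"
  have "poly p c = mpoly_eval (\<lambda>i. c * v i) f" for c
    by (simp add: p_def poly_sum poly_monom mpoly_eval_eq mpoly_eval_with_def mono_eval_scale mult_ac)
  hence "p = 0" using assms poly_all_0_iff_0[of p] by simp
  hence "0 = coeff p k" by simp
  also have "\<dots> = (\<Sum>s\<in>Poly_Mapping.keys f. if mono_degree s = k then Poly_Mapping.lookup f s * mono_eval v s else 0)"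
    by (simp add: p_def coeff_sum)
  also have "\<dots> = (\<Sum>s\<in>Poly_Mapping.keys (hom_comp k f). Poly_Mapping.lookup f s * mono_eval v s)"
    unfolding keys_hom_comp by (simp add: sum.inter_filter)
  also have "\<dots> = mpoly_eval v (hom_comp k f)"
    by (simp add: mpoly_eval_eq mpoly_eval_with_def lookup_hom_comp keys_hom_comp)
  finally show ?thesis by simp
qed

lemma mpoly_eval_add: "mpoly_eval v (f + g) = mpoly_eval v f + mpoly_eval v g"
  unfolding mpoly_eval_eq by (rule comm_ring_hom.mpoly_eval_with_add[OF comm_ring_hom_id])

lemma mpoly_eval_mult: "mpoly_eval v (f * g) = mpoly_eval v f * mpoly_eval v g"
  unfolding mpoly_eval_eq by (rule comm_ring_hom.mpoly_eval_with_mult[OF comm_ring_hom_id])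

lemma mpoly_eval_sum: "mpoly_eval v (\<Sum>x\<in>A. f x) = (\<Sum>x\<in>A. mpoly_eval v (f x))"
  unfolding mpoly_eval_eq by (rule comm_ring_hom.mpoly_eval_with_sum[OF comm_ring_hom_id])

lemma mpoly_eval_0 [simp]: "mpoly_eval v 0 = 0"
  by (simp add: mpoly_eval_def)

lemma hom_comp_cone_ideal:
  fixes f :: "'k::field_char_0 mpoly"
  assumes "f \<in> cone_ideal d n r"
  shows "hom_comp k f \<in> cone_ideal d n r"
proof -
  have "mpoly_eval (moment_vec (\<lambda>c. c) d n u a) (hom_comp k f) = 0" for u a
  proof (rule mpoly_eval_hom_comp_eq_0)
    fix c
    have "mpoly_eval (moment_vec (\<lambda>c. c) d n u (\<lambda>k. c * a k)) f = 0"
      using assms by (simp add: cone_ideal_def)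
    thus "mpoly_eval (\<lambda>i. c * moment_vec (\<lambda>c. c) d n u a i) f = 0"
      by (simp add: moment_vec_scale[abs_def])
  qed
  thus ?thesis using assms by (simp add: cone_ideal_def hom_comp_carrier)
qed

lemma moment_points_in_proj_space:
  assumes "d < n"
  shows "(moment_points d n r :: (nat \<Rightarrow> 'k::field_char_0) set set) \<subseteq> proj_space r"
proof
  fix P :: "(nat \<Rightarrow> 'k) set" assume "P \<in> moment_points d n r"
  then obtain u a where P: "P = proj_point (\<lambda>i. if i \<le> r then moment_vec (\<lambda>c. c) d n u a i else 0)"
    and a: "a d = 1" using moment_points_subset[OF assms] by blast
  have "moment_vec (\<lambda>c. c) d n u a 0 = 1" using assms a by (simp add: moment_vec_def)
  hence "\<exists>i. (if i \<le> r then moment_vec (\<lambda>c. c) d n u a i else 0) \<noteq> 0"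
    by (intro exI[of _ 0]) simp
  thus "P \<in> proj_space r" unfolding P proj_space_def by auto
qed

lemma moment_points_subset_variety: "moment_points d n r \<subseteq> moment_variety d n r"
  by (auto simp: moment_variety_def zariski_closure_def)

lemma mpoly_eval_moment_point:
  assumes "f \<in> carrier (mpoly_ring r)"
  shows "mpoly_eval (\<lambda>i. c * (if i \<le> r then moment_vec (\<lambda>c. c) d n u a i else 0)) f =
     mpoly_eval (moment_vec (\<lambda>c. c) d n u (\<lambda>k. c * a k)) f"
  by (rule mpoly_eval_cong[OF assms]) (simp add: moment_vec_scale)

lemma cone_ideal_vanishes:
  fixes f :: "'k::field_char_0 mpoly"
  assumes "d < n" "f \<in> cone_ideal d n r" "P \<in> moment_points d n r" "v \<in> P"
  shows "mpoly_eval v f = 0"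
proof -
  obtain u a where P: "P = proj_point (\<lambda>i. if i \<le> r then moment_vec (\<lambda>c. c) d n u a i else 0)"
    using moment_points_subset[OF assms(1,3)] by blast
  then obtain c where v: "v = (\<lambda>i. c * (if i \<le> r then moment_vec (\<lambda>c. c) d n u a i else 0))"
    using assms(4) unfolding proj_point_def by blast
  show ?thesis unfolding v using assms(2)
    by (subst mpoly_eval_moment_point) (auto simp: cone_ideal_def)
qed

text \<open>Parameters with \<open>a d \<noteq> 0\<close> are rescaled to \<open>a d = 1\<close>.
  The others are limits: varying only \<open>a d\<close> gives a univariate polynomial that vanishes
  at all but one argument.\<close>

lemma cone_idealI:
  fixes f :: "'k::field_char_0 mpoly"
  assumes "d < n" "f \<in> carrier (mpoly_ring r)"
    and zero: "\<And>P v. P \<in> moment_points d n r \<Longrightarrow> v \<in> P \<Longrightarrow> mpoly_eval v f = 0"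
  shows "f \<in> cone_ideal d n r"
proof -
  have nz: "mpoly_eval (moment_vec (\<lambda>c. c) d n u a) f = 0" if "a d \<noteq> 0" for u a
  proof -
    define b where "b k = a k / a d" for k
    have a: "a = (\<lambda>k. a d * b k)" using that by (auto simp: b_def)
    have b: "b d = 1" using that by (simp add: b_def)
    have "mpoly_eval (\<lambda>i. a d * (if i \<le> r then moment_vec (\<lambda>c. c) d n u b i else 0)) f = 0"
      using proj_point_in_moment_points[OF assms(1), of b r u, OF b]
      by (rule zero)
         (use that in \<open>unfold proj_point_def, blast\<close>)
    thus ?thesis
      unfolding mpoly_eval_moment_point[OF assms(2)] a[symmetric] .
  qed
  have "mpoly_eval (moment_vec (\<lambda>c. c) d n u a) f = 0" for u a
  proof -
    define p where "p = mpoly_eval_with (\<lambda>c. [:c:])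
      (moment_vec (\<lambda>c. [:c:]) d n (\<lambda>j. [:u j:]) (\<lambda>k. [:a k, if k = d then 1 else 0:])) f"
    have p: "poly p t = mpoly_eval (moment_vec (\<lambda>c. c) d n u (\<lambda>k. a k + t * (if k = d then 1 else 0))) f" for t
      unfolding p_def poly_mpoly_eval_moment_vec by simp
    have "p = 0"
    proof (rule poly_eq_0_cofinite[of "{- a d}"])
      fix t assume "t \<notin> {- a d}"
      hence "a d + t \<noteq> 0" by (simp add: eq_neg_iff_add_eq_0 add.commute)
      thus "poly p t = 0" unfolding p by (intro nz) simp
    qed simp
    thus ?thesis using p[of 0] by simp
  qed
  thus ?thesis using assms(2) by (simp add: cone_ideal_def)
qed

text \<open>Closed sets are given by homogeneous equations, so an element of
  \<open>cone_ideal\<close> has to be decomposed. The common zeros of its components form a closed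
  set containing the parametrised points, hence also their closure.\<close>

lemma vanishing_ideal_moment_variety:
  assumes "d < n"
  shows "vanishing_ideal r (moment_variety d n r) = (cone_ideal d n r :: 'k::field_char_0 mpoly set)"
proof (intro equalityI subsetI)
  fix f :: "'k mpoly" assume "f \<in> vanishing_ideal r (moment_variety d n r)"
  thus "f \<in> cone_ideal d n r"
    using moment_points_subset_variety[of d n r]
    by (intro cone_idealI assms) (auto simp: vanishing_ideal_def)
next
  fix f :: "'k mpoly" assume f: "f \<in> cone_ideal d n r"
  hence fc: "f \<in> carrier (mpoly_ring r)" by (simp add: cone_ideal_def)
  define X where "X = zero_locus r (range (\<lambda>k. hom_comp k f))"
  have "zariski_closed r X"
    unfolding zariski_closed_def X_def
    by (intro exI[of _ "range (\<lambda>k. hom_comp k f)"]) (use hom_comp_carrier[OF fc] homogeneous_hom_comp in blast)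
  moreover have "moment_points d n r \<subseteq> X"
    unfolding X_def zero_locus_def
    using moment_points_in_proj_space[OF assms] cone_ideal_vanishes[OF assms hom_comp_cone_ideal[OF f]] by blast
  ultimately have sub: "moment_variety d n r \<subseteq> X"
    by (auto simp: moment_variety_def zariski_closure_def)
  have "mpoly_eval v f = 0" if "P \<in> moment_variety d n r" "v \<in> P" for P v
  proof -
    have "mpoly_eval v (hom_comp k f) = 0" for k
      using sub that by (auto simp: X_def zero_locus_def)
    hence "mpoly_eval v (\<Sum>k\<in>mono_degree ` Poly_Mapping.keys f. hom_comp k f) = 0"
      by (simp add: mpoly_eval_sum)
    thus ?thesis by (simp add: sum_hom_comp)
  qed
  thus "f \<in> vanishing_ideal r (moment_variety d n r)" using fc by (simp add: vanishing_ideal_def)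
qed

section \<open>Hankel minors\<close>

lemma pick_image:
  fixes j :: "nat \<Rightarrow> nat"
  assumes "strict_mono_on {..n} j" "l \<le> n"
  shows "pick (j ` {..n}) l = j l"
proof -
  have "{a \<in> j ` {..n}. a < j l} = j ` {..<l}"
  proof (intro equalityI subsetI)
    fix a assume "a \<in> {a \<in> j ` {..n}. a < j l}"
    then obtain k where "k \<le> n" "a = j k" "j k < j l" by auto
    thus "a \<in> j ` {..<l}"
      using strict_mono_on_less[OF assms(1), of k l] assms(2) by simp
  next
    fix a assume "a \<in> j ` {..<l}"
    then obtain k where k: "k < l" "a = j k" by auto
    have "j k < j l"
      by (rule strict_mono_onD[OF assms(1) _ _ k(1)]) (use k(1) assms(2) in simp_all)
    thus "a \<in> {a \<in> j ` {..n}. a < j l}"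
      using k assms(2) by simp
  qed
  moreover have "inj_on j {..<l}"
    by (rule inj_on_subset[OF strict_mono_on_imp_inj_on[OF assms(1)]]) (use assms(2) in auto)
  ultimately have "card {a \<in> j ` {..n}. a < j l} = l" by (simp add: card_image)
  thus ?thesis using pick_card_in_set[of "j l" "j ` {..n}"] assms(2) by simp
qed

text \<open>Continued by the identity beyond \<open>n\<close>, as \<open>permutes\<close>
  requires.\<close>

definition rev_perm :: "nat \<Rightarrow> nat \<Rightarrow> nat" where
  "rev_perm n i = (if i \<le> n then n - i else i)"

lemma rev_perm_permutes: "rev_perm n permutes {0..<Suc n}"
  by (rule bij_imp_permutes, rule bij_betw_byWitness[of _ "rev_perm n"]) (auto simp: rev_perm_def)

text \<open>A strictly decreasing map of \<open>0, ..., n\<close> into itself has no slack: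
  descending from \<open>p 0 \<le> n\<close> gives \<open>p i \<le> n - i\<close>, and climbing back
  from \<open>p n \<ge> 0\<close> gives the converse.\<close>

lemma eq_rev_permI:
  assumes p: "p permutes {0..<Suc n}" and dec: "\<And>i. i < n \<Longrightarrow> p (Suc i) < p i"
  shows "p = rev_perm n"
proof
  fix i
  have up: "p i + i \<le> n" if "i \<le> n" for i
    using that
  proof (induction i)
    case 0
    have "p 0 \<in> {0..<Suc n}" using permutes_in_image[OF p, of 0] by simp
    thus ?case by simp
  next
    case (Suc i)
    thus ?case using dec[of i] by simp
  qed
  have down: "k \<le> p (n - k)" if "k \<le> n" for k
    using that
  proof (induction k)
    case (Suc k)
    have "Suc (n - Suc k) = n - k" using Suc.prems by simp
    thus ?case using Suc dec[of "n - Suc k"] by simp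
  qed simp
  show "p i = rev_perm n i"
  proof (cases "i \<le> n")
    case True
    thus ?thesis using up[of i] down[of "n - i"] by (simp add: rev_perm_def)
  next
    case False
    thus ?thesis using permutes_not_in[OF p, of i] by (simp add: rev_perm_def)
  qed
qed

text \<open>Exchanging the images of two neighbours \<open>i\<close>, \<open>i + 1\<close> with \<open>p i < p (i + 1)\<close> decreases the
  sum, so the reversal is the only minimiser.\<close>

lemma sum_squares_rearrangement:
  fixes f :: "nat \<Rightarrow> nat"
  assumes f: "strict_mono_on {..n} f" and p: "p permutes {0..<Suc n}" "p \<noteq> rev_perm n"
  shows "(\<Sum>i\<le>n. (i + f (rev_perm n i))\<^sup>2) < (\<Sum>i\<le>n. (i + f (p i))\<^sup>2)"
proof -
  define E where "E p = (\<Sum>i\<le>n. (i + f (p i))\<^sup>2)" for p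
  have step: "\<exists>p'. p' permutes {0..<Suc n} \<and> E p' < E p"
    if p: "p permutes {0..<Suc n}" "p \<noteq> rev_perm n" for p
  proof -
    obtain i where i: "i < n" "\<not> p (Suc i) < p i" using eq_rev_permI[OF p(1)] p(2) by blast
    have "p i \<noteq> p (Suc i)" using permutes_inj[OF p(1)] by (simp add: inj_eq)
    hence lt: "p i < p (Suc i)" using i by simp
    have "p i \<in> {0..<Suc n}" "p (Suc i) \<in> {0..<Suc n}"
      using i permutes_in_image[OF p(1)] by auto
    hence flt: "f (p i) < f (p (Suc i))"
      using lt strict_mono_onD[OF f, of "p i" "p (Suc i)"] by simp
    define p' where "p' = p \<circ> transpose i (Suc i)"
    have p': "p' permutes {0..<Suc n}"
      unfolding p'_def by (rule permutes_compose[OF permutes_swap_id p(1)]) (use i in auto)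
    have split: "(\<Sum>k\<le>n. g k) = g i + g (Suc i) + (\<Sum>k\<in>{..n} - {i, Suc i}. g k)" for g :: "nat \<Rightarrow> nat"
    proof -
      have "(\<Sum>k\<le>n. g k) = (\<Sum>k\<in>{i, Suc i}. g k) + (\<Sum>k\<in>{..n} - {i, Suc i}. g k)"
        by (subst add.commute, rule sum.subset_diff) (use i in auto)
      thus ?thesis by simp
    qed
    have rest: "(\<Sum>k\<in>{..n} - {i, Suc i}. (k + f (p' k))\<^sup>2) = (\<Sum>k\<in>{..n} - {i, Suc i}. (k + f (p k))\<^sup>2)"
      by (rule sum.cong) (auto simp: p'_def transpose_def)
    have "(i + f (p (Suc i)))\<^sup>2 + (Suc i + f (p i))\<^sup>2 < (i + f (p i))\<^sup>2 + (Suc i + f (p (Suc i)))\<^sup>2"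
      using flt by (simp add: power2_eq_square algebra_simps)
    hence "E p' < E p"
      unfolding E_def split[of "\<lambda>k. (k + f (p' k))\<^sup>2"] split[of "\<lambda>k. (k + f (p k))\<^sup>2"] rest
      by (simp add: p'_def)
    thus ?thesis using p' by blast
  qed
  have min: "E (rev_perm n) \<le> E p" if "p permutes {0..<Suc n}" for p
    using that
  proof (induction "E p" arbitrary: p rule: less_induct)
    case less
    show ?case
    proof (cases "p = rev_perm n")
      case False
      then obtain p' where "p' permutes {0..<Suc n}" "E p' < E p" using step less.prems by blast
      thus ?thesis using less.hyps[of p'] by simp
    qed simp
  qed
  obtain p' where p': "p' permutes {0..<Suc n}" "E p' < E p" using step p by blast
  have "E (rev_perm n) < E p" using min[OF p'(1)] p'(2) by simp
  thus ?thesis unfolding E_def .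
qed

section \<open>Weights of monomials and the expansion of the minors\<close>

definition weight :: "(nat \<Rightarrow> nat) \<Rightarrow> monomial \<Rightarrow> nat" where
  "weight w s = (\<Sum>i\<in>Poly_Mapping.keys s. Poly_Mapping.lookup s i * w i)"

lemma weight_superset:
  assumes "finite A" "Poly_Mapping.keys s \<subseteq> A"
  shows "weight w s = (\<Sum>i\<in>A. Poly_Mapping.lookup s i * w i)"
  unfolding weight_def
  by (rule sum.mono_neutral_left) (use assms in \<open>auto simp: in_keys_iff\<close>)

lemma weight_add: "weight w (s + t) = weight w s + weight w t"
proof -
  let ?A = "Poly_Mapping.keys s \<union> Poly_Mapping.keys t"
  have "weight w (s + t) = (\<Sum>i\<in>?A. Poly_Mapping.lookup (s + t) i * w i)"
    by (rule weight_superset) (use keys_add[of s t] in auto)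
  also have "\<dots> = weight w s + weight w t"
    by (simp add: weight_superset[of ?A] lookup_add distrib_right sum.distrib)
  finally show ?thesis .
qed

lemma weight_single [simp]: "weight w (Poly_Mapping.single i k) = k * w i"
  by (simp add: weight_def)

lemma weight_sum: "weight w (\<Sum>i\<in>A. s i) = (\<Sum>i\<in>A. weight w (s i))"
  by (induction A rule: infinite_finite_induct) (simp_all add: weight_add, simp_all add: weight_def)

lemma hankel_entry_eq:
  "(hankel_entry d k :: 'a::comm_ring_1 mpoly) =
     (if k < d then 0 else Poly_Mapping.single (Poly_Mapping.single (k - d) 1) (of_nat (k choose d)))"
  by (simp add: hankel_entry_def mconst_def mvar_def mult_single flip: single_of_nat)

lemma prod_single:
  "(\<Prod>i\<in>A. Poly_Mapping.single (s i) (c i) :: 'a::comm_ring_1 mpoly) =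
     Poly_Mapping.single (\<Sum>i\<in>A. s i) (\<Prod>i\<in>A. c i)"
  by (induction A rule: infinite_finite_induct) (simp_all add: mult_single)

locale hankel_setup =
  fixes d n r :: nat
  assumes d_less: "d < n" and r_ge: "2 * n - d \<le> r"
begin

abbreviation "middle \<equiv> {n - d..r - n}"

lemma pick_strict_mono:
  assumes "J \<in> maximal_column_sets d n r"
  shows "strict_mono_on {..n} (pick J)"
  using assms by (intro strict_mono_onI pick_mono) (auto simp: maximal_column_sets_def)

text \<open>The set \<open>J\<close> has \<open>l\<close> elements before its \<open>l\<close>-th
  one and \<open>n - l\<close> after it. On the antidiagonal, where column \<open>l\<close> meets
  row \<open>n - l\<close>, the two bounds say that the index of \<open>c\<close> lies between
  \<open>n\<close> and \<open>r + d - n\<close>, which is the range of the middle variables.\<close>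

lemma pick_bounds:
  assumes J: "J \<in> maximal_column_sets d n r" and l: "l \<le> n"
  shows "l \<le> pick J l" "pick J l + (n - l) \<le> r + d - n"
proof -
  note sm = strict_mono_onD[OF pick_strict_mono[OF J]]
  have "i \<le> pick J i" if "i \<le> n" for i
    using that
  proof (induction i)
    case (Suc i)
    thus ?case using sm[of i "Suc i"] by simp
  qed simp
  thus "l \<le> pick J l" using l by simp
  have "pick J n \<in> J" using J by (intro pick_in_set_le) (auto simp: maximal_column_sets_def)
  hence n: "pick J n \<le> r + d - n" using J by (auto simp: maximal_column_sets_def)
  have "pick J (n - i) + i \<le> pick J n" if "i \<le> n" for i
    using that
  proof (induction i)
    case (Suc i)
    thus ?case using sm[of "n - Suc i" "n - i"] Suc_diff_Suc[of i n] by simp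
  qed simp
  from this[of "n - l"] show "pick J l + (n - l) \<le> r + d - n" using l n by simp
qed

lemma hankel_submatrix_eq:
  assumes J: "J \<in> maximal_column_sets d n r"
  shows "hankel_submatrix d n r J = mat (Suc n) (Suc n) (\<lambda>(i, l). hankel_entry d (i + pick J l))"
proof -
  have "{j. j < r + d - n + 1 \<and> j \<in> J} = J" using J by (auto simp: maximal_column_sets_def)
  hence c: "card {j. j < r + d - n + 1 \<and> j \<in> J} = Suc n" using J by (simp add: maximal_column_sets_def)
  have c': "card {i. i < n + 1 \<and> i \<in> (UNIV :: nat set)} = Suc n" by simp
  show ?thesis
  proof (rule eq_matI)
    fix i l
    assume "i < dim_row (mat (Suc n) (Suc n) (\<lambda>(i, l). hankel_entry d (i + pick J l)) :: 'a mpoly mat)"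
      "l < dim_col (mat (Suc n) (Suc n) (\<lambda>(i, l). hankel_entry d (i + pick J l)) :: 'a mpoly mat)"
    hence il: "i < Suc n" "l < Suc n" by simp_all
    have "pick J l < r + d - n + 1" using pick_bounds(2)[OF J, of l] il by simp
    thus "hankel_submatrix d n r J $$ (i, l) =
        (mat (Suc n) (Suc n) (\<lambda>(i, l). hankel_entry d (i + pick J l)) :: 'a mpoly mat) $$ (i, l)"
      using il c by (simp add: hankel_submatrix_def submatrix_def hankel_matrix_def pick_UNIV)
  qed (use c in \<open>simp_all add: hankel_submatrix_def submatrix_def hankel_matrix_def\<close>)
qed

lemma mpoly_eval_hankel_entry:
  fixes u a :: "nat \<Rightarrow> 'k::field_char_0"
  shows "mpoly_eval (moment_vec (\<lambda>c. c) d n u a) (hankel_entry d k) =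
     rec_seq n (char_coeff n u) (\<lambda>k. if k < d then 0 else a k) k"
proof (cases "k < d")
  case True
  thus ?thesis using d_less by (simp add: hankel_entry_def)
next
  case False
  hence "of_nat (k choose d) \<noteq> (0 :: 'k)" by simp
  thus ?thesis using False
    unfolding mpoly_eval_eq
    by (simp add: hankel_entry_eq comm_ring_hom.mpoly_eval_with_single[OF comm_ring_hom_id] moment_vec_def)
qed

text \<open>Every column consists of \<open>n + 1\<close> consecutive terms of a recurrent sequence,
  so the reversed coefficients of the recurrence annihilate all columns at once; this vector is
  nonzero because its last entry is \<open>1\<close>.\<close>

lemma hankel_minor_vanishes:
  fixes u a :: "nat \<Rightarrow> 'k::field_char_0"
  assumes J: "J \<in> maximal_column_sets d n r"
  shows "mpoly_eval (moment_vec (\<lambda>c. c) d n u a) (det (hankel_submatrix d n r J)) = 0"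
proof -
  define q where "q = char_coeff n u"
  define s where "s = rec_seq n q (\<lambda>k. if k < d then 0 else a k)"
  interpret ev: comm_ring_hom "mpoly_eval (moment_vec (\<lambda>c. c) d n u a)"
    unfolding mpoly_eval_eq[abs_def]
    by (rule comm_ring_hom.comm_ring_hom_mpoly_eval_with[OF comm_ring_hom_id])
  define A where "A = mat (Suc n) (Suc n) (\<lambda>(i, l). s (i + pick J l))"
  have A: "A \<in> carrier_mat (Suc n) (Suc n)" by (simp add: A_def)
  have "map_mat (mpoly_eval (moment_vec (\<lambda>c. c) d n u a)) (hankel_submatrix d n r J) = A"
    unfolding hankel_submatrix_eq[OF J] A_def
    by (rule eq_matI) (auto simp: mpoly_eval_hankel_entry s_def q_def)
  hence "mpoly_eval (moment_vec (\<lambda>c. c) d n u a) (det (hankel_submatrix d n r J)) = det A"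
    using ev.hom_det[of "hankel_submatrix d n r J"] by simp
  also have "det A = det (transpose_mat A)" using det_transpose[OF A] by simp
  also have "det (transpose_mat A) = 0"
  proof (subst det_0_iff_vec_prod_zero_field[of _ "Suc n"])
    define w where "w = vec (Suc n) (\<lambda>i. q (n - i))"
    have "w $ n = 1" by (simp add: w_def q_def)
    hence "w \<noteq> 0\<^sub>v (Suc n)" by auto
    moreover have "transpose_mat A *\<^sub>v w = 0\<^sub>v (Suc n)"
    proof (rule eq_vecI)
      fix l assume "l < dim_vec (0\<^sub>v (Suc n) :: 'k vec)"
      hence l: "l < Suc n" by simp
      have "(transpose_mat A *\<^sub>v w) $ l = (\<Sum>i\<le>n. s (i + pick J l) * q (n - i))"
        using l by (simp add: A_def w_def scalar_prod_def atLeast0LessThan lessThan_Suc_atMost)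
      also have "\<dots> = (\<Sum>i\<le>n. q i * s (n + pick J l - i))"
        by (rule sum.reindex_bij_witness[of _ "\<lambda>i. n - i" "\<lambda>i. n - i"]) (auto simp: mult.commute add.commute)
      also have "\<dots> = 0"
        unfolding s_def by (rule rec_seq_relation) (simp_all add: q_def)
      finally show "(transpose_mat A *\<^sub>v w) $ l = 0\<^sub>v (Suc n) $ l" using l by simp
    qed (simp add: A_def)
    ultimately show "\<exists>v. v \<in> carrier_vec (Suc n) \<and> v \<noteq> 0\<^sub>v (Suc n) \<and> transpose_mat A *\<^sub>v v = 0\<^sub>v (Suc n)"
      by (intro exI[of _ w]) (simp add: w_def)
  qed (simp add: A_def)
  finally show ?thesis .
qed

text \<open>The truncated subtraction yields the right variables only if no entry has an index below
  \<open>d\<close>. Otherwise the product of the entries is \<open>0\<close>, a case that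
  \<open>hankel_prod_eq\<close> separates.\<close>

definition perm_mono :: "nat set \<Rightarrow> (nat \<Rightarrow> nat) \<Rightarrow> monomial" where
  "perm_mono J p = (\<Sum>i\<le>n. Poly_Mapping.single (i + pick J (p i) - d) 1)"

abbreviation anti_mono :: "nat set \<Rightarrow> monomial" where
  "anti_mono J \<equiv> perm_mono J (rev_perm n)"

abbreviation anti_weight :: "monomial \<Rightarrow> nat" where
  "anti_weight \<equiv> weight (\<lambda>k. (k + d)\<^sup>2)"

lemma hankel_prod_eq:
  fixes J :: "nat set" and p :: "nat \<Rightarrow> nat"
  shows "(\<Prod>i\<le>n. hankel_entry d (i + pick J (p i)) :: 'a::field_char_0 mpoly) =
    (if \<exists>i\<le>n. i + pick J (p i) < d then 0
     else Poly_Mapping.single (perm_mono J p) (\<Prod>i\<le>n. of_nat ((i + pick J (p i)) choose d)))"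
proof (cases "\<exists>i\<le>n. i + pick J (p i) < d")
  case True
  then obtain i where "i \<le> n" "i + pick J (p i) < d" by blast
  hence "(\<Prod>i\<le>n. hankel_entry d (i + pick J (p i)) :: 'a mpoly) = 0"
    by (intro prod_zero) (auto simp: hankel_entry_def)
  thus ?thesis using True by simp
next
  case False
  have "(\<Prod>i\<le>n. hankel_entry d (i + pick J (p i)) :: 'a mpoly) =
      (\<Prod>i\<le>n. Poly_Mapping.single (Poly_Mapping.single (i + pick J (p i) - d) 1) (of_nat ((i + pick J (p i)) choose d)))"
    by (rule prod.cong) (use False in \<open>auto simp: hankel_entry_eq\<close>)
  thus ?thesis using False by (simp only: prod_single perm_mono_def if_False)
qed

lemma det_hankel_submatrix:
  assumes J: "J \<in> maximal_column_sets d n r"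
  shows "(det (hankel_submatrix d n r J) :: 'a::field_char_0 mpoly) =
    (\<Sum>p | p permutes {0..<Suc n}. signof p * (\<Prod>i\<le>n. hankel_entry d (i + pick J (p i))))"
proof -
  have "(\<Prod>i = 0..<Suc n. hankel_submatrix d n r J $$ (i, p i)) =
      (\<Prod>i\<le>n. hankel_entry d (i + pick J (p i)) :: 'a mpoly)" if "p permutes {0..<Suc n}" for p
    unfolding atLeast0LessThan lessThan_Suc_atMost hankel_submatrix_eq[OF J]
    using permutes_in_image[OF that] by (intro prod.cong) auto
  thus ?thesis
    by (subst det_def'[of _ "Suc n"]) (simp_all add: hankel_submatrix_eq[OF J] del: prod.op_ivl_Suc)
qed

lemma anti_mono_index:
  assumes "J \<in> maximal_column_sets d n r" "i \<le> n"
  shows "n \<le> i + pick J (rev_perm n i)" "i + pick J (rev_perm n i) \<le> r + d - n"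
  using pick_bounds[OF assms(1), of "n - i"] assms(2) by (simp_all add: rev_perm_def)

lemma perm_mono_degree: "mono_degree (perm_mono J p) = Suc n"
  by (simp add: perm_mono_def mono_degree_sum)

lemma keys_perm_mono: "Poly_Mapping.keys (perm_mono J p) = (\<lambda>i. i + pick J (p i) - d) ` {..n}"
  by (auto simp: perm_mono_def in_keys_iff lookup_sum lookup_single when_def split: if_splits)

lemma perm_mono_monomials:
  assumes J: "J \<in> maximal_column_sets d n r" and p: "p permutes {0..<Suc n}"
  shows "perm_mono J p \<in> monomials r"
proof -
  have "i + pick J (p i) - d \<le> r" if "i \<le> n" for i
  proof -
    have "p i \<le> n" using permutes_in_image[OF p, of i] that by simp
    thus ?thesis using pick_bounds(2)[OF J, of "p i"] that d_less r_ge by simp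
  qed
  thus ?thesis by (auto simp: monomials_def keys_perm_mono)
qed

lemma anti_mono_monomials_on:
  assumes "J \<in> maximal_column_sets d n r"
  shows "anti_mono J \<in> monomials_on middle (Suc n)"
proof -
  have "i + pick J (rev_perm n i) - d \<in> middle" if "i \<le> n" for i
    using anti_mono_index[OF assms that] d_less r_ge by auto
  thus ?thesis by (auto simp: monomials_on_def keys_perm_mono perm_mono_degree)
qed

lemma anti_mono_index_ge:
  assumes "J \<in> maximal_column_sets d n r" "i \<le> n"
  shows "d \<le> i + pick J (rev_perm n i)"
  using anti_mono_index(1)[OF assms] d_less by simp

lemma anti_weight_perm_mono:
  assumes "\<And>i. i \<le> n \<Longrightarrow> d \<le> i + pick J (p i)"
  shows "anti_weight (perm_mono J p) = (\<Sum>i\<le>n. (i + pick J (p i))\<^sup>2)"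
  unfolding perm_mono_def weight_sum by (rule sum.cong) (use assms in auto)

lemma keys_signof_mult:
  "Poly_Mapping.keys (signof p * f :: 'a::field_char_0 mpoly) = Poly_Mapping.keys f"
  by (cases "evenperm p") (simp_all add: sign_def)

text \<open>Terms of different permutations may share a monomial or cancel. Every monomial that
  remains still comes from some permutation with no entry of index below \<open>d\<close>, and only
  the reversal attains the minimal weight.\<close>

lemma hankel_minor_keys:
  assumes J: "J \<in> maximal_column_sets d n r"
    and t: "t \<in> Poly_Mapping.keys (det (hankel_submatrix d n r J) :: 'a::field_char_0 mpoly)"
  shows "mono_degree t = Suc n" "t \<in> monomials r"
    "t = anti_mono J \<or> anti_weight (anti_mono J) < anti_weight t"
proof -
  have "t \<in> (\<Union>p\<in>{p. p permutes {0..<Suc n}}. Poly_Mapping.keys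
      (signof p * (\<Prod>i\<le>n. hankel_entry d (i + pick J (p i))) :: 'a mpoly))"
    using t keys_sum[of "\<lambda>p. signof p * (\<Prod>i\<le>n. hankel_entry d (i + pick J (p i))) :: 'a mpoly"]
    unfolding det_hankel_submatrix[OF J] by (rule rev_subsetD)
  then obtain p where p: "p permutes {0..<Suc n}"
    and "t \<in> Poly_Mapping.keys (\<Prod>i\<le>n. hankel_entry d (i + pick J (p i)) :: 'a mpoly)"
    unfolding keys_signof_mult by blast
  hence t: "t = perm_mono J p" and ok: "\<not> (\<exists>i\<le>n. i + pick J (p i) < d)"
    unfolding hankel_prod_eq by (auto split: if_splits)
  show "mono_degree t = Suc n" by (simp add: t perm_mono_degree)
  show "t \<in> monomials r" unfolding t by (rule perm_mono_monomials[OF J p])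
  show "t = anti_mono J \<or> anti_weight (anti_mono J) < anti_weight t"
  proof (cases "p = rev_perm n")
    case False
    have "anti_weight (anti_mono J) = (\<Sum>i\<le>n. (i + pick J (rev_perm n i))\<^sup>2)"
      by (rule anti_weight_perm_mono) (rule anti_mono_index_ge[OF J])
    also have "\<dots> < (\<Sum>i\<le>n. (i + pick J (p i))\<^sup>2)"
      by (rule sum_squares_rearrangement[OF pick_strict_mono[OF J] p False])
    also have "\<dots> = anti_weight t"
      unfolding t by (rule anti_weight_perm_mono[symmetric]) (use ok in auto)
    finally show ?thesis by simp
  qed (simp add: t)
qed

lemma anti_prod_nonzero:
  assumes J: "J \<in> maximal_column_sets d n r"
  shows "(\<Prod>i\<le>n. of_nat ((i + pick J (rev_perm n i)) choose d) :: 'a::field_char_0) \<noteq> 0"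
proof -
  have "(of_nat ((i + pick J (rev_perm n i)) choose d) :: 'a) \<noteq> 0" if "i \<le> n" for i
    using anti_mono_index_ge[OF J that] by simp
  thus ?thesis by simp
qed

lemma anti_hankel_prod_eq:
  assumes J: "J \<in> maximal_column_sets d n r"
  shows "(\<Prod>i\<le>n. hankel_entry d (i + pick J (rev_perm n i)) :: 'a::field_char_0 mpoly) =
    Poly_Mapping.single (anti_mono J) (\<Prod>i\<le>n. of_nat ((i + pick J (rev_perm n i)) choose d))"
proof -
  have "\<not> (\<exists>i\<le>n. i + pick J (rev_perm n i) < d)"
    using anti_mono_index_ge[OF J] by (auto simp: not_less)
  thus ?thesis unfolding hankel_prod_eq by (simp only: if_False)
qed

lemma antidiagonal_product_hankel:
  assumes J: "J \<in> maximal_column_sets d n r"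
  shows "(antidiagonal_product (hankel_submatrix d n r J) :: 'a::field_char_0 mpoly) =
    Poly_Mapping.single (anti_mono J) (\<Prod>i\<le>n. of_nat ((i + pick J (rev_perm n i)) choose d))"
  unfolding anti_hankel_prod_eq[OF J, symmetric] antidiagonal_product_def hankel_submatrix_eq[OF J]
  by (rule prod.cong) (auto simp: rev_perm_def)

text \<open>The antidiagonal term cannot cancel: any other permutation with nonzero product gives a
  monomial of strictly larger weight.\<close>

lemma anti_mono_in_keys:
  assumes J: "J \<in> maximal_column_sets d n r"
  shows "Poly_Mapping.lookup (det (hankel_submatrix d n r J) :: 'a::field_char_0 mpoly) (anti_mono J) \<noteq> 0"
proof -
  let ?g = "\<lambda>p. signof p * (\<Prod>i\<le>n. hankel_entry d (i + pick J (p i))) :: 'a mpoly"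
  have "Poly_Mapping.lookup (?g p) (anti_mono J) = 0" if p: "p permutes {0..<Suc n}" "p \<noteq> rev_perm n" for p
  proof (rule ccontr)
    assume "Poly_Mapping.lookup (?g p) (anti_mono J) \<noteq> 0"
    hence "anti_mono J \<in> Poly_Mapping.keys (\<Prod>i\<le>n. hankel_entry d (i + pick J (p i)) :: 'a mpoly)"
      using keys_signof_mult[of p] by (metis in_keys_iff)
    hence t: "anti_mono J = perm_mono J p" and ok: "\<not> (\<exists>i\<le>n. i + pick J (p i) < d)"
      unfolding hankel_prod_eq by (auto split: if_splits)
    have "anti_weight (anti_mono J) = (\<Sum>i\<le>n. (i + pick J (rev_perm n i))\<^sup>2)"
      by (rule anti_weight_perm_mono) (rule anti_mono_index_ge[OF J])
    also have "\<dots> < (\<Sum>i\<le>n. (i + pick J (p i))\<^sup>2)"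
      by (rule sum_squares_rearrangement[OF pick_strict_mono[OF J] p])
    also have "\<dots> = anti_weight (anti_mono J)"
      unfolding t by (rule anti_weight_perm_mono[symmetric]) (use ok in auto)
    finally show False by simp
  qed
  hence "Poly_Mapping.lookup (det (hankel_submatrix d n r J) :: 'a mpoly) (anti_mono J) =
      (\<Sum>p\<in>{rev_perm n}. Poly_Mapping.lookup (?g p) (anti_mono J))"
    unfolding det_hankel_submatrix[OF J] lookup_sum
    by (intro sum.mono_neutral_right) (auto simp: finite_permutations rev_perm_permutes)
  also have "\<dots> \<noteq> 0"
    using anti_prod_nonzero[OF J, where 'a='a]
    by (simp only: sum.insert finite.emptyI sum.empty anti_hankel_prod_eq[OF J]
          in_keys_iff[symmetric] keys_signof_mult empty_iff not_False_eq_True add_0_right keys_single if_False insertI1)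
  finally show ?thesis .
qed

end

section \<open>Reduction modulo the minors\<close>

lemma monomial_split_var:
  assumes "0 < Poly_Mapping.lookup s x"
  shows "s = Poly_Mapping.single x 1 + (s - Poly_Mapping.single x (1::nat))"
  by (rule poly_mapping_eqI) (use assms in \<open>auto simp: lookup_add lookup_minus lookup_single when_def\<close>)

lemma monomial_eq_sorted_list:
  assumes "mono_degree s = k"
  shows "\<exists>xs. length xs = k \<and> sorted xs \<and> set xs \<subseteq> Poly_Mapping.keys s \<and>
    s = sum_list (map (\<lambda>x. Poly_Mapping.single x (1::nat)) xs)"
proof -
  have "\<exists>xs. length xs = k \<and> set xs \<subseteq> Poly_Mapping.keys s \<and>
    s = sum_list (map (\<lambda>x. Poly_Mapping.single x (1::nat)) xs)"
    using assms
  proof (induction k arbitrary: s)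
    case 0
    hence "Poly_Mapping.lookup s x = 0" for x
      by (cases "x \<in> Poly_Mapping.keys s") (auto simp: mono_degree_def in_keys_iff)
    hence "s = 0" by (intro poly_mapping_eqI) simp
    thus ?case by simp
  next
    case (Suc k)
    then obtain x where x: "x \<in> Poly_Mapping.keys s"
      by (metis all_not_in_conv keys_eq_empty mono_degree_0 nat.distinct(1))
    define s' where "s' = s - Poly_Mapping.single x 1"
    have s: "s = Poly_Mapping.single x 1 + s'"
      unfolding s'_def by (rule monomial_split_var) (use x in \<open>simp add: in_keys_iff\<close>)
    hence "mono_degree s' = k" using Suc.prems by (simp add: mono_degree_add)
    then obtain xs where xs: "length xs = k" "set xs \<subseteq> Poly_Mapping.keys s'"
      "s' = sum_list (map (\<lambda>x. Poly_Mapping.single x (1::nat)) xs)"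
      using Suc.IH by blast
    have "Poly_Mapping.keys s' \<subseteq> Poly_Mapping.keys s"
      by (auto simp: s'_def in_keys_iff lookup_minus)
    hence "set (x # xs) \<subseteq> Poly_Mapping.keys s" using xs x by auto
    moreover have "s = sum_list (map (\<lambda>x. Poly_Mapping.single x (1::nat)) (x # xs))"
      using s xs(3) by simp
    ultimately show ?case using xs(1) by (metis length_Cons)
  qed
  then obtain xs where xs: "length xs = k" "set xs \<subseteq> Poly_Mapping.keys s"
    "s = sum_list (map (\<lambda>x. Poly_Mapping.single x (1::nat)) xs)" by blast
  have "sum_list (map f (sort xs)) = sum_list (map f xs)" for f :: "nat \<Rightarrow> monomial"
    by (metis mset_map mset_sort sum_mset_sum_list)
  thus ?thesis using xs by (intro exI[of _ "sort xs"]) simp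
qed

lemma monomial_factor:
  assumes V: "finite V" and k: "k \<le> deg_in V t"
  shows "\<exists>s u. t = s + u \<and> s \<in> monomials_on V k"
  using k
proof (induction k)
  case 0
  show ?case by (intro exI[of _ 0] exI[of _ t]) (simp add: monomials_on_def)
next
  case (Suc k)
  then obtain s u where t: "t = s + u" and s: "s \<in> monomials_on V k" by force
  have "deg_in V s = k" using s mono_degree_eq_deg_in[OF V, of s] by (simp add: monomials_on_def)
  hence "deg_in V u \<noteq> 0" using Suc.prems t by (simp add: deg_in_add)
  then obtain x where x: "x \<in> V" "Poly_Mapping.lookup u x \<noteq> 0"
    unfolding deg_in_def by (meson sum.neutral)
  have "t = (s + Poly_Mapping.single x 1) + (u - Poly_Mapping.single x 1)"
    unfolding t using x(2) by (subst monomial_split_var[of u x]) (simp_all add: add.assoc)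
  moreover have "s + Poly_Mapping.single x 1 \<in> monomials_on V (Suc k)"
    using s x(1) keys_add[of s "Poly_Mapping.single x 1"] by (auto simp: monomials_on_def mono_degree_add)
  ultimately show ?case by blast
qed

lemma monomials_add: "s \<in> monomials r \<Longrightarrow> t \<in> monomials r \<Longrightarrow> s + t \<in> monomials r"
  using keys_add[of s t] by (auto simp: monomials_def)

lemma monomials_add_iff: "s + t \<in> monomials r \<longleftrightarrow> s \<in> monomials r \<and> t \<in> monomials r"
proof
  assume *: "s + t \<in> monomials r"
  have "Poly_Mapping.keys s \<subseteq> Poly_Mapping.keys (s + t)" "Poly_Mapping.keys t \<subseteq> Poly_Mapping.keys (s + t)"
    by (auto simp: in_keys_iff lookup_add)
  thus "s \<in> monomials r \<and> t \<in> monomials r" using * by (auto simp: monomials_def)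
qed (simp add: monomials_add)

lemma finite_monomials_degree: "finite {s \<in> monomials r. mono_degree s = k}"
  using finite_monomials_on[of "{..r}" k] by (simp add: monomials_on_def monomials_def)

lemma mpoly_ring_simps:
  "carrier (mpoly_ring r) = {f. Poly_Mapping.keys f \<subseteq> monomials r}"
  "f \<otimes>\<^bsub>mpoly_ring r\<^esub> g = f * g" "f \<oplus>\<^bsub>mpoly_ring r\<^esub> g = f + g"
  "\<one>\<^bsub>mpoly_ring r\<^esub> = 1" "\<zero>\<^bsub>mpoly_ring r\<^esub> = 0"
  by (simp_all add: mpoly_ring_def)

lemma mpoly_ring_ring: "ring (mpoly_ring r :: 'a::comm_ring_1 mpoly ring)"
  using mpoly_ring_cring cring.axioms(1) by blast

lemma single_in_carrier: "t \<in> monomials r \<Longrightarrow> Poly_Mapping.single t c \<in> carrier (mpoly_ring r)"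
  by (simp add: mpoly_ring_simps)

lemma lookup_single_0_mult:
  "Poly_Mapping.lookup (Poly_Mapping.single 0 c * g) s = c * Poly_Mapping.lookup g s"
  for g :: "'a::comm_ring_1 mpoly"
  unfolding mult_map_scale_conv_mult[symmetric] by transfer (simp add: when_def)

context
  fixes I :: "'a::comm_ring_1 mpoly set" and r :: nat
  assumes I: "ideal I (mpoly_ring r)"
begin

lemma mpoly_ideal_carrier: "f \<in> I \<Longrightarrow> f \<in> carrier (mpoly_ring r)"
  using ideal.Icarr[OF I] by blast

lemma mpoly_ideal_0: "0 \<in> I"
  using additive_subgroup.zero_closed[OF ideal.axioms(1)[OF I]] by (simp add: mpoly_ring_simps)

lemma mpoly_ideal_add: "f \<in> I \<Longrightarrow> g \<in> I \<Longrightarrow> f + g \<in> I"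
  using additive_subgroup.a_closed[OF ideal.axioms(1)[OF I]] by (simp add: mpoly_ring_simps)

lemma mpoly_ideal_mult: "f \<in> I \<Longrightarrow> g \<in> carrier (mpoly_ring r) \<Longrightarrow> g * f \<in> I"
  using ideal.I_l_closed[OF I, of f g] by (simp add: mpoly_ring_simps)

lemma mpoly_ideal_sum: "(\<And>x. x \<in> A \<Longrightarrow> f x \<in> I) \<Longrightarrow> (\<Sum>x\<in>A. f x) \<in> I"
  by (induction A rule: infinite_finite_induct) (auto simp: mpoly_ideal_0 intro: mpoly_ideal_add)

lemma mpoly_ideal_scale: "f \<in> I \<Longrightarrow> Poly_Mapping.single 0 c * f \<in> I"
  by (rule mpoly_ideal_mult) (auto simp: mpoly_ring_simps monomials_def)

lemma mpoly_ideal_diff: "f \<in> I \<Longrightarrow> g \<in> I \<Longrightarrow> f - g \<in> I"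
  using mpoly_ideal_add[of f "- g"] mpoly_ideal_scale[of g "-1"]
  by (simp add: single_uminus)

end

text \<open>Adding \<open>l\<close> to the \<open>l\<close>-th entry makes a weakly increasing list
  strictly increasing, hence a set of columns. The row index \<open>n - l\<close> on the
  antidiagonal compensates the shift, so the entry in column \<open>l\<close> has index
  \<open>xs ! l + d\<close>, which belongs to the variable with index \<open>xs ! l\<close>.\<close>

lemma (in hankel_setup) sorted_shift:
  assumes xs: "length xs = Suc n" "sorted xs" "set xs \<subseteq> middle"
  defines "j \<equiv> \<lambda>l. xs ! l + d - n + l"
  shows "j ` {..n} \<in> maximal_column_sets d n r"
    and "anti_mono (j ` {..n}) = sum_list (map (\<lambda>x. Poly_Mapping.single x (1::nat)) xs)"
proof -
  have mem: "n - d \<le> xs ! l" "xs ! l \<le> r - n" if "l \<le> n" for l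
  proof -
    have "xs ! l \<in> set xs" using that xs(1) by simp
    thus "n - d \<le> xs ! l" "xs ! l \<le> r - n" using xs(3) by auto
  qed
  have sm: "strict_mono_on {..n} j"
  proof (rule strict_mono_onI)
    fix l k assume "l \<in> {..n}" "k \<in> {..n}" "l < k"
    hence "xs ! l \<le> xs ! k" using sorted_nth_mono[OF xs(2), of l k] xs(1) by simp
    thus "j l < j k" using \<open>l < k\<close> by (simp add: j_def)
  qed
  have "j l < r + d - n + 1" if "l \<le> n" for l
    using mem[OF that] that d_less r_ge by (simp add: j_def)
  moreover have "card (j ` {..n}) = Suc n"
    by (simp add: card_image strict_mono_on_imp_inj_on[OF sm])
  ultimately show "j ` {..n} \<in> maximal_column_sets d n r"
    by (auto simp: maximal_column_sets_def)
  have "anti_mono (j ` {..n}) = (\<Sum>i\<le>n. Poly_Mapping.single (xs ! (n - i)) 1)"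
    unfolding perm_mono_def
  proof (rule sum.cong)
    fix i assume "i \<in> {..n}"
    hence i: "i \<le> n" by simp
    have "i + pick (j ` {..n}) (rev_perm n i) - d = i + j (n - i) - d"
      using pick_image[OF sm, of "n - i"] i by (simp add: rev_perm_def)
    also have "\<dots> = xs ! (n - i)"
      using mem[of "n - i"] i d_less by (simp add: j_def)
    finally show "Poly_Mapping.single (i + pick (j ` {..n}) (rev_perm n i) - d) (1::nat) =
        Poly_Mapping.single (xs ! (n - i)) 1" by simp
  qed simp
  also have "\<dots> = (\<Sum>i\<le>n. Poly_Mapping.single (xs ! i) 1)"
    by (rule sum.reindex_bij_witness[of _ "\<lambda>i. n - i" "\<lambda>i. n - i"]) auto
  also have "\<dots> = (\<Sum>i<length xs. Poly_Mapping.single (xs ! i) 1)"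
    unfolding xs(1) lessThan_Suc_atMost ..
  also have "\<dots> = sum_list (map (\<lambda>x. Poly_Mapping.single x (1::nat)) xs)"
    by (simp add: sum_list_sum_nth atLeast0LessThan)
  finally show "anti_mono (j ` {..n}) = sum_list (map (\<lambda>x. Poly_Mapping.single x (1::nat)) xs)" .
qed

context hankel_setup
begin

lemma anti_mono_image: "anti_mono ` maximal_column_sets d n r = monomials_on middle (Suc n)"
proof (intro equalityI subsetI)
  fix s assume s: "s \<in> monomials_on middle (Suc n)"
  then obtain xs where xs: "length xs = Suc n" "sorted xs" "set xs \<subseteq> Poly_Mapping.keys s"
    and s': "s = sum_list (map (\<lambda>x. Poly_Mapping.single x (1::nat)) xs)"
    using monomial_eq_sorted_list[of s "Suc n"] by (auto simp: monomials_on_def)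
  have "set xs \<subseteq> middle" using xs(3) s by (auto simp: monomials_on_def)
  note shift = sorted_shift[OF xs(1,2) this]
  show "s \<in> anti_mono ` maximal_column_sets d n r"
    unfolding s' shift(2)[symmetric] by (rule imageI[OF shift(1)])
qed (use anti_mono_monomials_on in blast)

lemma finite_maximal_column_sets: "finite (maximal_column_sets d n r)"
  unfolding maximal_column_sets_def by (rule finite_subset[of _ "Pow {..<r + d - n + 1}"]) auto

lemma card_middle: "card middle + n = r + d - n + 1"
  using d_less r_ge by simp

text \<open>A surjection between finite sets of equal size: \<open>period choose (n + 1)\<close>
  counts both the column sets and the monomials of degree \<open>n + 1\<close> in the middle
  variables, where \<open>period\<close> stands for \<open>r + d - n + 1\<close>.\<close>

lemma anti_mono_inj: "inj_on anti_mono (maximal_column_sets d n r)"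
proof (rule eq_card_imp_inj_on[OF finite_maximal_column_sets])
  have "card (maximal_column_sets d n r) = (r + d - n + 1) choose (n + 1)"
    unfolding maximal_column_sets_def by (subst n_subsets) auto
  moreover have "card (monomials_on middle (Suc n)) = (card middle + n) choose (n + 1)"
    by (subst card_monomials_on) auto
  ultimately show "card (anti_mono ` maximal_column_sets d n r) = card (maximal_column_sets d n r)"
    unfolding anti_mono_image card_middle by simp
qed

definition std_mono :: "monomial \<Rightarrow> bool" where
  "std_mono s \<longleftrightarrow> s \<in> monomials r \<and> deg_in middle s \<le> n"

text \<open>The relation \<open>prec\<close> is kept abstract because two instances are needed:
  larger antidiagonal weight, which requires no term order, and the strict part of a given
  antidiagonal order. Well-foundedness of \<open>prec\<close> is not assumed. The minors are
  homogeneous, so rewriting stays among the finitely many monomials of one degree.\<close>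

lemma reduce_monomial:
  fixes I :: "'a::field_char_0 mpoly set"
  assumes I: "ideal I (mpoly_ring r)" and minors: "hankel_minors d n r \<subseteq> I"
    and irrefl: "\<And>s. \<not> prec s s"
    and trans: "\<And>s t u. prec s t \<Longrightarrow> prec t u \<Longrightarrow> prec s u"
    and mono: "\<And>s t u. prec s t \<Longrightarrow> u \<in> monomials r \<Longrightarrow> prec (s + u) (t + u)"
    and lead: "\<And>J t. J \<in> maximal_column_sets d n r \<Longrightarrow>
      t \<in> Poly_Mapping.keys (det (hankel_submatrix d n r J) :: 'a mpoly) \<Longrightarrow>
      t \<noteq> anti_mono J \<Longrightarrow> prec t (anti_mono J)"
    and t: "t \<in> monomials r"
  shows "\<exists>h. Poly_Mapping.single t 1 - h \<in> I \<and> (std_mono t \<longrightarrow> h = Poly_Mapping.single t 1) \<and>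
     (\<forall>s\<in>Poly_Mapping.keys h. std_mono s \<and> mono_degree s = mono_degree t \<and> (s = t \<or> prec s t))"
  using t
proof (induction "card {s \<in> monomials r. mono_degree s = mono_degree t \<and> prec s t}" arbitrary: t rule: less_induct)
  case less
  show ?case
  proof (cases "std_mono t")
    case True
    thus ?thesis by (intro exI[of _ "Poly_Mapping.single t 1"]) (simp add: mpoly_ideal_0[OF I])
  next
    case False
    hence "Suc n \<le> deg_in middle t" using less.prems by (simp add: std_mono_def)
    then obtain s u where tsu: "t = s + u" and "s \<in> monomials_on middle (Suc n)"
      using monomial_factor[of middle "Suc n" t] by auto
    then obtain J where J: "J \<in> maximal_column_sets d n r" and s: "s = anti_mono J"
      unfolding anti_mono_image[symmetric] by blast
    have u: "u \<in> monomials r" using less.prems tsu by (simp add: monomials_add_iff)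
    define g :: "'a mpoly" where "g = det (hankel_submatrix d n r J)"
    define c where "c = Poly_Mapping.lookup g s"
    have c: "c \<noteq> 0" unfolding c_def g_def s by (rule anti_mono_in_keys[OF J])
    have gI: "g \<in> I" using minors J by (auto simp: hankel_minors_def g_def)
    define K where "K = Poly_Mapping.keys g - {s}"
    have K: "prec (x + u) t" "mono_degree (x + u) = mono_degree t" "x + u \<in> monomials r" if "x \<in> K" for x
    proof -
      have x: "x \<in> Poly_Mapping.keys (det (hankel_submatrix d n r J) :: 'a mpoly)" "x \<noteq> anti_mono J"
        using that by (auto simp: K_def g_def s)
      show "prec (x + u) t" unfolding tsu s by (rule mono[OF lead[OF J x] u])
      show "mono_degree (x + u) = mono_degree t"
        using hankel_minor_keys(1)[OF J x(1)] by (simp add: tsu s mono_degree_add perm_mono_degree)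
      show "x + u \<in> monomials r"
        by (rule monomials_add[OF hankel_minor_keys(2)[OF J x(1)] u])
    qed
    have IH: "\<exists>h. Poly_Mapping.single (x + u) 1 - h \<in> I \<and>
        (\<forall>s\<in>Poly_Mapping.keys h. std_mono s \<and> mono_degree s = mono_degree t \<and> prec s t)" if x: "x \<in> K" for x
    proof -
      have "card {s \<in> monomials r. mono_degree s = mono_degree (x + u) \<and> prec s (x + u)} <
          card {s \<in> monomials r. mono_degree s = mono_degree t \<and> prec s t}"
      proof (rule psubset_card_mono)
        show "finite {s \<in> monomials r. mono_degree s = mono_degree t \<and> prec s t}"
          by (rule finite_subset[OF _ finite_monomials_degree[of r "mono_degree t"]]) auto
        have "x + u \<in> {s \<in> monomials r. mono_degree s = mono_degree t \<and> prec s t}"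
          using K[OF x] by simp
        moreover have "x + u \<notin> {s \<in> monomials r. mono_degree s = mono_degree (x + u) \<and> prec s (x + u)}"
          using irrefl by simp
        moreover have "{s \<in> monomials r. mono_degree s = mono_degree (x + u) \<and> prec s (x + u)} \<subseteq>
            {s \<in> monomials r. mono_degree s = mono_degree t \<and> prec s t}"
          using K(1,2)[OF x] trans by auto
        ultimately show "{s \<in> monomials r. mono_degree s = mono_degree (x + u) \<and> prec s (x + u)} \<subset>
            {s \<in> monomials r. mono_degree s = mono_degree t \<and> prec s t}" by blast
      qed
      from less.hyps[OF this K(3)[OF x]] obtain h where
        h: "Poly_Mapping.single (x + u) 1 - h \<in> I"
          "\<forall>s\<in>Poly_Mapping.keys h. std_mono s \<and> mono_degree s = mono_degree (x + u) \<and> (s = x + u \<or> prec s (x + u))"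
        by blast
      have "std_mono s \<and> mono_degree s = mono_degree t \<and> prec s t" if "s \<in> Poly_Mapping.keys h" for s
        using h(2) that K(1,2)[OF x] trans[of s "x + u" t] by auto
      thus ?thesis using h(1) by blast
    qed
    then obtain H where H1: "\<And>x. x \<in> K \<Longrightarrow> Poly_Mapping.single (x + u) 1 - H x \<in> I"
      and H2: "\<And>x s. x \<in> K \<Longrightarrow> s \<in> Poly_Mapping.keys (H x) \<Longrightarrow> std_mono s \<and> mono_degree s = mono_degree t \<and> prec s t"
      by metis
    let ?b = "\<lambda>x. - Poly_Mapping.lookup g x / c"
    define h where "h = (\<Sum>x\<in>K. Poly_Mapping.single 0 (?b x) * H x)"
    have fK: "finite K" by (simp add: K_def)
    have g_eq: "g = Poly_Mapping.single s c + (\<Sum>x\<in>K. Poly_Mapping.single x (Poly_Mapping.lookup g x))"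
    proof -
      have "s \<in> Poly_Mapping.keys g" using c by (simp add: c_def in_keys_iff)
      hence "(\<Sum>x\<in>Poly_Mapping.keys g. Poly_Mapping.single x (Poly_Mapping.lookup g x)) =
          Poly_Mapping.single s c + (\<Sum>x\<in>K. Poly_Mapping.single x (Poly_Mapping.lookup g x))"
        unfolding K_def c_def by (subst sum.remove[of _ s]) auto
      thus ?thesis unfolding mpoly_eq_sum_single .
    qed
    \<comment> \<open>This multiple of the minor has coefficient \<open>1\<close> at
      \<open>t\<close>. Its other terms are smaller than \<open>t\<close> and get replaced by their
      remainders from the induction hypothesis.\<close>
    have "Poly_Mapping.single u (1 / c) * g =
        Poly_Mapping.single t 1 - (\<Sum>x\<in>K. Poly_Mapping.single (x + u) (?b x))"
      by (subst g_eq) (simp add: distrib_left sum_distrib_left mult_single tsu c add.commute single_uminus sum_negf)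
    hence "Poly_Mapping.single t 1 - h = Poly_Mapping.single u (1 / c) * g +
        (\<Sum>x\<in>K. Poly_Mapping.single 0 (?b x) * (Poly_Mapping.single (x + u) 1 - H x))"
      unfolding h_def by (simp add: right_diff_distrib sum_subtractf mult_single)
    also have "\<dots> \<in> I"
      using gI H1 u by (intro mpoly_ideal_add[OF I] mpoly_ideal_mult[OF I] mpoly_ideal_sum[OF I]
          mpoly_ideal_scale[OF I] single_in_carrier)
    finally have "Poly_Mapping.single t 1 - h \<in> I" .
    moreover have "std_mono s \<and> mono_degree s = mono_degree t \<and> (s = t \<or> prec s t)"
      if "s \<in> Poly_Mapping.keys h" for s
    proof -
      have "s \<in> (\<Union>x\<in>K. Poly_Mapping.keys (Poly_Mapping.single 0 (?b x) * H x))"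
        using that keys_sum[of "\<lambda>x. Poly_Mapping.single 0 (?b x) * H x" K] unfolding h_def by blast
      then obtain x where "x \<in> K" "s \<in> Poly_Mapping.keys (Poly_Mapping.single 0 (?b x) * H x)" by blast
      moreover from this have "s \<in> Poly_Mapping.keys (H x)"
        using keys_mult[of "Poly_Mapping.single 0 (?b x)" "H x"] by (auto split: if_splits)
      ultimately show ?thesis using H2 by blast
    qed
    ultimately show ?thesis using False by blast
  qed
qed

text \<open>The last clause serves leading monomials. Other monomials \<open>t\<close> of
  \<open>f\<close> contribute to the coefficient at \<open>s\<close> only if
  \<open>prec s t\<close>, so a standard \<open>s\<close> below none of them keeps its
  coefficient.\<close>

lemma reduce_polynomial:
  fixes I :: "'a::field_char_0 mpoly set"
  assumes I: "ideal I (mpoly_ring r)" and minors: "hankel_minors d n r \<subseteq> I"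
    and irrefl: "\<And>s. \<not> prec s s"
    and trans: "\<And>s t u. prec s t \<Longrightarrow> prec t u \<Longrightarrow> prec s u"
    and mono: "\<And>s t u. prec s t \<Longrightarrow> u \<in> monomials r \<Longrightarrow> prec (s + u) (t + u)"
    and lead: "\<And>J t. J \<in> maximal_column_sets d n r \<Longrightarrow>
      t \<in> Poly_Mapping.keys (det (hankel_submatrix d n r J) :: 'a mpoly) \<Longrightarrow>
      t \<noteq> anti_mono J \<Longrightarrow> prec t (anti_mono J)"
    and f: "f \<in> carrier (mpoly_ring r)"
  shows "\<exists>h. f - h \<in> I \<and> (\<forall>s\<in>Poly_Mapping.keys h. std_mono s) \<and>
     (\<forall>s. std_mono s \<longrightarrow> (\<forall>t\<in>Poly_Mapping.keys f. \<not> prec s t) \<longrightarrow> Poly_Mapping.lookup h s = Poly_Mapping.lookup f s)"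
proof -
  have "\<forall>t\<in>Poly_Mapping.keys f. \<exists>h. Poly_Mapping.single t 1 - h \<in> I \<and> (std_mono t \<longrightarrow> h = Poly_Mapping.single t 1) \<and>
     (\<forall>s\<in>Poly_Mapping.keys h. std_mono s \<and> mono_degree s = mono_degree t \<and> (s = t \<or> prec s t))"
  proof
    fix t assume "t \<in> Poly_Mapping.keys f"
    hence "t \<in> monomials r" using f by (auto simp: mpoly_ring_simps)
    thus "\<exists>h. Poly_Mapping.single t 1 - h \<in> I \<and> (std_mono t \<longrightarrow> h = Poly_Mapping.single t 1) \<and>
       (\<forall>s\<in>Poly_Mapping.keys h. std_mono s \<and> mono_degree s = mono_degree t \<and> (s = t \<or> prec s t))"
      using I minors irrefl trans mono lead by (intro reduce_monomial[where prec = prec]) blast+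
  qed
  then obtain H where H: "\<And>t. t \<in> Poly_Mapping.keys f \<Longrightarrow> Poly_Mapping.single t 1 - H t \<in> I"
    "\<And>t. t \<in> Poly_Mapping.keys f \<Longrightarrow> std_mono t \<Longrightarrow> H t = Poly_Mapping.single t 1"
    "\<And>t s. t \<in> Poly_Mapping.keys f \<Longrightarrow> s \<in> Poly_Mapping.keys (H t) \<Longrightarrow> std_mono s \<and> (s = t \<or> prec s t)"
    by metis
  let ?c = "\<lambda>t. Poly_Mapping.lookup f t"
  define h where "h = (\<Sum>t\<in>Poly_Mapping.keys f. Poly_Mapping.single 0 (?c t) * H t)"
  note lk = lookup_single_0_mult
  have "f - h = (\<Sum>t\<in>Poly_Mapping.keys f. Poly_Mapping.single 0 (?c t) * (Poly_Mapping.single t 1 - H t))"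
    by (simp add: h_def right_diff_distrib sum_subtractf mult_single mpoly_eq_sum_single)
  also have "\<dots> \<in> I"
    by (intro mpoly_ideal_sum[OF I] mpoly_ideal_scale[OF I] H)
  finally have "f - h \<in> I" .
  moreover have "std_mono s" if "s \<in> Poly_Mapping.keys h" for s
  proof (rule ccontr)
    assume "\<not> std_mono s"
    hence "Poly_Mapping.lookup (H t) s = 0" if "t \<in> Poly_Mapping.keys f" for t
      using H(3)[OF that, of s] by (auto simp: in_keys_iff)
    hence "Poly_Mapping.lookup h s = 0" by (simp add: h_def lookup_sum lk)
    thus False using that by (simp add: in_keys_iff)
  qed
  moreover have "Poly_Mapping.lookup h s = ?c s"
    if s: "std_mono s" "\<forall>t\<in>Poly_Mapping.keys f. \<not> prec s t" for s
  proof -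
    have "Poly_Mapping.lookup (H t) s = (if t = s then 1 else 0)" if t: "t \<in> Poly_Mapping.keys f" for t
    proof (cases "t = s")
      case True
      thus ?thesis using H(2)[OF t] s by simp
    next
      case False
      hence "s \<notin> Poly_Mapping.keys (H t)" using H(3)[OF t, of s] s(2) t by blast
      thus ?thesis using False by (simp add: in_keys_iff)
    qed
    hence "Poly_Mapping.lookup h s = (\<Sum>t\<in>Poly_Mapping.keys f. if t = s then ?c t else 0)"
      unfolding h_def lookup_sum lk by (intro sum.cong) simp_all
    thus ?thesis by (simp add: in_keys_iff)
  qed
  ultimately show ?thesis by blast
qed

end

section \<open>Exponential sums\<close>

lemma poly_eq_on_finite:
  fixes p q :: "'a::field poly"
  assumes "finite S" "degree p < card S" "degree q < card S" "\<And>x. x \<in> S \<Longrightarrow> poly p x = poly q x"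
  shows "p = q"
proof (rule ccontr)
  assume "p \<noteq> q"
  hence nz: "p - q \<noteq> 0" by simp
  have "card S \<le> card {x. poly (p - q) x = 0}"
    by (rule card_mono[OF poly_roots_finite[OF nz]]) (use assms in auto)
  also have "\<dots> \<le> degree (p - q)" by (rule card_poly_roots_bound[OF nz])
  also have "\<dots> < card S" using degree_diff_le_max[of p q] assms by simp
  finally show False by simp
qed

definition lagrange_poly :: "'a::field set \<Rightarrow> 'a \<Rightarrow> 'a poly" where
  "lagrange_poly S x = (\<Prod>y\<in>S - {x}. Polynomial.smult (1 / (x - y)) [:- y, 1:])"

lemma degree_lagrange_poly:
  assumes "finite S" "x \<in> S"
  shows "degree (lagrange_poly S x) < card S"
proof -
  have "degree (lagrange_poly S x) \<le> (\<Sum>y\<in>S - {x}. degree (Polynomial.smult (1 / (x - y)) [:- y, 1:]))"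
    unfolding lagrange_poly_def using assms
    by (intro order_trans[OF degree_prod_sum_le]) (simp_all add: comp_def del: smult_pCons)
  also have "\<dots> \<le> (\<Sum>y\<in>S - {x}. 1)"
    by (rule sum_mono) (simp only: degree_smult_eq, simp)
  also have "\<dots> < card S" using assms card_Diff1_less[of S x] by simp
  finally show ?thesis .
qed

lemma poly_lagrange_poly:
  assumes "finite S" "x \<in> S" "z \<in> S"
  shows "poly (lagrange_poly S x) z = (if z = x then 1 else 0)"
proof (cases "z = x")
  case True
  have "poly (lagrange_poly S x) x = (\<Prod>y\<in>S - {x}. 1)"
    unfolding lagrange_poly_def poly_prod by (rule prod.cong) (auto simp: divide_simps)
  thus ?thesis using True by simp
next
  case False
  thus ?thesis using assms by (auto simp: lagrange_poly_def poly_prod intro!: prod_zero)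
qed

lemma poly_as_sum_less:
  fixes p :: "'a::comm_ring_1 poly"
  assumes "degree p < n"
  shows "poly p x = (\<Sum>i<n. coeff p i * x ^ i)"
proof -
  have "(\<Sum>i<n. coeff p i * x ^ i) = (\<Sum>i\<le>degree p. coeff p i * x ^ i)"
    by (rule sum.mono_neutral_right) (use assms in \<open>auto simp: coeff_eq_0\<close>)
  thus ?thesis by (simp add: poly_altdef)
qed

text \<open>A Vandermonde system solved by Lagrange polynomials: for \<open>k < n\<close>
  interpolating the \<open>k\<close>-th power on \<open>S\<close> reproduces it exactly, and
  comparing coefficients shows that the weights \<open>w\<close> read off from the Lagrange
  coefficients solve the system.\<close>

lemma power_sums_surj:
  fixes S :: "'a::field set"
  assumes S: "finite S" "card S = n"
  shows "\<exists>w. \<forall>k<n. (\<Sum>x\<in>S. w x * x ^ k) = a k"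
proof (intro exI allI impI)
  fix k assume k: "k < n"
  define w where "w x = (\<Sum>i<n. coeff (lagrange_poly S x) i * a i)" for x
  have "(\<Sum>x\<in>S. Polynomial.smult (x ^ k) (lagrange_poly S x)) = monom 1 k"
  proof (rule poly_eq_on_finite[OF S(1)])
    have "degree (\<Sum>x\<in>S. Polynomial.smult (x ^ k) (lagrange_poly S x)) \<le> card S - 1"
      by (rule degree_sum_le[OF S(1)])
         (use degree_lagrange_poly[OF S(1)] in \<open>fastforce intro: order_trans[OF degree_smult_le]\<close>)
    thus "degree (\<Sum>x\<in>S. Polynomial.smult (x ^ k) (lagrange_poly S x)) < card S" using k S(2) by simp
    show "degree (monom (1::'a) k) < card S" using k S(2) by (simp add: degree_monom_eq)
    fix z assume z: "z \<in> S"
    have "(\<Sum>x\<in>S. x ^ k * poly (lagrange_poly S x) z) = (\<Sum>x\<in>S. if x = z then x ^ k else 0)"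
      by (rule sum.cong) (use poly_lagrange_poly[OF S(1) _ z] in auto)
    thus "poly (\<Sum>x\<in>S. Polynomial.smult (x ^ k) (lagrange_poly S x)) z = poly (monom 1 k) z"
      using z S(1) by (simp add: poly_sum poly_monom)
  qed
  hence "coeff (\<Sum>x\<in>S. Polynomial.smult (x ^ k) (lagrange_poly S x)) i = (if i = k then 1 else 0)" for i by simp
  hence c: "(\<Sum>x\<in>S. x ^ k * coeff (lagrange_poly S x) i) = (if i = k then 1 else 0)" for i
    by (simp add: coeff_sum)
  have "(\<Sum>x\<in>S. w x * x ^ k) = (\<Sum>x\<in>S. \<Sum>i<n. a i * (x ^ k * coeff (lagrange_poly S x) i))"
    by (simp add: w_def sum_distrib_left sum_distrib_right mult_ac)
  also have "\<dots> = (\<Sum>i<n. a i * (\<Sum>x\<in>S. x ^ k * coeff (lagrange_poly S x) i))"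
    by (subst sum.swap) (simp add: sum_distrib_left)
  also have "\<dots> = (\<Sum>i<n. if i = k then a i else 0)"
    unfolding c by (rule sum.cong) auto
  also have "\<dots> = a k" using k by simp
  finally show "(\<Sum>x\<in>S. w x * x ^ k) = a k" .
qed

text \<open>Apply the functional that sends a polynomial to its \<open>w\<close>-weighted sum over
  \<open>S\<close> to the product of the linear factors for the points other than \<open>x\<close>.
  This product is monic of degree \<open>n - 1\<close>, so the prescribed moments give
  \<open>1\<close>; directly, only the summand at \<open>x\<close> remains.\<close>

lemma power_sum_weight_nonzero:
  fixes S :: "'a::field set"
  assumes S: "finite S" "card S = n"
    and w: "\<And>k. k < n \<Longrightarrow> (\<Sum>x\<in>S. w x * x ^ k) = (if Suc k = n then 1 else 0)"
    and x: "x \<in> S"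
  shows "w x \<noteq> 0"
proof -
  define p where "p = (\<Prod>y\<in>S - {x}. [:- y, 1:])"
  have n: "0 < n" using S x by (auto simp: card_gt_0_iff)
  have deg: "degree p = n - 1"
    unfolding p_def using S x by (subst degree_prod_eq_sum_degree) (auto simp: card_Diff_singleton)
  have lead: "coeff p (n - 1) = 1"
    unfolding deg[symmetric] by (simp add: p_def lead_coeff_prod)
  have "(\<Sum>y\<in>S. w y * poly p y) = (\<Sum>y\<in>S. \<Sum>i<n. coeff p i * (w y * y ^ i))"
    using deg n by (simp add: poly_as_sum_less[of p n] sum_distrib_left mult_ac)
  also have "\<dots> = (\<Sum>i<n. coeff p i * (\<Sum>y\<in>S. w y * y ^ i))"
    by (subst sum.swap) (simp add: sum_distrib_left)
  also have "\<dots> = (\<Sum>i<n. if i = n - 1 then coeff p i else 0)"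
    by (rule sum.cong) (auto simp: w)
  also have "\<dots> = 1" using n lead by simp
  finally have "(\<Sum>y\<in>S. w y * poly p y) = 1" .
  moreover have "(\<Sum>y\<in>S. w y * poly p y) = (\<Sum>y\<in>{x}. w y * poly p y)"
    by (rule sum.mono_neutral_right) (use S x in \<open>auto simp: p_def poly_prod intro!: prod_zero\<close>)
  ultimately show ?thesis by auto
qed

lemma rec_seq_exp_sum:
  fixes u :: "nat \<Rightarrow> 'a::comm_ring_1"
  shows "rec_seq n (char_coeff n u) (\<lambda>k. \<Sum>j=1..n. w j * u j ^ k) k = (\<Sum>j=1..n. w j * u j ^ k)"
proof (rule rec_seq_unique)
  fix k assume k: "n \<le> k"
  have "(\<Sum>i\<le>n. char_coeff n u i * (\<Sum>j=1..n. w j * u j ^ (k - i))) =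
      (\<Sum>j=1..n. \<Sum>i\<le>n. char_coeff n u i * (w j * u j ^ (k - i)))"
    by (subst sum.swap) (simp add: sum_distrib_left)
  also have "\<dots> = (\<Sum>j=1..n. w j * u j ^ (k - n) * (\<Sum>i\<le>n. char_coeff n u i * u j ^ (n - i)))"
  proof (rule sum.cong)
    fix j
    have pow: "u j ^ (k - i) = u j ^ (k - n) * u j ^ (n - i)" if "i \<le> n" for i
    proof -
      have "k - i = (k - n) + (n - i)" using that k by simp
      show ?thesis by (subst \<open>k - i = (k - n) + (n - i)\<close>) (rule power_add)
    qed
    show "(\<Sum>i\<le>n. char_coeff n u i * (w j * u j ^ (k - i))) =
        w j * u j ^ (k - n) * (\<Sum>i\<le>n. char_coeff n u i * u j ^ (n - i))"
      unfolding sum_distrib_left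
    proof (rule sum.cong)
      fix i assume "i \<in> {..n}"
      hence i: "i \<le> n" by simp
      show "char_coeff n u i * (w j * u j ^ (k - i)) =
          w j * u j ^ (k - n) * (char_coeff n u i * u j ^ (n - i))"
        unfolding pow[OF i] by (simp only: mult_ac)
    qed simp
  qed simp
  also have "\<dots> = 0" by (simp add: char_coeff_root)
  finally have "(\<Sum>i\<le>n. char_coeff n u i * (\<Sum>j=1..n. w j * u j ^ (k - i))) = 0" .
  moreover have "{..n} = insert 0 {1..n}" by auto
  ultimately show "(\<Sum>j=1..n. w j * u j ^ k) = - (\<Sum>i=1..n. char_coeff n u i * (\<Sum>j=1..n. w j * u j ^ (k - i)))"
    by (simp add: eq_neg_iff_add_eq_0)
qed simp

text \<open>Used with \<open>p\<close> the square of the curve parameter: agreement of initial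
  values to first order spreads to all terms.\<close>

lemma dvd_rec_seq_diff:
  assumes "\<And>k. k < n \<Longrightarrow> p dvd a k - b k"
  shows "p dvd rec_seq n q a k - rec_seq n q b k"
proof (induction k rule: less_induct)
  case (less k)
  show ?case
  proof (cases "k < n")
    case False
    hence "rec_seq n q a k - rec_seq n q b k =
        - (\<Sum>i=1..n. q i * (rec_seq n q a (k - i) - rec_seq n q b (k - i)))"
      by (subst (1 2) rec_seq.simps) (simp add: right_diff_distrib sum_subtractf)
    also have "p dvd \<dots>"
      unfolding dvd_minus_iff by (intro dvd_sum dvd_mult less) (use False in auto)
    finally show ?thesis .
  qed (use assms in simp)
qed

text \<open>Writing the linear term as \<open>a * z\<close>, with \<open>z\<close> a logarithmic
  derivative, leaves the power of \<open>a\<close> unchanged in the derivative. This avoids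
  exponents \<open>k - 1\<close> and keeps periodicity in \<open>k\<close> usable.\<close>

lemma coeff_linear_power:
  fixes a z :: "'a::comm_ring_1"
  shows "coeff ([:a, a * z:] ^ k) 0 = a ^ k" "coeff ([:a, a * z:] ^ k) 1 = of_nat k * z * a ^ k"
proof -
  show 0: "coeff ([:a, a * z:] ^ k) 0 = a ^ k" for k
    by (simp add: coeff_0_power)
  show "coeff ([:a, a * z:] ^ k) 1 = of_nat k * z * a ^ k"
    by (induction k) (simp_all add: 0 coeff_mult algebra_simps)
qed

text \<open>\<open>E\<close> and \<open>C\<close> are square matrices because the index sets have
  equal size, so the right inverse \<open>C\<close> of \<open>E\<close> is also a left
  inverse.\<close>

lemma square_system_injective:
  fixes E :: "'p \<Rightarrow> 'q \<Rightarrow> 'k::field"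
  assumes fin: "finite P" "finite Q" and card: "card P = card Q"
    and inv: "\<And>S S'. S \<in> P \<Longrightarrow> S' \<in> P \<Longrightarrow> (\<Sum>b\<in>Q. E S b * C b S') = (if S = S' then 1 else 0)"
    and zero: "\<And>S. S \<in> P \<Longrightarrow> (\<Sum>b\<in>Q. E S b * g b) = 0"
    and b: "b \<in> Q"
  shows "g b = 0"
proof -
  define m where "m = card P"
  obtain f where f: "bij_betw f {0..<m} P" using ex_bij_betw_nat_finite[OF fin(1)] m_def by blast
  obtain h where h: "bij_betw h {0..<m} Q" using ex_bij_betw_nat_finite[OF fin(2)] m_def card by metis
  have fP: "f i \<in> P" if "i < m" for i using f that by (auto simp: bij_betw_def)
  define A where "A = mat m m (\<lambda>(i, j). E (f i) (h j))"
  define B where "B = mat m m (\<lambda>(j, i). C (h j) (f i))"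
  define x where "x = vec m (\<lambda>j. g (h j))"
  have AB: "A \<in> carrier_mat m m" "B \<in> carrier_mat m m" by (simp_all add: A_def B_def)
  have x: "x \<in> carrier_vec m" by (simp add: x_def)
  have sumQ: "(\<Sum>j\<in>{0..<m}. F (h j)) = (\<Sum>b\<in>Q. F b)" for F :: "'q \<Rightarrow> 'k"
    by (rule sum.reindex_bij_betw[OF h])
  have "A * B = 1\<^sub>m m"
  proof (rule eq_matI)
    fix i j assume "i < dim_row (1\<^sub>m m :: 'k mat)" "j < dim_col (1\<^sub>m m :: 'k mat)"
    hence ij: "i < m" "j < m" by simp_all
    have "(A * B) $$ (i, j) = (\<Sum>b\<in>Q. E (f i) b * C b (f j))"
      using ij by (simp add: A_def B_def scalar_prod_def sumQ[of "\<lambda>b. E (f i) b * C b (f j)"])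
    also have "\<dots> = (if f i = f j then 1 else 0)" using ij fP by (intro inv) auto
    also have "f i = f j \<longleftrightarrow> i = j"
      using f ij by (auto simp: bij_betw_def inj_on_def)
    finally show "(A * B) $$ (i, j) = 1\<^sub>m m $$ (i, j)" using ij by simp
  qed (simp_all add: A_def B_def)
  hence BA: "B * A = 1\<^sub>m m" by (rule mat_mult_left_right_inverse[OF AB])
  have "A *\<^sub>v x = 0\<^sub>v m"
  proof (rule eq_vecI)
    fix i assume "i < dim_vec (0\<^sub>v m :: 'k vec)"
    hence i: "i < m" by simp
    have "(A *\<^sub>v x) $ i = (\<Sum>b\<in>Q. E (f i) b * g b)"
      using i by (simp add: A_def x_def scalar_prod_def sumQ[of "\<lambda>b. E (f i) b * g b"])
    thus "(A *\<^sub>v x) $ i = 0\<^sub>v m $ i" using zero[OF fP[OF i]] i by simp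
  qed (simp add: A_def)
  hence "B *\<^sub>v (A *\<^sub>v x) = 0\<^sub>v m"
    using AB by (auto simp: scalar_prod_def intro!: eq_vecI)
  hence "(B * A) *\<^sub>v x = 0\<^sub>v m" using AB x by (simp add: assoc_mult_mat_vec)
  hence x0: "x = 0\<^sub>v m" unfolding BA using x by simp
  obtain j where j: "j < m" "b = h j" using h b by (auto simp: bij_betw_def)
  have "x $ j = 0" using x0 j by simp
  thus ?thesis using j by (simp add: x_def)
qed

text \<open>\<open>H\<close> has an outer and an inner variable, and the outer one is replaced by
  the inner one. Outer powers below \<open>k\<close> are absent and those above \<open>k\<close>
  contribute only to higher orders, so order \<open>k\<close> sees just one constant term.\<close>

lemma coeff_poly_at_var:
  fixes H :: "'a::comm_ring_1 poly poly"
  assumes "\<And>j. j < k \<Longrightarrow> coeff H j = 0"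
  shows "coeff (poly H [:0, 1:]) k = coeff (coeff H k) 0"
proof -
  have m: "[:0, 1:] ^ j = monom (1::'a) j" for j
    by (simp add: monom_altdef)
  have "coeff (poly H [:0, 1:]) k = (\<Sum>j\<le>degree H. if j \<le> k then coeff (coeff H j) (k - j) else 0)"
    unfolding poly_altdef coeff_sum m
    by (rule sum.cong) (simp_all add: mult.commute[of _ "monom 1 _"] coeff_monom_mult)
  also have "\<dots> = (\<Sum>j\<le>degree H. if j = k then coeff (coeff H j) 0 else 0)"
  proof (rule sum.cong)
    fix j
    show "(if j \<le> k then coeff (coeff H j) (k - j) else 0) = (if j = k then coeff (coeff H j) 0 else 0)"
      using assms[of j] by (cases j k rule: linorder_cases) auto
  qed simp
  also have "\<dots> = coeff (coeff H k) 0"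
    by (simp add: coeff_eq_0)
  finally show ?thesis .
qed

lemma mpoly_eval_with_cong:
  assumes "Poly_Mapping.keys f \<subseteq> monomials r" "\<And>i. i \<le> r \<Longrightarrow> v i = w i"
  shows "mpoly_eval_with h v f = mpoly_eval_with h w f"
proof -
  have "mono_eval v s = mono_eval w s" if "s \<in> Poly_Mapping.keys f" for s
    unfolding mono_eval_def
    by (rule prod.cong) (use that assms in \<open>auto simp: monomials_def subset_iff\<close>)
  thus ?thesis by (simp add: mpoly_eval_with_def)
qed

lemma comm_ring_hom_map_poly:
  assumes "comm_ring_hom h" shows "comm_ring_hom (map_poly h)"
proof -
  interpret comm_ring_hom h by fact
  show ?thesis
    by unfold_locales
       (auto intro!: poly_eqI simp: coeff_map_poly hom_add coeff_mult hom_sum hom_mult)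
qed

section \<open>Independence of the standard monomials\<close>

context hankel_setup
begin

abbreviation "period \<equiv> r + d - n + 1"

definition unity_subsets :: "complex set set" where
  "unity_subsets = {S. S \<subseteq> {z. z ^ period = 1} \<and> card S = n}"

definition star_weight :: "complex set \<Rightarrow> complex \<Rightarrow> complex" where
  "star_weight S = (SOME w. \<forall>k<n. (\<Sum>x\<in>S. w x * x ^ k) = (if Suc k = n then 1 else 0))"

definition star_seq :: "complex set \<Rightarrow> nat \<Rightarrow> complex" where
  "star_seq S k = (\<Sum>x\<in>S. star_weight S x * x ^ k)"

text \<open>The points over the base point at which, of the first and the last \<open>n\<close> entries of \<open>c\<close>, only
  \<open>c\<^bsub>n-1\<^esub>\<close> and \<open>c\<^bsub>r+d\<^esub>\<close> are nonzero, both equal to \<open>1\<close>. They correspond to the sets of \<open>n\<close> among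
  the \<open>r + d - n + 1\<close> roots of unity, so their number is the claimed degree.\<close>

definition star_point :: "complex set \<Rightarrow> nat \<Rightarrow> complex" where
  "star_point S i = inverse (of_nat ((d + i) choose d)) * star_seq S (d + i)"

lemma unity_finite: "finite {z::complex. z ^ period = 1}"
  by (rule finite_roots_unity) simp

lemma unity_subset_props:
  assumes "S \<in> unity_subsets"
  shows "finite S" "card S = n" "\<And>x. x \<in> S \<Longrightarrow> x ^ period = 1"
  using assms finite_subset[OF _ unity_finite, of S] by (auto simp: unity_subsets_def)

lemma finite_unity_subsets: "finite unity_subsets"
  unfolding unity_subsets_def by (rule finite_subset[of _ "Pow {z. z ^ period = 1}"]) (use unity_finite in auto)

lemma card_unity_subsets: "card unity_subsets = period choose n"
proof -
  have "card {z::complex. z ^ period = 1} = period" by (rule card_roots_unity_eq) simp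
  thus ?thesis unfolding unity_subsets_def n_subsets[OF unity_finite] by simp
qed

lemma star_seq_init:
  assumes S: "S \<in> unity_subsets" and k: "k < n"
  shows "star_seq S k = (if Suc k = n then 1 else 0)"
proof -
  have "\<exists>w. \<forall>k<n. (\<Sum>x\<in>S. w x * x ^ k) = (if Suc k = n then 1 else 0)"
    by (rule power_sums_surj) (use unity_subset_props[OF S] in auto)
  from someI_ex[OF this] show ?thesis
    unfolding star_seq_def star_weight_def using k by blast
qed

lemma star_weight_nonzero:
  assumes S: "S \<in> unity_subsets" and x: "x \<in> S"
  shows "star_weight S x \<noteq> 0"
  by (rule power_sum_weight_nonzero[OF unity_subset_props(1,2)[OF S] _ x])
     (use star_seq_init[OF S] in \<open>simp add: star_seq_def\<close>)

lemma star_seq_period: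
  assumes S: "S \<in> unity_subsets"
  shows "star_seq S (period + k) = star_seq S k"
  unfolding star_seq_def
  by (rule sum.cong) (use unity_subset_props(3)[OF S] in \<open>auto simp only: power_add mult_1_left\<close>)

text \<open>In terms of \<open>c\<close>, the middle variables occupy the indices from
  \<open>n\<close> to \<open>period - 1\<close>. An outer index is therefore either below
  \<open>n\<close> or such an index shifted by exactly one period.\<close>

lemma free_index_cases:
  assumes "i \<le> r" "i \<notin> middle"
  obtains "d + i < n" | k where "k < n" "d + i = period + k"
proof (cases "d + i < n")
  case False
  hence "r - n < i" using assms by auto
  hence "d + i - period < n" "d + i = period + (d + i - period)"
    using assms d_less r_ge by auto
  thus ?thesis using that(2) by blast
qed (use that in blast)

lemma star_point_free:
  assumes "S \<in> unity_subsets" "S' \<in> unity_subsets" "i \<le> r" "i \<notin> middle"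
  shows "star_point S i = star_point S' i"
  using assms(3,4)
proof (cases rule: free_index_cases)
  case 1
  thus ?thesis using assms by (simp add: star_point_def star_seq_init)
next
  case (2 k)
  thus ?thesis using assms by (simp only: star_point_def star_seq_period star_seq_init)
qed

text \<open>The coefficients of the Lagrange polynomial of \<open>x\<close> on all roots of unity
  form a linear functional on \<open>c\<close> that extracts the weight at \<open>x\<close>. The
  values of \<open>c\<close> below \<open>n\<close> are already inserted, which leaves the constant
  term from index \<open>n - 1\<close>; the binomial coefficients convert moments to entries of
  \<open>c\<close>.\<close>

definition star_form :: "complex \<Rightarrow> complex mpoly" where
  "star_form x = (let p = lagrange_poly {z. z ^ period = 1} x in
     mconst (coeff p (n - 1)) +
     (\<Sum>i\<in>middle. mconst (coeff p (d + i) * of_nat ((d + i) choose d)) * mvar i))"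

lemma mpoly_eval_star_form:
  assumes T: "T \<in> unity_subsets" and x: "x ^ period = 1"
  shows "mpoly_eval (star_point T) (star_form x) = (if x \<in> T then star_weight T x else 0)"
proof -
  define p where "p = lagrange_poly {z. z ^ period = 1} x"
  interpret ev: comm_ring_hom "mpoly_eval (star_point T)"
    unfolding mpoly_eval_eq[abs_def]
    by (rule comm_ring_hom.comm_ring_hom_mpoly_eval_with[OF comm_ring_hom_id])
  have [simp]: "mpoly_eval (star_point T) (mvar i) = star_point T i"
    "mpoly_eval (star_point T) (mconst c) = c" for i c
    unfolding mpoly_eval_eq
    by (simp_all add: comm_ring_hom.mpoly_eval_with_mvar[OF comm_ring_hom_id]
        comm_ring_hom.mpoly_eval_with_mconst[OF comm_ring_hom_id])
  have bin: "c * of_nat ((d + i) choose d) * star_point T i = c * star_seq T (d + i)" for i c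
  proof -
    have "of_nat ((d + i) choose d) \<noteq> (0 :: complex)" by simp
    thus ?thesis by (simp add: star_point_def)
  qed
  have "mpoly_eval (star_point T) (star_form x) =
      coeff p (n - 1) + (\<Sum>i\<in>middle. coeff p (d + i) * star_seq T (d + i))"
    unfolding star_form_def Let_def p_def[symmetric] ev.hom_add ev.hom_sum ev.hom_mult
    by (simp add: bin)
  also have "(\<Sum>i\<in>middle. coeff p (d + i) * star_seq T (d + i)) = (\<Sum>k\<in>{n..<period}. coeff p k * star_seq T k)"
    by (rule sum.reindex_bij_witness[of _ "\<lambda>k. k - d" "\<lambda>i. d + i"]) (use d_less r_ge in auto)
  also have "coeff p (n - 1) = (\<Sum>k<n. if k = n - 1 then coeff p k else 0)"
    using d_less by simp
  also have "\<dots> = (\<Sum>k\<in>{0..<n}. coeff p k * star_seq T k)"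
    unfolding atLeast0LessThan by (rule sum.cong) (auto simp: star_seq_init[OF T])
  also have "(\<Sum>k\<in>{0..<n}. coeff p k * star_seq T k) + (\<Sum>k\<in>{n..<period}. coeff p k * star_seq T k) =
      (\<Sum>k\<in>{0..<period}. coeff p k * star_seq T k)"
    by (rule sum.atLeastLessThan_concat) (use d_less r_ge in auto)
  also have "\<dots> = (\<Sum>y\<in>T. star_weight T y * (\<Sum>k<period. coeff p k * y ^ k))"
    unfolding star_seq_def sum_distrib_left atLeast0LessThan
    by (subst sum.swap) (simp add: mult_ac)
  also have "\<dots> = (\<Sum>y\<in>T. if y = x then star_weight T y else 0)"
  proof (rule sum.cong)
    fix y assume y: "y \<in> T"
    have "degree p < period"
      using degree_lagrange_poly[OF unity_finite, of x] x card_roots_unity_eq[of period]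
      unfolding p_def by simp
    hence "(\<Sum>k<period. coeff p k * y ^ k) = poly p y" by (rule poly_as_sum_less[symmetric])
    also have "\<dots> = (if y = x then 1 else 0)"
      unfolding p_def by (rule poly_lagrange_poly[OF unity_finite]) (use x unity_subset_props(3)[OF T y] in simp_all)
    finally show "star_weight T y * (\<Sum>k<period. coeff p k * y ^ k) = (if y = x then star_weight T y else 0)"
      by simp
  qed simp
  also have "\<dots> = (if x \<in> T then star_weight T x else 0)"
    using unity_subset_props(1)[OF T] by simp
  finally show ?thesis .
qed

definition low_mono :: "nat \<Rightarrow> monomial set" where
  "low_mono k = {s. Poly_Mapping.keys s \<subseteq> middle \<and> mono_degree s \<le> k}"

lemma low_mono_add: "s \<in> low_mono k \<Longrightarrow> t \<in> low_mono l \<Longrightarrow> s + t \<in> low_mono (k + l)"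
  using keys_add[of s t] by (auto simp: low_mono_def mono_degree_add intro: add_mono)

lemma low_mono_keys_mult:
  assumes "Poly_Mapping.keys f \<subseteq> low_mono k" "Poly_Mapping.keys g \<subseteq> low_mono l"
  shows "Poly_Mapping.keys (f * g) \<subseteq> low_mono (k + l)"
  using keys_mult[of f g] low_mono_add assms by blast

lemma keys_star_form: "Poly_Mapping.keys (star_form x) \<subseteq> low_mono 1"
proof -
  have c: "Poly_Mapping.keys (mconst c :: complex mpoly) \<subseteq> low_mono 0" for c
    by (auto simp: mconst_def low_mono_def)
  have v: "Poly_Mapping.keys (mvar i :: complex mpoly) \<subseteq> low_mono 1" if "i \<in> middle" for i
    using that by (auto simp: mvar_def low_mono_def)
  have cv: "Poly_Mapping.keys (mconst c * mvar i :: complex mpoly) \<subseteq> low_mono 1" if "i \<in> middle" for c i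
    using low_mono_keys_mult[OF c v[OF that]] by simp
  have m: "low_mono 0 \<subseteq> low_mono 1" by (auto simp: low_mono_def)
  show ?thesis
    unfolding star_form_def Let_def
    by (rule order_trans[OF keys_add], rule Un_least[OF order_trans[OF c m]],
        rule order_trans[OF keys_sum]) (use cv in blast)
qed

lemma keys_prod_star_form:
  assumes "finite S" shows "Poly_Mapping.keys (\<Prod>x\<in>S. star_form x) \<subseteq> low_mono (card S)"
  using assms
proof induction
  case empty
  show ?case by (auto simp: low_mono_def)
next
  case (insert x S)
  thus ?case using low_mono_keys_mult[OF keys_star_form[of x] insert.IH] by simp
qed

lemma low_mono_eq: "low_mono k = (\<Union>j\<le>k. monomials_on middle j)"
  by (auto simp: low_mono_def monomials_on_def)

lemma finite_low_mono: "finite (low_mono k)"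
  by (simp add: low_mono_eq)

text \<open>There are as many star points as monomials in \<open>low_mono n\<close>, so a one-sided
  inverse of the evaluation matrix is enough, and explicit interpolation polynomials provide
  it.\<close>

lemma star_points_unisolvent:
  assumes g: "Poly_Mapping.keys g \<subseteq> low_mono n"
    and zero: "\<And>S. S \<in> unity_subsets \<Longrightarrow> mpoly_eval (star_point S) g = 0"
  shows "g = 0"
proof -
  have expand: "mpoly_eval v f = (\<Sum>b\<in>low_mono n. mono_eval v b * Poly_Mapping.lookup f b)"
    if "Poly_Mapping.keys f \<subseteq> low_mono n" for v and f :: "complex mpoly"
    unfolding mpoly_eval_eq
    by (subst comm_ring_hom.mpoly_eval_with_superset[OF comm_ring_hom_id finite_low_mono that])
       (simp add: mult.commute)
  \<comment> \<open>The column of \<open>S\<close> holds the normalised product of the forms of its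
    elements. At the star point of \<open>T\<close> this product is nonzero only if \<open>S\<close>
    is contained in \<open>T\<close>, which for sets of equal size means
    \<open>S = T\<close>.\<close>
  define C where "C b S = Poly_Mapping.lookup (\<Prod>x\<in>S. star_form x) b / (\<Prod>x\<in>S. star_weight S x)" for b S
  have "Poly_Mapping.lookup g b = 0" if b: "b \<in> low_mono n" for b
  proof (rule square_system_injective[of unity_subsets "low_mono n" "\<lambda>S. mono_eval (star_point S)" C])
    show "card unity_subsets = card (low_mono n)"
      using card_monomials_on_le[of middle n]
      unfolding card_middle card_unity_subsets low_mono_eq by simp
    show "(\<Sum>b\<in>low_mono n. mono_eval (star_point S) b * Poly_Mapping.lookup g b) = 0" if "S \<in> unity_subsets" for S
      using zero[OF that] expand[OF g] by simp
    fix S S' assume S: "S \<in> unity_subsets" and S': "S' \<in> unity_subsets"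
    note pS = unity_subset_props[OF S] and pS' = unity_subset_props[OF S']
    have "(\<Sum>b\<in>low_mono n. mono_eval (star_point S) b * C b S') =
        mpoly_eval (star_point S) (\<Prod>x\<in>S'. star_form x) / (\<Prod>x\<in>S'. star_weight S' x)"
      using keys_prod_star_form[OF pS'(1)] pS'(2)
      by (simp add: expand C_def sum_divide_distrib)
    also have "mpoly_eval (star_point S) (\<Prod>x\<in>S'. star_form x) =
        (\<Prod>x\<in>S'. mpoly_eval (star_point S) (star_form x))"
    proof -
      interpret ev: comm_ring_hom "mpoly_eval (star_point S)"
        unfolding mpoly_eval_eq[abs_def]
        by (rule comm_ring_hom.comm_ring_hom_mpoly_eval_with[OF comm_ring_hom_id])
      show ?thesis by (rule ev.hom_prod)
    qed
    also have "\<dots> = (\<Prod>x\<in>S'. if x \<in> S then star_weight S x else 0)"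
      by (rule prod.cong) (use mpoly_eval_star_form[OF S] pS'(3) in auto)
    also have "\<dots> / (\<Prod>x\<in>S'. star_weight S' x) = (if S = S' then 1 else 0)"
    proof (cases "S = S'")
      case True
      thus ?thesis using star_weight_nonzero[OF S'] pS'(1) by simp
    next
      case False
      hence "\<not> S' \<subseteq> S" using card_subset_eq[OF pS(1)] pS(2) pS'(2) by blast
      hence "(\<Prod>x\<in>S'. if x \<in> S then star_weight S x else 0) = 0"
        using pS'(1) by (intro prod_zero) auto
      thus ?thesis using False by simp
    qed
    finally show "(\<Sum>b\<in>low_mono n. mono_eval (star_point S) b * C b S') = (if S = S' then 1 else 0)" .
  qed (use b finite_unity_subsets finite_low_mono in auto)
  thus ?thesis using g by (intro poly_mapping_eqI) (auto simp: in_keys_iff)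
qed

text \<open>The projection of the cone to the coordinates outside the middle range is unramified at the
  star points: every direction \<open>v\<close> in the target is the derivative of a curve through each of
  them.\<close>

lemma star_point_curve:
  fixes v :: "nat \<Rightarrow> complex"
  assumes S: "S \<in> unity_subsets"
  shows "\<exists>U A. \<forall>i. coeff (moment_vec (\<lambda>c. [:c:]) d n U A i) 0 = star_point S i \<and>
    (i \<le> r \<longrightarrow> i \<notin> middle \<longrightarrow> coeff (moment_vec (\<lambda>c. [:c:]) d n U A i) 1 = v i)"
proof -
  note pS = unity_subset_props[OF S]
  define w where "w = star_weight S"
  \<comment> \<open>The derivative wanted for \<open>c\<close>; the first \<open>d\<close> entries
    of \<open>c\<close> stay zero along any curve.\<close>
  define V where "V k = (if k < d then 0 else of_nat (k choose d) * v (k - d))" for k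
  have N: "of_nat period \<noteq> (0 :: complex)" by (simp only: of_nat_eq_0_iff)
  \<comment> \<open>If the weights move as \<open>w + t * w'\<close> and the roots as
    \<open>x * (1 + t * z)\<close>, the derivative at index \<open>k\<close> is the sum of
    \<open>(w' + k * w * z) * x ^ k\<close>. The powers for \<open>k\<close> and
    \<open>period + k\<close> agree, so the difference of the two conditions is
    \<open>period\<close> times the sum of \<open>y * x ^ k\<close> with \<open>y = w * z\<close>.
    This determines \<open>y\<close>, and the condition at \<open>k\<close> then determines
    \<open>w'\<close>.\<close>
  obtain y where y: "\<And>k. k < n \<Longrightarrow> (\<Sum>x\<in>S. y x * x ^ k) = (V (period + k) - V k) / of_nat period"
    using power_sums_surj[OF pS(1,2), of "\<lambda>k. (V (period + k) - V k) / of_nat period"] by blast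
  obtain w' where w': "\<And>k. k < n \<Longrightarrow> (\<Sum>x\<in>S. w' x * x ^ k) = V k - of_nat k * (\<Sum>x\<in>S. y x * x ^ k)"
    using power_sums_surj[OF pS(1,2), of "\<lambda>k. V k - of_nat k * (\<Sum>x\<in>S. y x * x ^ k)"] by blast
  obtain u where u: "bij_betw u {1..n} S"
    using ex_bij_betw_nat_finite_1[OF pS(1)] pS(2) by blast
  \<comment> \<open>The division is legitimate because no weight at a star point vanishes.\<close>
  define z where "z x = y x / w x" for x
  define s where "s k = (\<Sum>x\<in>S. [:w x, w' x:] * [:x, x * z x:] ^ k)" for k
  define U where "U j = [:u j, u j * z (u j):]" for j
  define A where "A k = [:star_seq S k, V k:]" for k
  have s0: "coeff (s k) 0 = star_seq S k" for k
    by (simp add: s_def coeff_sum coeff_linear_power star_seq_def w_def coeff_mult)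
  have s1: "coeff (s k) 1 = (\<Sum>x\<in>S. w' x * x ^ k) + of_nat k * (\<Sum>x\<in>S. y x * x ^ k)" for k
  proof -
    have "coeff ([:w x, w' x:] * [:x, x * z x:] ^ k) 1 = w' x * x ^ k + of_nat k * (y x * x ^ k)" if "x \<in> S" for x
    proof -
      have "w x * z x = y x" using star_weight_nonzero[OF S that] by (simp add: z_def w_def)
      moreover have "coeff ([:w x, w' x:] * [:x, x * z x:] ^ k) 1 = w' x * x ^ k + of_nat k * (w x * z x * x ^ k)"
        using coeff_linear_power[of x "z x" k] by (simp add: coeff_mult algebra_simps)
      ultimately show ?thesis by simp
    qed
    hence "coeff (s k) 1 = (\<Sum>x\<in>S. w' x * x ^ k + of_nat k * (y x * x ^ k))"
      unfolding s_def coeff_sum by (intro sum.cong) simp_all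
    thus ?thesis by (simp only: sum.distrib sum_distrib_left)
  qed
  have s1_low: "coeff (s k) 1 = V k" if "k < n" for k
    unfolding s1 w'[OF that] by simp
  have s1_high: "coeff (s (period + k)) 1 = V (period + k)" if "k < n" for k
  proof -
    have per: "(\<Sum>x\<in>S. g x * x ^ (period + k)) = (\<Sum>x\<in>S. g x * x ^ k)" for g :: "complex \<Rightarrow> complex"
      by (rule sum.cong) (use pS(3) in \<open>auto simp only: power_add mult_1_left\<close>)
    have "coeff (s (period + k)) 1 = V k + of_nat period * (\<Sum>x\<in>S. y x * x ^ k)"
      unfolding s1 per w'[OF that] by (simp only: of_nat_add) (simp add: algebra_simps)
    thus ?thesis unfolding y[OF that] using N by simp
  qed
  \<comment> \<open>The first \<open>d\<close> entries of \<open>s\<close> need not vanish as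
    polynomials, as \<open>moment_vec\<close> requires. They vanish modulo the square of the curve
    parameter, and \<open>A\<close> agrees with the remaining initial values to the same order,
    which is all that the derivative needs.\<close>
  have rec: "monom 1 2 dvd rec_seq n (char_coeff n U) (\<lambda>k. if k < d then 0 else A k) k - s k" for k
  proof -
    have s_eq: "s k = (\<Sum>j=1..n. [:w (u j), w' (u j):] * U j ^ k)" for k
      unfolding s_def U_def
      by (rule sum.reindex_bij_betw[OF u, of "\<lambda>x. [:w x, w' x:] * [:x, x * z x:] ^ k", symmetric])
    have "s k = rec_seq n (char_coeff n U) s k"
      unfolding s_eq by (rule rec_seq_exp_sum[symmetric])
    moreover have "monom 1 2 dvd rec_seq n (char_coeff n U) (\<lambda>k. if k < d then 0 else A k) k -
        rec_seq n (char_coeff n U) s k"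
    proof (rule dvd_rec_seq_diff)
      fix k assume k: "k < n"
      have "coeff ((if k < d then 0 else A k) - s k) j = 0" if "j < 2" for j
      proof -
        have "j = 0 \<or> j = 1" using that by auto
        thus ?thesis
          using k d_less s0[of k] s1_low[OF k] star_seq_init[OF S k] by (auto simp: A_def V_def)
      qed
      thus "monom 1 2 dvd (if k < d then 0 else A k) - s k" by (simp add: monom_1_dvd_iff')
    qed
    ultimately show ?thesis by simp
  qed
  have cf: "coeff (moment_vec (\<lambda>c. [:c:]) d n U A i) j = inverse (of_nat ((d + i) choose d)) * coeff (s (d + i)) j"
    if "j < 2" for i j
  proof -
    have "coeff (rec_seq n (char_coeff n U) (\<lambda>k. if k < d then 0 else A k) (d + i) - s (d + i)) j = 0"
      using rec[of "d + i"] that by (simp add: monom_1_dvd_iff')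
    thus ?thesis by (simp add: moment_vec_def)
  qed
  show ?thesis
  proof (rule exI[of _ U], rule exI[of _ A], intro allI conjI impI)
    fix i
    show "coeff (moment_vec (\<lambda>c. [:c:]) d n U A i) 0 = star_point S i"
      by (simp add: cf s0 star_point_def)
    assume i: "i \<le> r" "i \<notin> middle"
    have "coeff (s (d + i)) 1 = V (d + i)"
      using i
    proof (cases rule: free_index_cases)
      case (2 k)
      thus ?thesis using s1_high by simp
    qed (use s1_low in simp)
    moreover have "of_nat ((d + i) choose d) \<noteq> (0 :: complex)" by simp
    ultimately show "coeff (moment_vec (\<lambda>c. [:c:]) d n U A i) 1 = v i"
      by (simp add: cf V_def)
  qed
qed

end

section \<open>Taylor coefficients transversal to the base point\<close>

definition restrict_mono :: "nat set \<Rightarrow> monomial \<Rightarrow> monomial" where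
  "restrict_mono V s = (\<Sum>i\<in>V. Poly_Mapping.single i (Poly_Mapping.lookup s i))"

lemma mono_eval_restrict_mono: "mono_eval v (restrict_mono V s) = (\<Prod>i\<in>V. v i ^ Poly_Mapping.lookup s i)"
  by (simp add: restrict_mono_def mono_eval_sum)

lemma mono_degree_restrict_mono: "mono_degree (restrict_mono V s) = deg_in V s"
  by (simp add: restrict_mono_def mono_degree_sum deg_in_def)

lemma keys_restrict_mono: "Poly_Mapping.keys (restrict_mono V s) \<subseteq> V"
proof (cases "finite V")
  case True
  thus ?thesis
    unfolding restrict_mono_def by (intro order_trans[OF keys_sum]) (auto split: if_splits)
qed (simp add: restrict_mono_def)

lemma mono_eval_split:
  assumes "s \<in> monomials r" "V \<subseteq> {..r}"
  shows "mono_eval v s = mono_eval v (restrict_mono V s) * mono_eval v (restrict_mono ({..r} - V) s)"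
proof -
  have "mono_eval v s = (\<Prod>i\<in>{..r}. v i ^ Poly_Mapping.lookup s i)"
    by (rule mono_eval_superset) (use assms in \<open>auto simp: monomials_def\<close>)
  also have "\<dots> = (\<Prod>i\<in>{..r} - V. v i ^ Poly_Mapping.lookup s i) * (\<Prod>i\<in>V. v i ^ Poly_Mapping.lookup s i)"
    by (rule prod.subset_diff) (use assms(2) in auto)
  finally show ?thesis by (simp add: mono_eval_restrict_mono mult.commute)
qed

context hankel_setup
begin

text \<open>The Taylor expansion of \<open>F\<close> in the outer variables at the base point
  \<open>p\<close>, in direction \<open>v\<close>, with the middle coordinates fixed at
  \<open>y\<close>.\<close>

abbreviation star_line :: "(nat \<Rightarrow> complex) \<Rightarrow> (nat \<Rightarrow> complex) \<Rightarrow> (nat \<Rightarrow> complex) \<Rightarrow> complex mpoly \<Rightarrow> complex poly" where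
  "star_line p v y F \<equiv> mpoly_eval_with (\<lambda>c. [:c:]) (\<lambda>i. if i \<in> middle then [:y i:] else [:p i, v i:]) F"

lemma middle_subset: "middle \<subseteq> {..r}"
  by auto

text \<open>The point \<open>y\<close> enters only through the middle part of each monomial, which
  for a standard monomial has degree at most \<open>n\<close>. As a function of \<open>y\<close>,
  each Taylor coefficient thus lies in the space on which \<open>star_points_unisolvent\<close>
  applies.\<close>

lemma star_line_coeff:
  assumes F: "\<And>s. s \<in> Poly_Mapping.keys F \<Longrightarrow> std_mono s"
  shows "\<exists>g. Poly_Mapping.keys g \<subseteq> low_mono n \<and> (\<forall>y. coeff (star_line p v y F) k = mpoly_eval y g)"
proof -
  define R where "R s = coeff (mono_eval (\<lambda>i. [:p i, v i:]) (restrict_mono ({..r} - middle) s)) k" for s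
  define g where "g = (\<Sum>s\<in>Poly_Mapping.keys F.
      Poly_Mapping.single (restrict_mono middle s) (Poly_Mapping.lookup F s * R s))"
  have "Poly_Mapping.keys g \<subseteq> low_mono n"
  proof -
    have "restrict_mono middle s \<in> low_mono n" if "s \<in> Poly_Mapping.keys F" for s
      using F[OF that] keys_restrict_mono[of middle s]
      unfolding low_mono_def std_mono_def by (simp add: mono_degree_restrict_mono)
    thus ?thesis unfolding g_def
      by (intro order_trans[OF keys_sum]) (auto split: if_splits)
  qed
  moreover have "coeff (star_line p v y F) k = mpoly_eval y g" for y
  proof -
    let ?v = "\<lambda>i. if i \<in> middle then [:y i:] else [:p i, v i:]"
    have mid: "mono_eval ?v (restrict_mono middle s) = [:mono_eval y (restrict_mono middle s):]" for s
    proof -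
      interpret c: comm_ring_hom "\<lambda>c::complex. [:c:]" by (rule comm_ring_hom_pCons)
      have "mono_eval ?v (restrict_mono middle s) = mono_eval (\<lambda>i. [:y i:]) (restrict_mono middle s)"
        unfolding mono_eval_restrict_mono by (rule prod.cong) auto
      thus ?thesis by (simp only: c.hom_mono_eval)
    qed
    have out: "mono_eval ?v (restrict_mono ({..r} - middle) s) =
        mono_eval (\<lambda>i. [:p i, v i:]) (restrict_mono ({..r} - middle) s)" for s
      unfolding mono_eval_restrict_mono by (rule prod.cong) auto
    have "mono_eval ?v s = Polynomial.smult (mono_eval y (restrict_mono middle s))
        (mono_eval (\<lambda>i. [:p i, v i:]) (restrict_mono ({..r} - middle) s))" if "s \<in> Poly_Mapping.keys F" for s
    proof -
      have "s \<in> monomials r" using F[OF that] by (simp add: std_mono_def)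
      show ?thesis
        unfolding mono_eval_split[OF \<open>s \<in> monomials r\<close> middle_subset, of ?v] mid out by simp
    qed
    hence "coeff (star_line p v y F) k =
        (\<Sum>s\<in>Poly_Mapping.keys F. Poly_Mapping.lookup F s * (mono_eval y (restrict_mono middle s) * R s))"
      unfolding mpoly_eval_with_def coeff_sum by (intro sum.cong) (simp_all add: R_def)
    also have "\<dots> = mpoly_eval y g"
      unfolding g_def mpoly_eval_sum
      by (simp add: mpoly_eval_eq comm_ring_hom.mpoly_eval_with_single[OF comm_ring_hom_id] mult_ac)
    finally show ?thesis .
  qed
  ultimately show ?thesis by blast
qed

text \<open>The lowest nonvanishing Taylor coefficient of \<open>F\<close> transversal to the base point only depends
  on the tangent direction of a curve.\<close>

lemma star_line_coeff_at_star_point: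
  assumes F: "Poly_Mapping.keys F \<subseteq> monomials r"
    and zero: "\<And>u a. mpoly_eval (moment_vec (\<lambda>c. c) d n u a) F = 0"
    and low: "\<And>v y j. j < k \<Longrightarrow> coeff (star_line p v y F) j = 0"
    and p: "\<And>i. i \<le> r \<Longrightarrow> i \<notin> middle \<Longrightarrow> p i = star_point S i"
    and S: "S \<in> unity_subsets"
  shows "coeff (star_line p v (star_point S) F) k = 0"
proof -
  obtain U A where c0: "\<And>i. coeff (moment_vec (\<lambda>c. [:c:]) d n U A i) 0 = star_point S i"
    and c1: "\<And>i. i \<le> r \<Longrightarrow> i \<notin> middle \<Longrightarrow> coeff (moment_vec (\<lambda>c. [:c:]) d n U A i) 1 = v i"
    using star_point_curve[OF S, of v] by blast
  define M where "M = moment_vec (\<lambda>c. [:c:]) d n U A"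
  \<comment> \<open>The quotient of \<open>M i\<close> minus its constant term by the curve
    parameter, so that the outer coordinates are \<open>p i\<close> plus the parameter times
    \<open>w i\<close>.\<close>
  define w where "w i = poly_shift 1 (M i)" for i
  have M: "M i = pCons (p i) (w i)" if "i \<le> r" "i \<notin> middle" for i
    by (rule poly_eqI) (use c0[of i] p[OF that] in \<open>auto simp: coeff_pCons coeff_poly_shift w_def M_def split: nat.splits\<close>)
  have FM: "mpoly_eval_with (\<lambda>c. [:c:]) M F = 0"
  proof (rule poly_eq_0_cofinite[of "{}"])
    show "poly (mpoly_eval_with (\<lambda>c. [:c:]) M F) t = 0" for t
      unfolding M_def poly_mpoly_eval_moment_vec by (rule zero)
  qed simp
  \<comment> \<open>The explicit factor of \<open>w\<close> becomes a second, outer variable. At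
    every fixed inner parameter \<open>H\<close> is a \<open>star_line\<close> with direction
    \<open>w\<close> and middle point \<open>M\<close> taken at that parameter, so its coefficients
    below \<open>k\<close> vanish by \<open>low\<close>. Setting both variables equal recovers
    \<open>F\<close> along the curve, which is zero.\<close>
  define H where "H = mpoly_eval_with (\<lambda>c. [:[:c:]:]) (\<lambda>i. if i \<in> middle then [:M i:] else [:[:p i:], w i:]) F"
  have spec: "map_poly (\<lambda>q. poly q t) H = star_line p (\<lambda>i. poly (w i) t) (\<lambda>i. poly (M i) t) F" for t
  proof -
    have e: "map_poly (\<lambda>q. poly q t) [:q:] = [:poly q t:]"
      "map_poly (\<lambda>q. poly q t) [:q, q':] = [:poly q t, poly q' t:]" for q q' :: "complex poly"
      by (intro poly_eqI, simp add: coeff_map_poly coeff_pCons split: nat.splits)+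
    have "map_poly (\<lambda>q. poly q t) H = mpoly_eval_with (\<lambda>c. map_poly (\<lambda>q. poly q t) [:[:c:]:])
       (\<lambda>i. map_poly (\<lambda>q. poly q t) (if i \<in> middle then [:M i:] else [:[:p i:], w i:])) F"
      unfolding H_def
      by (rule comm_ring_hom.hom_mpoly_eval_with[OF comm_ring_hom_map_poly[OF comm_ring_hom_poly]])
    also have "\<dots> = star_line p (\<lambda>i. poly (w i) t) (\<lambda>i. poly (M i) t) F"
      unfolding if_distrib[of "map_poly (\<lambda>q. poly q t)"] e by (simp cong: if_cong)
    finally show ?thesis .
  qed
  have cs: "poly (coeff H j) t = coeff (star_line p (\<lambda>i. poly (w i) t) (\<lambda>i. poly (M i) t) F) j" for j t
    unfolding spec[symmetric] by (simp add: coeff_map_poly)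
  have Hlow: "coeff H j = 0" if "j < k" for j
    by (rule poly_eq_0_cofinite[of "{}"]) (simp_all only: cs low[OF that] finite.emptyI)
  have "poly H [:0, 1:] = mpoly_eval_with (\<lambda>c. [:c:]) (\<lambda>i. if i \<in> middle then M i else pCons (p i) (w i)) F"
    unfolding H_def
    by (simp add: comm_ring_hom.hom_mpoly_eval_with[OF comm_ring_hom_poly] if_distrib[of "\<lambda>q. poly q [:0, 1:]"] cong: if_cong)
  also have "\<dots> = mpoly_eval_with (\<lambda>c. [:c:]) M F"
    by (rule mpoly_eval_with_cong[OF F]) (use M in auto)
  finally have "coeff (coeff H k) 0 = 0"
    using coeff_poly_at_var[of k H] Hlow FM by simp
  hence "0 = poly (coeff H k) 0" by (simp add: poly_0_coeff_0)
  also have "\<dots> = coeff (star_line p (\<lambda>i. poly (w i) 0) (\<lambda>i. poly (M i) 0) F) k" by (rule cs)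
  also have "star_line p (\<lambda>i. poly (w i) 0) (\<lambda>i. poly (M i) 0) F = star_line p v (star_point S) F"
  proof (rule mpoly_eval_with_cong[OF F])
    fix i assume i: "i \<le> r"
    have "poly (M i) 0 = star_point S i" by (simp add: poly_0_coeff_0 M_def c0)
    moreover have "poly (w i) 0 = v i" if "i \<notin> middle"
      using c1[OF i that] by (simp add: poly_0_coeff_0 w_def coeff_poly_shift M_def)
    ultimately show "(if i \<in> middle then [:poly (M i) 0:] else [:p i, poly (w i) 0:]) =
        (if i \<in> middle then [:star_point S i:] else [:p i, v i:])" by simp
  qed
  finally show ?thesis by simp
qed

lemma std_vanishing_complex:
  assumes F: "\<And>s. s \<in> Poly_Mapping.keys F \<Longrightarrow> std_mono s"
    and zero: "\<And>u a. mpoly_eval (moment_vec (\<lambda>c. c) d n u a) F = (0::complex)"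
  shows "F = 0"
proof (rule ccontr)
  assume F0: "F \<noteq> 0"
  have FR: "Poly_Mapping.keys F \<subseteq> monomials r" using F by (auto simp: std_mono_def)
  have "card unity_subsets \<noteq> 0" using d_less r_ge by (simp add: card_unity_subsets)
  then obtain S0 where S0: "S0 \<in> unity_subsets" by (metis card.empty ex_in_conv)
  \<comment> \<open>All star points have the same outer coordinates, so any one of them serves as
    base point.\<close>
  define p where "p = star_point S0"
  define P where "P k \<longleftrightarrow> (\<exists>v y. coeff (star_line p v y F) k \<noteq> 0)" for k
  have "\<exists>k. P k"
  proof (rule ccontr)
    assume no: "\<not> (\<exists>k. P k)"
    hence z: "star_line p v y F = 0" for v y
      by (intro poly_eqI) (auto simp: P_def)
    have "mpoly_eval x F = 0" for x
    proof -
      \<comment> \<open>Every point \<open>x\<close> is reached at parameter \<open>1\<close> on the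
        line with direction \<open>x - p\<close> in the outer coordinates, so vanishing of all
        Taylor coefficients would make \<open>F\<close> zero everywhere.\<close>
      have "poly (star_line p (\<lambda>i. x i - p i) x F) 1 = mpoly_eval x F"
        by (simp add: comm_ring_hom.hom_mpoly_eval_with[OF comm_ring_hom_poly] if_distrib[of "\<lambda>q. poly q 1"] mpoly_eval_eq
            cong: if_cong)
      thus ?thesis unfolding z by simp
    qed
    thus False using mpoly_eqI_eval[OF FR] F0 by blast
  qed
  define k where "k = (LEAST k. P k)"
  have k: "P k" using \<open>\<exists>k. P k\<close> unfolding k_def by (rule LeastI_ex)
  have low: "coeff (star_line p v y F) j = 0" if "j < k" for v y j
    using not_less_Least[of j P] that by (auto simp: k_def P_def)
  obtain v y where vy: "coeff (star_line p v y F) k \<noteq> 0" using k by (auto simp: P_def)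
  obtain g where g: "Poly_Mapping.keys g \<subseteq> low_mono n" "\<And>y. coeff (star_line p v y F) k = mpoly_eval y g"
    using star_line_coeff[where F = F and p = p and v = v and k = k] F by blast
  have "g = 0"
  proof (rule star_points_unisolvent[OF g(1)])
    fix S assume S: "S \<in> unity_subsets"
    show "mpoly_eval (star_point S) g = 0"
      unfolding g(2)[symmetric]
      by (rule star_line_coeff_at_star_point[OF FR zero low _ S])
         (use star_point_free[OF S0 S] in \<open>auto simp: p_def\<close>)
  qed
  thus False using vy g(2)[of y] by simp
qed

text \<open>Complex parameters are values at the imaginary unit of the real linear curves
  \<open>Re + t * Im\<close>. Along such a curve \<open>F\<close> is a real polynomial in
  \<open>t\<close> that vanishes at all real \<open>t\<close>, hence identically.\<close>

lemma std_vanishing_real: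
  fixes F :: "real mpoly"
  assumes F: "\<And>s. s \<in> Poly_Mapping.keys F \<Longrightarrow> std_mono s"
    and zero: "\<And>u a. mpoly_eval (moment_vec (\<lambda>c. c) d n u a) F = 0"
  shows "F = 0"
proof -
  have "(extend_scalars F :: complex mpoly) = 0"
  proof (rule std_vanishing_complex)
    show "std_mono s" if "s \<in> Poly_Mapping.keys (extend_scalars F :: complex mpoly)" for s
      using that F by simp
    fix u a :: "nat \<Rightarrow> complex"
    define q where "q = mpoly_eval_with (\<lambda>c. [:c:]) (moment_vec (\<lambda>c. [:c:]) d n
      (\<lambda>j. [:Re (u j), Im (u j):]) (\<lambda>k. [:Re (a k), Im (a k):])) F"
    have "q = 0"
    proof (rule poly_eq_0_cofinite[of "{}"])
      show "poly q t = 0" for t unfolding q_def poly_mpoly_eval_moment_vec by (rule zero)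
    qed simp
    define h where "h q = poly (map_poly of_real q) \<i>" for q :: "real poly"
    have h: "comm_ring_hom h"
      unfolding h_def[abs_def]
      by (rule comm_ring_hom_comp[OF comm_ring_hom_poly comm_ring_hom_map_poly[OF comm_ring_hom_of_real]])
    have hl: "h [:x, y:] = Complex x y" "h [:x:] = of_real x" for x y
    proof -
      have "map_poly of_real [:x, y:] = [:of_real x, of_real y :: complex:]" "map_poly of_real [:x:] = [:of_real x :: complex:]"
        by (intro poly_eqI, simp add: coeff_map_poly coeff_pCons split: nat.splits)+
      thus "h [:x, y:] = Complex x y" "h [:x:] = of_real x" by (simp_all add: h_def complex_eq_iff)
    qed
    have mv: "moment_vec (\<lambda>c. of_real c) d n u a = moment_vec (\<lambda>c. c) d n u a"
      by (simp add: moment_vec_def fun_eq_iff)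
    have "h q = mpoly_eval_with of_real (moment_vec (\<lambda>c. c) d n u a) F"
      unfolding q_def comm_ring_hom.hom_mpoly_eval_with[OF h] comm_ring_hom.hom_moment_vec[OF h]
      by (simp add: hl mv)
    moreover have "h q = 0" unfolding \<open>q = 0\<close> by (simp add: h_def)
    ultimately show "mpoly_eval (moment_vec (\<lambda>c. c) d n u a) (extend_scalars F) = 0"
      by (simp add: mpoly_eval_extend_scalars)
  qed
  moreover have "Poly_Mapping.keys (extend_scalars F :: complex mpoly) = Poly_Mapping.keys F" by simp
  ultimately have "Poly_Mapping.keys F = {}" by simp
  thus ?thesis by simp
qed

text \<open>At real parameters all monomials have real values, so a real linear functional on
  \<open>'k\<close> may be applied to the coefficients of a relation. A functional with value
  \<open>1\<close> at one nonzero coefficient turns it into a nonzero real relation.\<close>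

lemma std_cone_ideal:
  fixes F :: "'k::real_field mpoly"
  assumes F: "\<And>s. s \<in> Poly_Mapping.keys F \<Longrightarrow> std_mono s" and cone: "F \<in> cone_ideal d n r"
  shows "F = 0"
proof (rule ccontr)
  assume "F \<noteq> 0"
  then obtain s where s: "s \<in> Poly_Mapping.keys F" by (metis all_not_in_conv keys_eq_empty)
  define x where "x = Poly_Mapping.lookup F s"
  have "x \<noteq> 0" using s by (simp add: x_def in_keys_iff)
  then obtain g :: "'k \<Rightarrow> real" where g: "linear g" "g x = 1"
    using linear_independent_extend[of "{x}" "\<lambda>_. 1 :: real"] by auto
  define G where "G = Poly_Mapping.map g F"
  have lk: "Poly_Mapping.lookup G t = g (Poly_Mapping.lookup F t)" for t
    unfolding G_def using linear_0[OF g(1)] by transfer (simp add: when_def)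
  have keys: "Poly_Mapping.keys G \<subseteq> Poly_Mapping.keys F"
    using linear_0[OF g(1)] by (auto simp: in_keys_iff lk)
  have "G = 0"
  proof (rule std_vanishing_real)
    show "std_mono t" if "t \<in> Poly_Mapping.keys G" for t using that keys F by blast
    fix u a :: "nat \<Rightarrow> real"
    define v where "v = moment_vec (\<lambda>c. c) d n u a"
    have "moment_vec (\<lambda>c. c) d n (\<lambda>j. of_real (u j)) (\<lambda>k. of_real (a k)) = (\<lambda>i. of_real (v i) :: 'k)"
      unfolding v_def comm_ring_hom.hom_moment_vec[OF comm_ring_hom_of_real]
      by (rule ext) (simp add: moment_vec_def)
    moreover have "mpoly_eval (moment_vec (\<lambda>c. c) d n (\<lambda>j. of_real (u j)) (\<lambda>k. of_real (a k)) :: nat \<Rightarrow> 'k) F = 0"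
      using cone by (simp add: cone_ideal_def)
    ultimately have "mpoly_eval (\<lambda>i. of_real (v i) :: 'k) F = 0" by simp
    hence "0 = g (mpoly_eval (\<lambda>i. of_real (v i) :: 'k) F)" using linear_0[OF g(1)] by simp
    also have "\<dots> = (\<Sum>t\<in>Poly_Mapping.keys F. g (Poly_Mapping.lookup F t * of_real (mono_eval v t)))"
      unfolding mpoly_eval_eq mpoly_eval_with_def linear_sum[OF g(1)]
      by (simp add: comm_ring_hom.hom_mono_eval[OF comm_ring_hom_of_real])
    also have "\<dots> = (\<Sum>t\<in>Poly_Mapping.keys F. g (Poly_Mapping.lookup F t) * mono_eval v t)"
    proof (rule sum.cong)
      fix t
      show "g (Poly_Mapping.lookup F t * of_real (mono_eval v t)) = g (Poly_Mapping.lookup F t) * mono_eval v t"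
        using linear_cmul[OF g(1), of "mono_eval v t" "Poly_Mapping.lookup F t"]
        by (simp add: scaleR_conv_of_real mult.commute)
    qed simp
    also have "\<dots> = mpoly_eval v G"
      unfolding mpoly_eval_eq
      by (subst comm_ring_hom.mpoly_eval_with_superset[OF comm_ring_hom_id finite_keys keys]) (simp add: lk)
    finally show "mpoly_eval (moment_vec (\<lambda>c. c) d n u a) G = 0" by (simp add: v_def)
  qed
  hence "g x = 0" unfolding x_def lk[symmetric] by simp
  thus False using g(2) by simp
qed

end

section \<open>Ideals\<close>

lemma mpoly_idealI:
  fixes I :: "'a::comm_ring_1 mpoly set"
  assumes sub: "I \<subseteq> carrier (mpoly_ring r)" and zero: "0 \<in> I"
    and add: "\<And>f g. f \<in> I \<Longrightarrow> g \<in> I \<Longrightarrow> f + g \<in> I"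
    and mult: "\<And>f g. f \<in> I \<Longrightarrow> g \<in> carrier (mpoly_ring r) \<Longrightarrow> g * f \<in> I"
  shows "ideal I (mpoly_ring r)"
proof -
  interpret cring "mpoly_ring r :: 'a mpoly ring" by (rule mpoly_ring_cring)
  show ?thesis
  proof (rule idealI)
    show "subgroup I (add_monoid (mpoly_ring r))"
    proof
      fix f assume f: "f \<in> I"
      have one: "- 1 \<in> carrier (mpoly_ring r :: 'a mpoly ring)"
        by (simp add: mpoly_ring_simps monomials_def)
      have m: "- f \<in> I" using mult[OF f one] by simp
      have "\<ominus>\<^bsub>mpoly_ring r\<^esub> f = - f"
        by (rule minus_equality) (use f m sub in \<open>auto simp: mpoly_ring_simps\<close>)
      thus "inv\<^bsub>add_monoid (mpoly_ring r)\<^esub> f \<in> I" using m by (simp add: a_inv_def)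
    qed (use sub zero add in \<open>auto simp: mpoly_ring_simps\<close>)
    fix f g :: "'a mpoly" assume "f \<in> I" "g \<in> carrier (mpoly_ring r)"
    thus "g \<otimes>\<^bsub>mpoly_ring r\<^esub> f \<in> I" "f \<otimes>\<^bsub>mpoly_ring r\<^esub> g \<in> I"
      using mult[of f g] by (simp_all add: mpoly_ring_simps mult.commute)
  qed (rule ring_axioms)
qed

lemma mpoly_genideal_minimal:
  assumes "ideal I (mpoly_ring r)" "S \<subseteq> I"
  shows "genideal (mpoly_ring r) S \<subseteq> I"
  using ring.genideal_minimal[OF mpoly_ring_ring assms] .

lemma mpoly_genideal_ideal:
  "S \<subseteq> carrier (mpoly_ring r) \<Longrightarrow> ideal (genideal (mpoly_ring r) S) (mpoly_ring r)"
  by (rule ring.genideal_ideal[OF mpoly_ring_ring])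

lemma mpoly_genideal_self:
  "S \<subseteq> carrier (mpoly_ring r) \<Longrightarrow> S \<subseteq> genideal (mpoly_ring r) S"
  by (rule ring.genideal_self[OF mpoly_ring_ring])

lemma vanishing_at_ideal: "ideal {f \<in> carrier (mpoly_ring r). mpoly_eval v f = 0} (mpoly_ring r)"
proof (rule mpoly_idealI)
  interpret cring "mpoly_ring r :: 'a mpoly ring" by (rule mpoly_ring_cring)
  fix f g :: "'a mpoly"
  assume f: "f \<in> {f \<in> carrier (mpoly_ring r). mpoly_eval v f = 0}"
  show "f + g \<in> {f \<in> carrier (mpoly_ring r). mpoly_eval v f = 0}"
    if "g \<in> {f \<in> carrier (mpoly_ring r). mpoly_eval v f = 0}"
    using f that a_closed[of f g] by (simp add: mpoly_eval_add mpoly_ring_simps(3))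
  show "g * f \<in> {f \<in> carrier (mpoly_ring r). mpoly_eval v f = 0}" if "g \<in> carrier (mpoly_ring r)"
    using f that m_closed[of g f] by (simp add: mpoly_eval_mult mpoly_ring_simps(2))
qed (auto simp: mpoly_ring_simps)

lemma cone_ideal_ideal: "ideal (cone_ideal d n r) (mpoly_ring r)"
proof (rule mpoly_idealI)
  interpret cring "mpoly_ring r :: 'a mpoly ring" by (rule mpoly_ring_cring)
  fix f g :: "'a mpoly"
  assume f: "f \<in> cone_ideal d n r"
  show "f + g \<in> cone_ideal d n r" if "g \<in> cone_ideal d n r"
    using f that a_closed[of f g] by (simp add: cone_ideal_def mpoly_eval_add mpoly_ring_simps(3))
  show "g * f \<in> cone_ideal d n r" if "g \<in> carrier (mpoly_ring r)"
    using f that m_closed[of g f] by (simp add: cone_ideal_def mpoly_eval_mult mpoly_ring_simps(2))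
qed (auto simp: cone_ideal_def mpoly_ring_simps)

text \<open>Two polynomials that do not vanish at given points of the parameter space do not vanish
  simultaneously at a general point of the line joining them.\<close>

lemma cone_ideal_prime:
  "primeideal (cone_ideal d n r :: 'k::field_char_0 mpoly set) (mpoly_ring r)"
proof (rule primeidealI[OF cone_ideal_ideal mpoly_ring_cring])
  have "mpoly_eval v (1 :: 'k mpoly) = 1" for v :: "nat \<Rightarrow> 'k"
    by (simp add: mpoly_eval_def)
  hence "1 \<notin> (cone_ideal d n r :: 'k mpoly set)" by (simp add: cone_ideal_def)
  moreover have "1 \<in> carrier (mpoly_ring r :: 'k mpoly ring)" by (simp add: mpoly_ring_simps monomials_def)
  ultimately show "carrier (mpoly_ring r :: 'k mpoly ring) \<noteq> cone_ideal d n r" by blast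
next
  fix f g :: "'k mpoly"
  assume f: "f \<in> carrier (mpoly_ring r)" and g: "g \<in> carrier (mpoly_ring r)"
    and fg: "f \<otimes>\<^bsub>mpoly_ring r\<^esub> g \<in> cone_ideal d n r"
  show "f \<in> cone_ideal d n r \<or> g \<in> cone_ideal d n r"
  proof (rule ccontr)
    assume "\<not> ?thesis"
    then obtain u a u' a' where ua: "mpoly_eval (moment_vec (\<lambda>c. c) d n u a) f \<noteq> 0"
      "mpoly_eval (moment_vec (\<lambda>c. c) d n u' a') g \<noteq> 0"
      using f g by (auto simp: cone_ideal_def)
    define E where "E = mpoly_eval_with (\<lambda>c. [:c:])
      (moment_vec (\<lambda>c. [:c:]) d n (\<lambda>j. [:u j, u' j - u j:]) (\<lambda>k. [:a k, a' k - a k:]))"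
    have E: "poly (E h) t = mpoly_eval (moment_vec (\<lambda>c. c) d n (\<lambda>j. u j + t * (u' j - u j))
        (\<lambda>k. a k + t * (a' k - a k))) h" for t h
      unfolding E_def poly_mpoly_eval_moment_vec by simp
    have "E f \<noteq> 0" using E[of f 0] ua by auto
    moreover have "E g \<noteq> 0" using E[of g 1] ua by auto
    moreover have "E f * E g = 0"
    proof (rule poly_eq_0_cofinite[of "{}"])
      fix t
      show "poly (E f * E g) t = 0"
        using fg unfolding poly_mult E mpoly_eval_mult[symmetric]
        by (simp add: cone_ideal_def mpoly_ring_simps(2))
    qed simp
    ultimately show False by simp
  qed
qed

lemma cone_ideal_homogeneous:
  "cone_ideal d n r = genideal (mpoly_ring r) {f \<in> cone_ideal d n r. \<exists>k. homogeneous k (f :: 'k::field_char_0 mpoly)}"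
    (is "?I = genideal ?R ?H")
proof
  have H: "?H \<subseteq> carrier ?R" by (auto simp: cone_ideal_def)
  show "genideal ?R ?H \<subseteq> ?I" by (rule mpoly_genideal_minimal[OF cone_ideal_ideal]) auto
  show "?I \<subseteq> genideal ?R ?H"
  proof
    fix f assume f: "f \<in> ?I"
    have "hom_comp k f \<in> ?H" for k
      using hom_comp_cone_ideal[OF f, of k] homogeneous_hom_comp[of k f] by blast
    hence "hom_comp k f \<in> genideal ?R ?H" for k
      using mpoly_genideal_self[OF H] by blast
    hence "(\<Sum>k\<in>mono_degree ` Poly_Mapping.keys f. hom_comp k f) \<in> genideal ?R ?H"
      by (intro mpoly_ideal_sum[OF mpoly_genideal_ideal[OF H]])
    thus "f \<in> genideal ?R ?H" by (simp add: sum_hom_comp)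
  qed
qed

definition divisible_by :: "monomial set \<Rightarrow> monomial \<Rightarrow> bool" where
  "divisible_by S t \<longleftrightarrow> (\<exists>s\<in>S. \<exists>u. t = s + u)"

lemma monomial_ideal_iff:
  fixes f :: "'a::comm_ring_1 mpoly"
  assumes S: "S \<subseteq> monomials r"
  shows "f \<in> monomial_ideal r S \<longleftrightarrow> f \<in> carrier (mpoly_ring r) \<and> (\<forall>t\<in>Poly_Mapping.keys f. divisible_by S t)"
proof -
  let ?G = "(\<lambda>s. Poly_Mapping.single s (1::'a)) ` S"
  let ?I = "{f \<in> carrier (mpoly_ring r). \<forall>t\<in>Poly_Mapping.keys f. divisible_by S t} :: 'a mpoly set"
  interpret cring "mpoly_ring r :: 'a mpoly ring" by (rule mpoly_ring_cring)
  have G: "?G \<subseteq> carrier (mpoly_ring r)" using S by (auto simp: mpoly_ring_simps)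
  have "genideal (mpoly_ring r) ?G \<subseteq> ?I"
  proof (rule mpoly_genideal_minimal[OF mpoly_idealI])
    fix f g :: "'a mpoly"
    assume f: "f \<in> ?I"
    show "f + g \<in> ?I" if "g \<in> ?I"
      using f that a_closed[of f g] keys_add[of f g] by (auto simp: mpoly_ring_simps(3))
    show "g * f \<in> ?I" if g: "g \<in> carrier (mpoly_ring r)"
    proof -
      have "divisible_by S t" if "t \<in> Poly_Mapping.keys (g * f)" for t
      proof -
        obtain x y where "t = x + y" "y \<in> Poly_Mapping.keys f" using keys_mult[of g f] \<open>t \<in> _\<close> by blast
        moreover from this obtain s u where "s \<in> S" "y = s + u" using f by (auto simp: divisible_by_def)
        ultimately have "t = s + (x + u)" by (simp add: ac_simps)
        thus ?thesis using \<open>s \<in> S\<close> by (auto simp: divisible_by_def)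
      qed
      thus ?thesis using f g m_closed[of g f] by (auto simp: mpoly_ring_simps(2))
    qed
  next
    have "divisible_by S s" if "s \<in> S" for s
      unfolding divisible_by_def using that by (intro bexI[of _ s] exI[of _ 0]) simp_all
    thus "?G \<subseteq> ?I" using G by auto
  qed (auto simp: mpoly_ring_simps)
  moreover have "?I \<subseteq> genideal (mpoly_ring r) ?G"
  proof
    fix f assume f: "f \<in> ?I"
    note I = mpoly_genideal_ideal[OF G]
    have "Poly_Mapping.single t (Poly_Mapping.lookup f t) \<in> genideal (mpoly_ring r) ?G"
      if t: "t \<in> Poly_Mapping.keys f" for t
    proof -
      obtain s u where su: "s \<in> S" "t = s + u" using f t by (auto simp: divisible_by_def)
      have "t \<in> monomials r" using f t by (auto simp: mpoly_ring_simps)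
      hence "u \<in> monomials r" using su by (simp add: monomials_add_iff)
      have "Poly_Mapping.single s 1 \<in> genideal (mpoly_ring r) ?G"
        using mpoly_genideal_self[OF G] su(1) by blast
      from mpoly_ideal_mult[OF I this single_in_carrier[OF \<open>u \<in> monomials r\<close>, of "Poly_Mapping.lookup f t"]]
      show ?thesis by (simp add: mult_single su(2) add.commute)
    qed
    hence "(\<Sum>t\<in>Poly_Mapping.keys f. Poly_Mapping.single t (Poly_Mapping.lookup f t)) \<in> genideal (mpoly_ring r) ?G"
      by (rule mpoly_ideal_sum[OF I])
    thus "f \<in> genideal (mpoly_ring r) ?G" by (simp add: mpoly_eq_sum_single)
  qed
  ultimately show ?thesis unfolding monomial_ideal_def by blast
qed

lemma monomial_ideal_ideal:
  "S \<subseteq> monomials r \<Longrightarrow> ideal (monomial_ideal r S :: 'a::comm_ring_1 mpoly set) (mpoly_ring r)"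
  unfolding monomial_ideal_def by (rule mpoly_genideal_ideal) (auto simp: mpoly_ring_simps)

lemma monomials_on_monomials: "V \<subseteq> {..r} \<Longrightarrow> monomials_on V k \<subseteq> monomials r"
  by (auto simp: monomials_on_def monomials_def)

lemma monomials_on_1: "monomials_on V 1 = (\<lambda>i. Poly_Mapping.single i 1) ` V"
proof (intro equalityI subsetI)
  fix s assume s: "s \<in> monomials_on V 1"
  then obtain i where i: "i \<in> Poly_Mapping.keys s"
    by (metis (mono_tags, lifting) all_not_in_conv keys_eq_empty mem_Collect_eq mono_degree_0 monomials_on_def zero_neq_one)
  define t where "t = s - Poly_Mapping.single i 1"
  have st: "s = Poly_Mapping.single i 1 + t"
    unfolding t_def by (rule monomial_split_var) (use i in \<open>simp add: in_keys_iff\<close>)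
  hence "mono_degree t = 0" using s by (simp add: monomials_on_def mono_degree_add)
  hence "Poly_Mapping.lookup t x = 0" for x
    by (cases "x \<in> Poly_Mapping.keys t") (auto simp: mono_degree_def in_keys_iff)
  hence "t = 0" by (intro poly_mapping_eqI) simp
  thus "s \<in> (\<lambda>i. Poly_Mapping.single i 1) ` V" using st i s by (auto simp: monomials_on_def)
qed (auto simp: monomials_on_def)

lemma divisible_by_monomials_on:
  assumes "finite V"
  shows "divisible_by (monomials_on V k) t \<longleftrightarrow> k \<le> deg_in V t"
proof
  assume "divisible_by (monomials_on V k) t"
  then obtain s u where "t = s + u" "s \<in> monomials_on V k" by (auto simp: divisible_by_def)
  thus "k \<le> deg_in V t"
    using mono_degree_eq_deg_in[OF assms, of s] by (simp add: monomials_on_def deg_in_add)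
qed (use monomial_factor[OF assms, of k t] in \<open>auto simp: divisible_by_def\<close>)

lemma monomial_ideal_monomials_on:
  assumes "V \<subseteq> {..r}"
  shows "f \<in> monomial_ideal r (monomials_on V k) \<longleftrightarrow>
    f \<in> carrier (mpoly_ring r) \<and> (\<forall>t\<in>Poly_Mapping.keys (f :: 'a::comm_ring_1 mpoly). k \<le> deg_in V t)"
  unfolding monomial_ideal_iff[OF monomials_on_monomials[OF assms]]
  using divisible_by_monomials_on[OF finite_subset[OF assms finite_atMost]] by simp

text \<open>A monomial of degree at least \<open>k + 1\<close> in \<open>V\<close> has a factor of
  degree exactly \<open>k\<close> in the variables of \<open>V\<close>, and the cofactor still
  contains a variable of \<open>V\<close>. The power is taken in the monoid of ideals, so exponent
  \<open>0\<close> gives the whole ring.\<close>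

lemma genideal_mvar_power:
  assumes V: "V \<subseteq> {..r}"
  shows "genideal (mpoly_ring r) (mvar ` V) [^]\<^bsub>ideals_set (mpoly_ring r)\<^esub> (k::nat) =
    (monomial_ideal r (monomials_on V k) :: 'a::comm_ring_1 mpoly set)"
proof -
  interpret cring "mpoly_ring r :: 'a mpoly ring" by (rule mpoly_ring_cring)
  have one: "genideal (mpoly_ring r) (mvar ` V) = (monomial_ideal r (monomials_on V 1) :: 'a mpoly set)"
    unfolding monomial_ideal_def monomials_on_1 image_image mvar_def ..
  note fin = finite_subset[OF V finite_atMost]
  note MI = monomial_ideal_ideal[OF monomials_on_monomials[OF V]]
  show ?thesis
  proof (induction k)
    case 0
    show ?case
      by (auto simp: nat_pow_def ideals_set_def monomial_ideal_monomials_on[OF V])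
  next
    case (Suc k)
    let ?M = "\<lambda>k. monomial_ideal r (monomials_on V k) :: 'a mpoly set"
    have "genideal (mpoly_ring r) (mvar ` V) [^]\<^bsub>ideals_set (mpoly_ring r)\<^esub> Suc k =
        ideal_prod (mpoly_ring r) (?M k) (?M 1)"
      using Suc.IH by (simp add: nat_pow_def ideals_set_def one)
    also have "\<dots> = ?M (Suc k)"
    proof (intro equalityI subsetI)
      fix f assume "f \<in> ideal_prod (mpoly_ring r) (?M k) (?M 1)"
      thus "f \<in> ?M (Suc k)"
      proof induction
        case (prod i j)
        have "Suc k \<le> deg_in V t" if t: "t \<in> Poly_Mapping.keys (i * j)" for t
        proof -
          obtain x y where "t = x + y" "x \<in> Poly_Mapping.keys i" "y \<in> Poly_Mapping.keys j"
            using keys_mult[of i j] t by blast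
          moreover from this have "k \<le> deg_in V x" "1 \<le> deg_in V y"
            using prod by (auto simp: monomial_ideal_monomials_on[OF V])
          ultimately show ?thesis by (simp add: deg_in_add)
        qed
        thus ?case using prod m_closed[of i j]
          by (auto simp: monomial_ideal_monomials_on[OF V] mpoly_ring_simps(2))
      next
        case (sum s1 s2)
        thus ?case using mpoly_ideal_add[OF MI] by (simp add: mpoly_ring_simps(3))
      qed
    next
      fix f assume f: "f \<in> ?M (Suc k)"
      note PI = ideal_prod_is_ideal[OF MI[of k] MI[of 1]]
      have "Poly_Mapping.single t (Poly_Mapping.lookup f t) \<in> ideal_prod (mpoly_ring r) (?M k) (?M 1)"
        if t: "t \<in> Poly_Mapping.keys f" for t
      proof -
        have tr: "t \<in> monomials r" "Suc k \<le> deg_in V t"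
          using f t by (auto simp: monomial_ideal_monomials_on[OF V] mpoly_ring_simps)
        obtain s u where su: "t = s + u" "s \<in> monomials_on V k"
          using monomial_factor[OF fin, of k t] tr(2) by auto
        hence "deg_in V s = k" using mono_degree_eq_deg_in[OF fin, of s] by (simp add: monomials_on_def)
        hence u: "1 \<le> deg_in V u" "u \<in> monomials r" "s \<in> monomials r"
          using su tr by (auto simp: deg_in_add monomials_add_iff)
        have "Poly_Mapping.single s 1 \<in> ?M k" "Poly_Mapping.single u (Poly_Mapping.lookup f t) \<in> ?M 1"
          using u \<open>deg_in V s = k\<close> by (simp_all add: monomial_ideal_monomials_on[OF V] single_in_carrier)
        from ideal_prod.prod[OF this, of "mpoly_ring r"] show ?thesis
          by (simp add: mpoly_ring_simps(2) mult_single su(1))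
      qed
      hence "(\<Sum>t\<in>Poly_Mapping.keys f. Poly_Mapping.single t (Poly_Mapping.lookup f t)) \<in>
          ideal_prod (mpoly_ring r) (?M k) (?M 1)"
        by (rule mpoly_ideal_sum[OF PI])
      thus "f \<in> ideal_prod (mpoly_ring r) (?M k) (?M 1)" by (simp add: mpoly_eq_sum_single)
    qed
    finally show ?case .
  qed
qed

section \<open>Generators and leading monomials of the ideal\<close>

context hankel_setup
begin

lemma hankel_minors_carrier: "(hankel_minors d n r :: 'a::field_char_0 mpoly set) \<subseteq> carrier (mpoly_ring r)"
  using hankel_minor_keys(2) by (auto simp: hankel_minors_def mpoly_ring_simps)

lemma hankel_minors_cone_ideal: "(hankel_minors d n r :: 'a::field_char_0 mpoly set) \<subseteq> cone_ideal d n r"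
  using hankel_minors_carrier hankel_minor_vanishes unfolding cone_ideal_def hankel_minors_def by blast

text \<open>The standard remainder of an element of the ideal vanishes on the cone, hence is zero.
  Reduction by the antidiagonal weight makes this independent of any term order.\<close>

lemma cone_ideal_eq_genideal:
  "(cone_ideal d n r :: 'k::real_field mpoly set) = genideal (mpoly_ring r) (hankel_minors d n r)"
proof
  let ?J = "genideal (mpoly_ring r) (hankel_minors d n r) :: 'k mpoly set"
  note J = mpoly_genideal_ideal[OF hankel_minors_carrier]
  show JI: "?J \<subseteq> cone_ideal d n r"
    by (rule mpoly_genideal_minimal[OF cone_ideal_ideal hankel_minors_cone_ideal])
  show "cone_ideal d n r \<subseteq> ?J"
  proof
    fix f :: "'k mpoly" assume f: "f \<in> cone_ideal d n r"
    have "\<exists>h. f - h \<in> ?J \<and> (\<forall>s\<in>Poly_Mapping.keys h. std_mono s) \<and>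
     (\<forall>s. std_mono s \<longrightarrow> (\<forall>t\<in>Poly_Mapping.keys f. \<not> anti_weight t < anti_weight s) \<longrightarrow>
        Poly_Mapping.lookup h s = Poly_Mapping.lookup f s)"
      by (rule reduce_polynomial[OF J mpoly_genideal_self[OF hankel_minors_carrier]])
         (use f hankel_minor_keys(3) in \<open>auto simp: weight_add cone_ideal_def\<close>)
    then obtain h where h: "f - h \<in> ?J" "\<And>s. s \<in> Poly_Mapping.keys h \<Longrightarrow> std_mono s" by blast
    have "f - (f - h) \<in> cone_ideal d n r"
      by (rule mpoly_ideal_diff[OF cone_ideal_ideal f]) (use h(1) JI in auto)
    hence "h = 0" by (intro std_cone_ideal h(2)) simp_all
    thus "f \<in> ?J" using h(1) by simp
  qed
qed

lemma is_lead_monomial_hankel_minor: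
  assumes ord: "antidiagonal_order d n r ord" and J: "J \<in> maximal_column_sets d n r"
  shows "is_lead_monomial ord (det (hankel_submatrix d n r J) :: real mpoly) (anti_mono J)"
proof -
  obtain s a where sa: "is_lead_monomial ord (det (hankel_submatrix d n r J) :: real mpoly) s" "a \<noteq> 0"
    "antidiagonal_product (hankel_submatrix d n r J) = Poly_Mapping.single s (a :: real)"
    using ord J unfolding antidiagonal_order_def by blast
  have "{s} = Poly_Mapping.keys (Poly_Mapping.single s a)" using sa(2) by simp
  also have "\<dots> = {anti_mono J}"
    unfolding sa(3)[symmetric] antidiagonal_product_hankel[OF J]
    using anti_prod_nonzero[OF J, where 'a = real] by (simp only: keys_single if_False)
  finally show ?thesis using sa(1) by simp
qed

text \<open>A standard leading monomial would keep its coefficient under reduction with respect to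
  \<open>ord\<close>, although the remainder of an element of the ideal is zero.\<close>

lemma lead_monomial_cone_ideal:
  fixes f :: "real mpoly"
  assumes ord: "antidiagonal_order d n r ord" and f: "f \<in> cone_ideal d n r" and s: "is_lead_monomial ord f s"
  shows "Suc n \<le> deg_in middle s"
proof (rule ccontr)
  assume low: "\<not> ?thesis"
  have mo: "monomial_order r ord" using ord by (simp add: antidiagonal_order_def)
  hence tr: "trans ord" and as: "antisym ord"
    by (auto simp: monomial_order_def linear_order_on_def partial_order_on_def preorder_on_def)
  have sk: "s \<in> Poly_Mapping.keys f" using s by (simp add: is_lead_monomial_def)
  hence "s \<in> monomials r" using f by (auto simp: cone_ideal_def mpoly_ring_simps)
  hence std: "std_mono s" using low by (simp add: std_mono_def)
  have "\<exists>h. f - h \<in> cone_ideal d n r \<and> (\<forall>s\<in>Poly_Mapping.keys h. std_mono s) \<and>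
     (\<forall>s. std_mono s \<longrightarrow> (\<forall>t\<in>Poly_Mapping.keys f. \<not> ((s, t) \<in> ord \<and> s \<noteq> t)) \<longrightarrow>
        Poly_Mapping.lookup h s = Poly_Mapping.lookup f s)"
  proof (rule reduce_polynomial[OF cone_ideal_ideal hankel_minors_cone_ideal])
    fix s t u assume "(s, t) \<in> ord \<and> s \<noteq> t" "(t, u) \<in> ord \<and> t \<noteq> u"
    thus "(s, u) \<in> ord \<and> s \<noteq> u" using tr as by (metis antisymD transD)
  next
    fix s t u assume "(s, t) \<in> ord \<and> s \<noteq> t" "u \<in> monomials r"
    thus "(s + u, t + u) \<in> ord \<and> s + u \<noteq> t + u" using mo by (simp add: monomial_order_def)
  next
    fix J t assume J: "J \<in> maximal_column_sets d n r"
      and t: "t \<in> Poly_Mapping.keys (det (hankel_submatrix d n r J) :: real mpoly)" "t \<noteq> anti_mono J"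
    have "is_lead_monomial ord (det (hankel_submatrix d n r J) :: real mpoly) (anti_mono J)"
      by (rule is_lead_monomial_hankel_minor[OF ord J])
    thus "(t, anti_mono J) \<in> ord \<and> t \<noteq> anti_mono J" using t by (simp add: is_lead_monomial_def)
  qed (use f in \<open>auto simp: cone_ideal_def\<close>)
  then obtain h where h: "f - h \<in> cone_ideal d n r" "\<And>s. s \<in> Poly_Mapping.keys h \<Longrightarrow> std_mono s"
    "(\<forall>t\<in>Poly_Mapping.keys f. \<not> ((s, t) \<in> ord \<and> s \<noteq> t)) \<longrightarrow> Poly_Mapping.lookup h s = Poly_Mapping.lookup f s"
    using std by blast
  have "f - (f - h) \<in> cone_ideal d n r" by (rule mpoly_ideal_diff[OF cone_ideal_ideal f h(1)])
  hence "h = 0" by (intro std_cone_ideal h(2)) simp_all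
  moreover have "\<not> ((s, t) \<in> ord \<and> s \<noteq> t)" if "t \<in> Poly_Mapping.keys f" for t
    using s that as by (auto simp: is_lead_monomial_def dest: antisymD)
  ultimately have "Poly_Mapping.lookup f s = 0" using h(3) by simp
  thus False using sk by (simp add: in_keys_iff)
qed

end

section \<open>Hilbert polynomial\<close>

lemma lookup_mscale: "Poly_Mapping.lookup (mscale a f) s = a * Poly_Mapping.lookup f s"
  by (simp add: mscale_def mconst_def lookup_single_0_mult)

text \<open>The coefficients at the monomials of \<open>M\<close> are dual to \<open>b\<close>. This
  is applied to all forms with \<open>b t\<close> a monomial, and to the forms in the ideal with
  \<open>b t\<close> a nonstandard monomial minus its remainder.\<close>

lemma dim_eq_card_monomials:
  fixes b :: "monomial \<Rightarrow> 'a::field mpoly"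
  assumes M: "finite M"
    and dual: "\<And>s t. s \<in> M \<Longrightarrow> t \<in> M \<Longrightarrow> Poly_Mapping.lookup (b t) s = (if s = t then 1 else 0)"
    and sub: "\<And>t. t \<in> M \<Longrightarrow> b t \<in> W"
    and span: "\<And>f. f \<in> W \<Longrightarrow> f = (\<Sum>t\<in>M. mscale (Poly_Mapping.lookup f t) (b t))"
  shows "vector_space.dim mscale W = card M"
proof -
  interpret vs: vector_space "mscale :: 'a \<Rightarrow> 'a mpoly \<Rightarrow> 'a mpoly" by (rule mscale_vector_space)
  have inj: "inj_on b M"
  proof (rule inj_onI)
    fix s t assume "s \<in> M" "t \<in> M" "b s = b t"
    thus "s = t" using dual[of s s] dual[of s t] by (simp split: if_splits)
  qed
  show ?thesis
  proof (rule vs.dim_unique[of "b ` M"])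
    show "b ` M \<subseteq> W" using sub by blast
    show "W \<subseteq> vs.span (b ` M)"
    proof
      fix f assume "f \<in> W"
      have "(\<Sum>t\<in>M. mscale (Poly_Mapping.lookup f t) (b t)) \<in> vs.span (b ` M)"
        by (intro vs.span_sum vs.span_scale vs.span_base) auto
      thus "f \<in> vs.span (b ` M)" using span[OF \<open>f \<in> W\<close>] by simp
    qed
    show "vs.independent (b ` M)"
    proof
      assume "vs.dependent (b ` M)"
      then obtain u t where t: "t \<in> M" "u (b t) \<noteq> 0" and sum: "(\<Sum>v\<in>b ` M. mscale (u v) v) = 0"
        using M by (auto simp: vs.dependent_finite)
      have "0 = Poly_Mapping.lookup (\<Sum>v\<in>b ` M. mscale (u v) v) t" using sum by simp
      also have "\<dots> = (\<Sum>s\<in>M. u (b s) * Poly_Mapping.lookup (b s) t)"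
        by (simp add: sum.reindex[OF inj] lookup_sum lookup_mscale)
      also have "\<dots> = (\<Sum>s\<in>M. if s = t then u (b s) else 0)"
        by (rule sum.cong) (use dual[OF t(1)] in auto)
      also have "\<dots> = u (b t)" using M t(1) by simp
      finally show False using t(2) by simp
    qed
    show "card (b ` M) = card M" by (rule card_image[OF inj])
  qed
qed

lemma lookup_restrict_mono:
  "finite V \<Longrightarrow> Poly_Mapping.lookup (restrict_mono V s) i = (if i \<in> V then Poly_Mapping.lookup s i else 0)"
  by (simp add: restrict_mono_def lookup_sum lookup_single when_def)

text \<open>A monomial factors uniquely into a \<open>V\<close> part of degree \<open>j\<close> and
  a \<open>W\<close> part; \<open>n \<le> k\<close> keeps \<open>k - j\<close> from being
  truncated.\<close>

lemma card_monomials_on_split: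
  assumes V: "finite V" "finite W" "V \<inter> W = {}" and k: "n \<le> k"
  shows "card {s \<in> monomials_on (V \<union> W) k. deg_in V s \<le> n} =
    (\<Sum>j\<le>n. card (monomials_on V j) * card (monomials_on W (k - j)))"
proof -
  let ?P = "\<lambda>j. monomials_on V j \<times> monomials_on W (k - j)"
  have low: "deg_in V b = j" if "b \<in> monomials_on V j" for b j
    using that mono_degree_eq_deg_in[OF V(1), of b] by (simp add: monomials_on_def)
  have zero: "Poly_Mapping.lookup f i = 0" if "f \<in> monomials_on U j" "i \<notin> U" for f i U j
    using that by (auto simp: monomials_on_def in_keys_iff)
  have high: "deg_in V f = 0" if "f \<in> monomials_on W j" for f j
    unfolding deg_in_def using zero[OF that] V(3) by (intro sum.neutral) auto
  have "{s \<in> monomials_on (V \<union> W) k. deg_in V s \<le> n} = (\<Union>j\<le>n. (\<lambda>(b, f). b + f) ` ?P j)"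
  proof (intro equalityI subsetI)
    fix s assume s: "s \<in> {s \<in> monomials_on (V \<union> W) k. deg_in V s \<le> n}"
    have eq: "s = restrict_mono V s + restrict_mono W s"
    proof (rule poly_mapping_eqI)
      fix i
      show "Poly_Mapping.lookup s i = Poly_Mapping.lookup (restrict_mono V s + restrict_mono W s) i"
        using zero[of s "V \<union> W" k i] s V by (auto simp: lookup_add lookup_restrict_mono)
    qed
    hence "mono_degree s = mono_degree (restrict_mono V s) + mono_degree (restrict_mono W s)"
      by (metis mono_degree_add)
    hence "mono_degree (restrict_mono W s) = k - deg_in V s"
      using s by (auto simp: monomials_on_def mono_degree_restrict_mono)
    hence "(restrict_mono V s, restrict_mono W s) \<in> ?P (deg_in V s)"
      by (simp add: monomials_on_def keys_restrict_mono mono_degree_restrict_mono[of V])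
    hence "s \<in> (\<lambda>(b, f). b + f) ` ?P (deg_in V s)" using eq by (intro image_eqI) auto
    thus "s \<in> (\<Union>j\<le>n. (\<lambda>(b, f). b + f) ` ?P j)" using s by blast
  next
    fix s assume "s \<in> (\<Union>j\<le>n. (\<lambda>(b, f). b + f) ` ?P j)"
    then obtain j b f where j: "j \<le> n" "b \<in> monomials_on V j" "f \<in> monomials_on W (k - j)" "s = b + f" by auto
    thus "s \<in> {s \<in> monomials_on (V \<union> W) k. deg_in V s \<le> n}"
      using k low[OF j(2)] high[OF j(3)] keys_add[of b f]
      by (auto simp: monomials_on_def mono_degree_add deg_in_add)
  qed
  also have "card \<dots> = (\<Sum>j\<le>n. card ((\<lambda>(b, f). b + f) ` ?P j))"
  proof (rule card_UN_disjoint)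
    have "deg_in V s = j" if "s \<in> (\<lambda>(b, f). b + f) ` ?P j" for s j
      using that low high by (auto simp: deg_in_add)
    thus "\<forall>i\<in>{..n}. \<forall>j\<in>{..n}. i \<noteq> j \<longrightarrow> (\<lambda>(b, f). b + f) ` ?P i \<inter> (\<lambda>(b, f). b + f) ` ?P j = {}"
      by blast
  qed (use V in auto)
  also have "\<dots> = (\<Sum>j\<le>n. card (monomials_on V j) * card (monomials_on W (k - j)))"
  proof (rule sum.cong)
    fix j
    have "inj_on (\<lambda>(b, f). b + f) (?P j)"
    proof (rule inj_onI, clarify)
      fix b f b' f'
      assume m: "b \<in> monomials_on V j" "f \<in> monomials_on W (k - j)"
        "b' \<in> monomials_on V j" "f' \<in> monomials_on W (k - j)" and eq: "b + f = b' + f'"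
      have "b = b'"
      proof (rule poly_mapping_eqI)
        fix i
        have "Poly_Mapping.lookup b i + Poly_Mapping.lookup f i = Poly_Mapping.lookup b' i + Poly_Mapping.lookup f' i"
          using eq by (metis lookup_add)
        thus "Poly_Mapping.lookup b i = Poly_Mapping.lookup b' i"
          using zero[OF m(1), of i] zero[OF m(2), of i] zero[OF m(3), of i] zero[OF m(4), of i] V(3)
          by (cases "i \<in> V"; cases "i \<in> W") auto
      qed
      thus "b = b' \<and> f = f'" using eq by simp
    qed
    thus "card ((\<lambda>(b, f). b + f) ` ?P j) = card (monomials_on V j) * card (monomials_on W (k - j))"
      by (simp add: card_image card_cartesian_product)
  qed simp
  finally show ?thesis .
qed

text \<open>The number of monomials of degree \<open>k - j\<close> in \<open>e + 1\<close>
  variables, as a polynomial in \<open>k\<close>.\<close>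

definition binomial_poly :: "nat \<Rightarrow> nat \<Rightarrow> rat poly" where
  "binomial_poly e j = Polynomial.smult (1 / fact e) (\<Prod>i<e. [:of_nat e - of_nat j - of_nat i, 1:])"

lemma degree_binomial_poly: "degree (binomial_poly e j) = e"
  and coeff_binomial_poly: "coeff (binomial_poly e j) e = 1 / fact e"
proof -
  have deg: "degree (\<Prod>i<e. [:of_nat e - of_nat j - of_nat i, 1 :: rat:]) = e"
    by (subst degree_prod_eq_sum_degree) auto
  have "lead_coeff (\<Prod>i<e. [:of_nat e - of_nat j - of_nat i, 1 :: rat:]) = 1"
    by (simp add: lead_coeff_prod)
  thus "degree (binomial_poly e j) = e" "coeff (binomial_poly e j) e = 1 / fact e"
    using deg by (simp_all add: binomial_poly_def)
qed

lemma poly_binomial_poly: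
  assumes "j \<le> k"
  shows "poly (binomial_poly e j) (of_nat k) = of_nat ((k - j + e) choose e)"
proof -
  have "of_nat ((k - j + e) choose e) = (of_nat (k - j + e) gchoose e :: rat)"
    by (rule binomial_gbinomial)
  also have "\<dots> = (\<Prod>i = 0..<e. of_nat (k - j + e) - of_nat i) / fact e"
    by (rule gbinomial_prod_rev)
  also have "\<dots> = poly (binomial_poly e j) (of_nat k)"
    using assms by (simp add: binomial_poly_def poly_prod atLeast0LessThan of_nat_diff algebra_simps)
  finally show ?thesis ..
qed

context hankel_setup
begin

lemma reduce_monomial_cone:
  assumes "t \<in> monomials r"
  shows "\<exists>h. Poly_Mapping.single t (1 :: 'k::real_field) - h \<in> cone_ideal d n r \<and>
    (\<forall>s\<in>Poly_Mapping.keys h. std_mono s \<and> mono_degree s = mono_degree t)"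
proof -
  have "\<exists>h. Poly_Mapping.single t (1 :: 'k) - h \<in> cone_ideal d n r \<and> (std_mono t \<longrightarrow> h = Poly_Mapping.single t 1) \<and>
    (\<forall>s\<in>Poly_Mapping.keys h. std_mono s \<and> mono_degree s = mono_degree t \<and> (s = t \<or> anti_weight t < anti_weight s))"
    by (rule reduce_monomial[OF cone_ideal_ideal hankel_minors_cone_ideal _ _ _ _ assms])
       (use hankel_minor_keys(3) in \<open>auto simp: weight_add\<close>)
  thus ?thesis by blast
qed

text \<open>The forms of degree \<open>k\<close> in the ideal have a basis indexed by the
  nonstandard monomials. Reduction preserves the degree, so each basis element is homogeneous; the
  standard monomials make up the difference of dimensions.\<close>

lemma hilbert_function_cone_ideal:
  "hilbert_function r (cone_ideal d n r :: 'k::real_field mpoly set) k =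
     card {s \<in> monomials_on {..r} k. deg_in middle s \<le> n}"
proof -
  let ?I = "cone_ideal d n r :: 'k mpoly set"
  define M where "M = monomials_on {..r} k"
  define B where "B = {s \<in> M. \<not> deg_in middle s \<le> n}"
  have fin: "finite M" "finite B" by (simp_all add: M_def B_def)
  have Mr: "M \<subseteq> monomials r" by (auto simp: M_def monomials_on_def monomials_def)
  have keysM: "Poly_Mapping.keys f \<subseteq> M" if "f \<in> forms r k" for f :: "'k mpoly"
    using that by (auto simp: forms_def M_def mpoly_ring_simps homogeneous_def monomials_on_def monomials_def)
  have expand: "(\<Sum>t\<in>M. mscale (Poly_Mapping.lookup f t) (Poly_Mapping.single t 1)) = f"
    if "f \<in> forms r k" for f :: "'k mpoly"
  proof (rule poly_mapping_eqI)
    fix s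
    have "Poly_Mapping.lookup f s = 0" if "s \<notin> M"
      using keysM[OF \<open>f \<in> forms r k\<close>] that by (auto simp: in_keys_iff)
    thus "Poly_Mapping.lookup (\<Sum>t\<in>M. mscale (Poly_Mapping.lookup f t) (Poly_Mapping.single t 1)) s = Poly_Mapping.lookup f s"
      using fin(1) by (auto simp: lookup_sum lookup_mscale lookup_single when_def if_distrib cong: if_cong)
  qed
  have "vector_space.dim mscale (forms r k :: 'k mpoly set) = card M"
  proof (rule dim_eq_card_monomials[of M "\<lambda>t. Poly_Mapping.single t 1", OF fin(1)])
    show "Poly_Mapping.single t 1 \<in> forms r k" if "t \<in> M" for t
      using that Mr by (auto simp: forms_def single_in_carrier homogeneous_def M_def monomials_on_def)
    show "f = (\<Sum>t\<in>M. mscale (Poly_Mapping.lookup f t) (Poly_Mapping.single t 1))" if "f \<in> forms r k" for f :: "'k mpoly"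
      using expand[OF that] by simp
  qed (auto simp: lookup_single when_def)
  moreover have "vector_space.dim mscale (forms r k \<inter> ?I) = card B"
  proof -
    have "\<forall>t\<in>B. \<exists>h. Poly_Mapping.single t 1 - h \<in> ?I \<and>
        (\<forall>s\<in>Poly_Mapping.keys h. std_mono s \<and> mono_degree s = mono_degree t)"
      using reduce_monomial_cone Mr by (auto simp: B_def)
    then obtain H :: "monomial \<Rightarrow> 'k mpoly" where H: "\<And>t. t \<in> B \<Longrightarrow> Poly_Mapping.single t 1 - H t \<in> ?I"
      "\<And>t s. t \<in> B \<Longrightarrow> s \<in> Poly_Mapping.keys (H t) \<Longrightarrow> std_mono s \<and> mono_degree s = mono_degree t"
      by metis
    have HB: "Poly_Mapping.lookup (H t) s = 0" if "t \<in> B" "s \<in> B" for s t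
      using H(2)[OF that(1), of s] that(2) by (auto simp: B_def std_mono_def in_keys_iff)
    define b where "b t = Poly_Mapping.single t 1 - H t" for t
    show ?thesis
    proof (rule dim_eq_card_monomials[of B b, OF fin(2)])
      show "Poly_Mapping.lookup (b t) s = (if s = t then 1 else 0)" if "s \<in> B" "t \<in> B" for s t
        using HB[OF that(2,1)] by (auto simp: b_def lookup_minus lookup_single when_def)
      show "b t \<in> forms r k \<inter> ?I" if t: "t \<in> B" for t
      proof -
        have bI: "b t \<in> ?I" using H(1)[OF t] by (simp add: b_def)
        have "homogeneous k (b t)"
          using H(2)[OF t] t keys_diff[of "Poly_Mapping.single t 1" "H t"]
          by (auto simp: homogeneous_def b_def B_def M_def monomials_on_def split: if_splits)
        thus ?thesis using bI mpoly_ideal_carrier[OF cone_ideal_ideal bI] by (simp add: forms_def)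
      qed
      fix f assume f: "f \<in> forms r k \<inter> ?I"
      \<comment> \<open>Subtraction clears all nonstandard coefficients, so \<open>g\<close> is a
        standard element of the ideal and must be zero.\<close>
      define g where "g = f - (\<Sum>t\<in>B. mscale (Poly_Mapping.lookup f t) (b t))"
      have "(\<Sum>t\<in>B. mscale (Poly_Mapping.lookup f t) (b t)) \<in> ?I"
        unfolding mscale_def mconst_def
        by (intro mpoly_ideal_sum[OF cone_ideal_ideal] mpoly_ideal_scale[OF cone_ideal_ideal])
           (use H(1) in \<open>simp add: b_def\<close>)
      hence gI: "g \<in> ?I" unfolding g_def using f by (intro mpoly_ideal_diff[OF cone_ideal_ideal]) auto
      have "std_mono s" if s: "s \<in> Poly_Mapping.keys g" for s
      proof (rule ccontr)
        assume ns: "\<not> std_mono s"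
        have "s \<in> monomials r" using s mpoly_ideal_carrier[OF cone_ideal_ideal gI] by (auto simp: mpoly_ring_simps)
        hence big: "\<not> deg_in middle s \<le> n" using ns by (simp add: std_mono_def)
        have "Poly_Mapping.lookup (b t) s = (if s = t then 1 else 0)" if "t \<in> B" for t
          using H(2)[OF that, of s] ns by (auto simp: b_def lookup_minus lookup_single when_def in_keys_iff)
        hence "Poly_Mapping.lookup g s = Poly_Mapping.lookup f s - (\<Sum>t\<in>B. if s = t then Poly_Mapping.lookup f t else 0)"
          unfolding g_def lookup_minus lookup_sum lookup_mscale
          by (intro arg_cong2[where f = minus] sum.cong) auto
        also have "\<dots> = 0"
        proof (cases "s \<in> B")
          case False
          hence "s \<notin> M" using big by (simp add: B_def)
          hence "Poly_Mapping.lookup f s = 0" using keysM[of f] f by (auto simp: in_keys_iff)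
          thus ?thesis using fin(2) False by simp
        qed (use fin(2) in simp)
        finally show False using s by (simp add: in_keys_iff)
      qed
      hence "g = 0" by (rule std_cone_ideal[OF _ gI])
      thus "f = (\<Sum>t\<in>B. mscale (Poly_Mapping.lookup f t) (b t))" by (simp add: g_def)
    qed
  qed
  moreover have "card M - card B = card {s \<in> M. deg_in middle s \<le> n}"
  proof -
    have "{s \<in> M. deg_in middle s \<le> n} = M - B" by (auto simp: B_def)
    thus ?thesis using fin by (simp add: card_Diff_subset B_def)
  qed
  ultimately show ?thesis by (simp add: hilbert_function_def M_def)
qed

text \<open>There are \<open>e + 1\<close> outer variables. All \<open>binomial_poly e j\<close>
  have leading coefficient \<open>1 / fact e\<close>, so the degree of the variety is the number of
  monomials of degree at most \<open>n\<close> in the middle variables.\<close>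

lemma hilbert_polynomial_cone_ideal:
  defines "e \<equiv> 2 * n - d - 1"
  defines "p \<equiv> (\<Sum>j\<le>n. Polynomial.smult (of_nat (card (monomials_on middle j))) (binomial_poly e j))"
  shows "hilbert_polynomial r (cone_ideal d n r :: 'k::real_field mpoly set) p"
    and "fact (degree p) * lead_coeff p = of_nat ((r - n + d + 1) choose n)"
proof -
  let ?outer = "{..r} - middle"
  have out: "card ?outer = Suc e"
  proof -
    have "card ?outer = Suc r - card middle" by (subst card_Diff_subset) auto
    thus ?thesis using d_less r_ge by (simp add: e_def)
  qed
  have co: "card (monomials_on ?outer l) = (l + e) choose e" for l
    using binomial_symmetric[of e "l + e"] out by (simp add: card_monomials_on add.commute)
  have "of_nat (hilbert_function r (cone_ideal d n r :: 'k mpoly set) k) = poly p (of_nat k)" if k: "n \<le> k" for k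
  proof -
    have un: "middle \<union> ?outer = {..r}" by auto
    have "hilbert_function r (cone_ideal d n r :: 'k mpoly set) k =
        (\<Sum>j\<le>n. card (monomials_on middle j) * card (monomials_on ?outer (k - j)))"
      using card_monomials_on_split[of middle ?outer n k] k
      unfolding un by (simp only: hilbert_function_cone_ideal) auto
    also have "of_nat \<dots> = poly p (of_nat k)"
      unfolding p_def poly_sum of_nat_sum
      by (rule sum.cong) (use k in \<open>simp_all add: co poly_binomial_poly\<close>)
    finally show ?thesis .
  qed
  thus "hilbert_polynomial r (cone_ideal d n r :: 'k mpoly set) p"
    unfolding hilbert_polynomial_def eventually_sequentially by blast
  have cp: "coeff p e = of_nat ((r - n + d + 1) choose n) / fact e"
  proof -
    have "coeff p e = of_nat (\<Sum>j\<le>n. card (monomials_on middle j)) / fact e"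
      by (simp add: p_def coeff_sum coeff_binomial_poly sum_divide_distrib)
    also have "(\<Sum>j\<le>n. card (monomials_on middle j)) = card (\<Union>j\<le>n. monomials_on middle j)"
      by (rule card_UN_disjoint[symmetric]) (use monomials_on_disjoint in auto)
    also have "\<dots> = (r + d - n + 1) choose n"
      unfolding card_monomials_on_le[OF finite_atLeastAtMost] card_middle ..
    also have "r + d - n + 1 = r - n + d + 1" using d_less r_ge by simp
    finally show ?thesis .
  qed
  have "degree p \<le> e"
    unfolding p_def by (rule degree_sum_le) (auto intro: order_trans[OF degree_smult_le] simp: degree_binomial_poly)
  moreover have "coeff p e \<noteq> 0" using d_less r_ge unfolding cp by simp
  ultimately have "degree p = e" by (simp add: le_degree antisym)
  thus "fact (degree p) * lead_coeff p = of_nat ((r - n + d + 1) choose n)"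
    by (simp add: cp)
qed

end

section \<open>The moment variety\<close>

lemma moment_variety_in_proj_space:
  assumes "d < n"
  shows "(moment_variety d n r :: (nat \<Rightarrow> 'k::field_char_0) set set) \<subseteq> proj_space r"
proof -
  have "zariski_closed r (proj_space r :: (nat \<Rightarrow> 'k) set set)"
    unfolding zariski_closed_def by (rule exI[of _ "{}"]) (auto simp: zero_locus_def)
  thus ?thesis
    using moment_points_in_proj_space[OF assms, of r] by (auto simp: moment_variety_def zariski_closure_def)
qed

context hankel_setup
begin

lemma extend_scalars_hankel_minor:
  assumes J: "J \<in> maximal_column_sets d n r"
  shows "extend_scalars (det (hankel_submatrix d n r J)) =
    (det (hankel_submatrix d n r J) :: 'k::real_field mpoly)"
proof -
  interpret ex: comm_ring_hom "extend_scalars :: _ \<Rightarrow> 'k mpoly"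
    by (rule comm_ring_hom_extend_scalars)
  have "extend_scalars (hankel_entry d k) = (hankel_entry d k :: 'k mpoly)" for k
    by (rule poly_mapping_eqI) (simp add: hankel_entry_eq lookup_single when_def)
  hence "map_mat extend_scalars (hankel_submatrix d n r J) = (hankel_submatrix d n r J :: 'k mpoly mat)"
    unfolding hankel_submatrix_eq[OF J] by (intro eq_matI) auto
  thus ?thesis using ex.hom_det[of "hankel_submatrix d n r J"] by simp
qed

lemma extend_scalars_hankel_minors:
  "extend_scalars ` hankel_minors d n r = (hankel_minors d n r :: 'k::real_field mpoly set)"
  unfolding hankel_minors_def image_image by (rule image_cong) (simp_all add: extend_scalars_hankel_minor)

text \<open>Restriction to real parameters gives one inclusion. The other goes through generators:
  the minors have integer coefficients, so after extension of scalars they vanish on the variety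
  over \<open>'k\<close>.\<close>

lemma real_vanishing_ideal_moment_variety:
  "real_vanishing_ideal r (moment_variety d n r :: (nat \<Rightarrow> 'k::real_field) set set) = cone_ideal d n r"
proof
  let ?I = "{f \<in> carrier (mpoly_ring r). (extend_scalars f :: 'k mpoly) \<in> cone_ideal d n r}"
  interpret ex: comm_ring_hom "extend_scalars :: _ \<Rightarrow> 'k mpoly"
    by (rule comm_ring_hom_extend_scalars)
  have I: "real_vanishing_ideal r (moment_variety d n r :: (nat \<Rightarrow> 'k) set set) = ?I"
    by (simp add: real_vanishing_ideal_def vanishing_ideal_moment_variety[OF d_less])
  show "real_vanishing_ideal r (moment_variety d n r :: (nat \<Rightarrow> 'k) set set) \<subseteq> cone_ideal d n r"
  proof
    fix f assume "f \<in> real_vanishing_ideal r (moment_variety d n r :: (nat \<Rightarrow> 'k) set set)"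
    hence f: "f \<in> carrier (mpoly_ring r)" "(extend_scalars f :: 'k mpoly) \<in> cone_ideal d n r"
      unfolding I by auto
    have "mpoly_eval (moment_vec (\<lambda>c. c) d n u a) f = 0" for u a
    proof -
      have "moment_vec (\<lambda>c. c) d n (\<lambda>j. of_real (u j)) (\<lambda>k. of_real (a k)) =
          (\<lambda>i. of_real (moment_vec (\<lambda>c. c) d n u a i) :: 'k)"
        unfolding comm_ring_hom.hom_moment_vec[OF comm_ring_hom_of_real]
        by (rule ext) (simp add: moment_vec_def)
      moreover have "mpoly_eval (moment_vec (\<lambda>c. c) d n (\<lambda>j. of_real (u j)) (\<lambda>k. of_real (a k)) :: nat \<Rightarrow> 'k) (extend_scalars f) = 0"
        using f(2) by (simp add: cone_ideal_def)
      ultimately have "of_real (mpoly_eval (moment_vec (\<lambda>c. c) d n u a) f) = (0 :: 'k)"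
        by (simp only: mpoly_eval_of_real)
      thus ?thesis by simp
    qed
    thus "f \<in> cone_ideal d n r" using f(1) by (simp add: cone_ideal_def)
  qed
  interpret R: cring "mpoly_ring r :: real mpoly ring" by (rule mpoly_ring_cring)
  have ec: "(extend_scalars g :: 'k mpoly) \<in> carrier (mpoly_ring r)" if "g \<in> carrier (mpoly_ring r)" for g
    using that by (simp add: mpoly_ring_simps)
  have "ideal ?I (mpoly_ring r)"
  proof (rule mpoly_idealI)
    fix f g :: "real mpoly" assume f: "f \<in> ?I"
    show "f + g \<in> ?I" if "g \<in> ?I"
    proof -
      have "(extend_scalars f + extend_scalars g :: 'k mpoly) \<in> cone_ideal d n r"
        by (rule mpoly_ideal_add[OF cone_ideal_ideal]) (use f that in simp_all)
      thus ?thesis using f that R.a_closed[of f g] by (simp add: mpoly_ring_simps(3) ex.hom_add)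
    qed
    show "g * f \<in> ?I" if "g \<in> carrier (mpoly_ring r)"
    proof -
      have "(extend_scalars g * extend_scalars f :: 'k mpoly) \<in> cone_ideal d n r"
        by (rule mpoly_ideal_mult[OF cone_ideal_ideal]) (use f ec[OF that] in simp_all)
      thus ?thesis using f that R.m_closed[of g f] by (simp add: mpoly_ring_simps(2) ex.hom_mult)
    qed
  next
    show "0 \<in> ?I" using mpoly_ideal_0[OF cone_ideal_ideal] by (simp add: mpoly_ring_simps(1))
  qed auto
  moreover have "hankel_minors d n r \<subseteq> ?I"
  proof
    fix f :: "real mpoly" assume f: "f \<in> hankel_minors d n r"
    hence "(extend_scalars f :: 'k mpoly) \<in> hankel_minors d n r"
      unfolding extend_scalars_hankel_minors[where 'k = 'k, symmetric] by blast
    thus "f \<in> ?I" using f hankel_minors_carrier hankel_minors_cone_ideal by blast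
  qed
  ultimately show "cone_ideal d n r \<subseteq> real_vanishing_ideal r (moment_variety d n r :: (nat \<Rightarrow> 'k) set set)"
    unfolding I cone_ideal_eq_genideal[where 'k = real] by (rule mpoly_genideal_minimal)
qed

text \<open>The real ideal contains the minors, which generate the ideal over \<open>'k\<close>, so
  its zeros are zeros of the whole ideal over \<open>'k\<close>. The equations of any closed set
  containing the parametrised points belong to that ideal.\<close>

lemma zero_locus_cone_ideal:
  "zero_locus r (extend_scalars ` cone_ideal d n r) = (moment_variety d n r :: (nat \<Rightarrow> 'k::real_field) set set)"
proof (intro equalityI subsetI)
  fix P :: "(nat \<Rightarrow> 'k) set" assume P: "P \<in> moment_variety d n r"
  have "mpoly_eval v (extend_scalars f) = 0" if "f \<in> cone_ideal d n r" "v \<in> P" for f v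
    using that P
    unfolding real_vanishing_ideal_moment_variety[where 'k = 'k, symmetric]
    by (auto simp: real_vanishing_ideal_def vanishing_ideal_def)
  thus "P \<in> zero_locus r (extend_scalars ` cone_ideal d n r)"
    using P moment_variety_in_proj_space[OF d_less] by (auto simp: zero_locus_def)
next
  fix P :: "(nat \<Rightarrow> 'k) set" assume P: "P \<in> zero_locus r (extend_scalars ` cone_ideal d n r)"
  have van: "mpoly_eval v f = 0" if f: "f \<in> cone_ideal d n r" and v: "v \<in> P" for f v
  proof -
    have "hankel_minors d n r \<subseteq> {f \<in> carrier (mpoly_ring r). mpoly_eval v f = 0}"
    proof
      fix g :: "'k mpoly" assume g: "g \<in> hankel_minors d n r"
      hence "g \<in> extend_scalars ` cone_ideal d n r"
        unfolding extend_scalars_hankel_minors[where 'k = 'k, symmetric] using hankel_minors_cone_ideal by blast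
      thus "g \<in> {f \<in> carrier (mpoly_ring r). mpoly_eval v f = 0}"
        using P v g hankel_minors_carrier by (auto simp: zero_locus_def)
    qed
    hence "cone_ideal d n r \<subseteq> {f \<in> carrier (mpoly_ring r). mpoly_eval v f = 0}"
      unfolding cone_ideal_eq_genideal[where 'k = 'k] by (rule mpoly_genideal_minimal[OF vanishing_at_ideal])
    thus ?thesis using f by blast
  qed
  show "P \<in> moment_variety d n r"
    unfolding moment_variety_def zariski_closure_def
  proof (rule InterI, clarify)
    fix X :: "(nat \<Rightarrow> 'k) set set" assume X: "zariski_closed r X" "moment_points d n r \<subseteq> X"
    then obtain F where F: "F \<subseteq> carrier (mpoly_ring r)" "X = zero_locus r F"
      by (auto simp: zariski_closed_def)
    have "f \<in> cone_ideal d n r" if "f \<in> F" for f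
      using that X(2) F by (intro cone_idealI[OF d_less]) (auto simp: zero_locus_def)
    thus "P \<in> X" using P van F(2) by (auto simp: zero_locus_def)
  qed
qed

lemma lead_monomials_hankel_minors:
  assumes ord: "antidiagonal_order d n r ord"
  shows "lead_monomials ord (hankel_minors d n r :: real mpoly set) = monomials_on middle (Suc n)"
proof -
  have as: "antisym ord"
    using ord by (auto simp: antidiagonal_order_def monomial_order_def linear_order_on_def partial_order_on_def)
  have "is_lead_monomial ord (det (hankel_submatrix d n r J) :: real mpoly) s \<longleftrightarrow> s = anti_mono J"
    if "J \<in> maximal_column_sets d n r" for J s
    using is_lead_monomial_hankel_minor[OF ord that] as by (auto simp: is_lead_monomial_def dest: antisymD)
  thus ?thesis
    unfolding anti_mono_image[symmetric] lead_monomials_def hankel_minors_def by blast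
qed

lemma initial_ideal_cone_ideal:
  assumes ord: "antidiagonal_order d n r ord"
  shows "initial_ideal r ord (cone_ideal d n r :: real mpoly set) = monomial_ideal r (monomials_on middle (Suc n))"
proof -
  let ?L = "lead_monomials ord (cone_ideal d n r :: real mpoly set)"
  have L: "?L \<subseteq> monomials r"
    by (auto simp: lead_monomials_def is_lead_monomial_def cone_ideal_def mpoly_ring_simps)
  have sub: "monomials_on middle (Suc n) \<subseteq> ?L"
    unfolding lead_monomials_hankel_minors[OF ord, symmetric] lead_monomials_def
    using hankel_minors_cone_ideal by blast
  have "divisible_by ?L t \<longleftrightarrow> divisible_by (monomials_on middle (Suc n)) t" for t
  proof
    assume "divisible_by ?L t"
    then obtain s u where "s \<in> ?L" "t = s + u" by (auto simp: divisible_by_def)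
    hence "Suc n \<le> deg_in middle t"
      using lead_monomial_cone_ideal[OF ord, of _ s] by (fastforce simp: lead_monomials_def deg_in_add)
    thus "divisible_by (monomials_on middle (Suc n)) t" by (simp add: divisible_by_monomials_on)
  next
    assume "divisible_by (monomials_on middle (Suc n)) t"
    thus "divisible_by ?L t" using sub unfolding divisible_by_def by blast
  qed
  thus ?thesis
    unfolding initial_ideal_def
    by (auto simp: monomial_ideal_iff[OF L] monomial_ideal_iff[OF monomials_on_monomials[OF middle_subset]])
qed

text \<open>All leading monomials have degree \<open>n + 1\<close>, so divisibility between two of
  them is equality, and distinct column sets have distinct antidiagonal monomials.\<close>

lemma minimal_groebner_basis_hankel_minors:
  assumes ord: "antidiagonal_order d n r ord"
  shows "minimal_groebner_basis r ord (cone_ideal d n r) (hankel_minors d n r :: real mpoly set)"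
proof -
  have as: "antisym ord"
    using ord by (auto simp: antidiagonal_order_def monomial_order_def linear_order_on_def partial_order_on_def)
  have lead: "s = anti_mono J"
    if "J \<in> maximal_column_sets d n r" "is_lead_monomial ord (det (hankel_submatrix d n r J) :: real mpoly) s" for J s
    using is_lead_monomial_hankel_minor[OF ord that(1)] that(2) as
    by (auto simp: is_lead_monomial_def dest: antisymD)
  have "groebner_basis r ord (cone_ideal d n r) (hankel_minors d n r :: real mpoly set)"
    unfolding groebner_basis_def initial_ideal_cone_ideal[OF ord] lead_monomials_hankel_minors[OF ord]
    using finite_maximal_column_sets hankel_minors_cone_ideal by (simp add: hankel_minors_def)
  moreover have "0 \<notin> (hankel_minors d n r :: real mpoly set)"
  proof
    assume "0 \<in> (hankel_minors d n r :: real mpoly set)"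
    then obtain J where J: "0 = (det (hankel_submatrix d n r J) :: real mpoly)" "J \<in> maximal_column_sets d n r"
      unfolding hankel_minors_def by (rule imageE)
    show False using anti_mono_in_keys[OF J(2), where 'a = real] unfolding J(1)[symmetric] by simp
  qed
  moreover have "f = g" if fg: "f \<in> hankel_minors d n r" "g \<in> hankel_minors d n r"
    and s: "is_lead_monomial ord f s" and t: "is_lead_monomial ord g (s + u)" for f g :: "real mpoly" and s u
  proof -
    obtain J K where J: "J \<in> maximal_column_sets d n r" "f = det (hankel_submatrix d n r J)"
      and K: "K \<in> maximal_column_sets d n r" "g = det (hankel_submatrix d n r K)"
      using fg unfolding hankel_minors_def by blast
    have sJ: "s = anti_mono J" by (rule lead[OF J(1) s[unfolded J(2)]])
    have tK: "s + u = anti_mono K" by (rule lead[OF K(1) t[unfolded K(2)]])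
    have "mono_degree s + mono_degree u = mono_degree s"
      by (simp only: mono_degree_add[symmetric] tK) (simp only: sJ perm_mono_degree)
    hence u0: "mono_degree u = 0" by simp
    have "Poly_Mapping.lookup u i = 0" for i
      using deg_in_le_mono_degree[of "{i}" u] u0 by (simp add: deg_in_def)
    hence "u = 0" by (intro poly_mapping_eqI) simp
    hence "anti_mono J = anti_mono K" using sJ tK by simp
    hence "J = K" by (rule inj_onD[OF anti_mono_inj _ J(1) K(1)])
    thus ?thesis using J K by simp
  qed
  ultimately show ?thesis unfolding minimal_groebner_basis_def by blast
qed

end

theorem theorem3p3:
  fixes d n r :: nat
  assumes "d \<ge> 1" and "n \<ge> d + 1" and "r \<ge> 2 * n - d"
  shows
    "let R = (mpoly_ring r :: real mpoly ring);
         M = (moment_variety d n r :: (nat \<Rightarrow> 'k::real_field) set set);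
         I = real_vanishing_ideal r M;
         G = hankel_minors d n r
     in homogeneous_ideal r I \<and> primeideal I R \<and> zero_locus r (extend_scalars ` I) = M \<and>
        I = genideal R G \<and>
        (\<forall>ord. antidiagonal_order d n r ord \<longrightarrow>
           minimal_groebner_basis r ord I G \<and>
           initial_ideal r ord I =
             genideal R (mvar ` {n - d..r - n}) [^]\<^bsub>ideals_set R\<^esub> (n + 1)) \<and>
        has_proj_degree r M ((r - n + d + 1) choose n)"
proof -
  interpret hankel_setup d n r
    by unfold_locales (use assms in auto)
  let ?I = "cone_ideal d n r :: real mpoly set"
  show ?thesis
    unfolding Let_def real_vanishing_ideal_moment_variety
  proof (intro conjI allI impI)
    show "homogeneous_ideal r ?I"
      unfolding homogeneous_ideal_def using cone_ideal_ideal cone_ideal_homogeneous by blast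
    show "primeideal ?I (mpoly_ring r)" by (rule cone_ideal_prime)
    show "zero_locus r (extend_scalars ` ?I) = (moment_variety d n r :: (nat \<Rightarrow> 'k) set set)"
      by (rule zero_locus_cone_ideal)
    show "?I = genideal (mpoly_ring r) (hankel_minors d n r)" by (rule cone_ideal_eq_genideal)
    show "has_proj_degree r (moment_variety d n r :: (nat \<Rightarrow> 'k) set set) ((r - n + d + 1) choose n)"
      unfolding has_proj_degree_def vanishing_ideal_moment_variety[OF d_less]
      using hilbert_polynomial_cone_ideal(1)[where 'k = 'k] hilbert_polynomial_cone_ideal(2)[symmetric]
      by blast
    fix ord assume ord: "antidiagonal_order d n r ord"
    show "minimal_groebner_basis r ord ?I (hankel_minors d n r)"
      by (rule minimal_groebner_basis_hankel_minors[OF ord])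
    show "initial_ideal r ord ?I =
        genideal (mpoly_ring r) (mvar ` middle) [^]\<^bsub>ideals_set (mpoly_ring r)\<^esub> (n + 1)"
      unfolding initial_ideal_cone_ideal[OF ord] genideal_mvar_power[OF middle_subset] by simp
  qed
qed

end
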